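(* Let $f:\mathbb{R}\to\mathbb{R}$ be a measurable function such that $f\in L^1(\mathbb{R})$ and, for some $\varepsilon\in(0,\frac12)$, $$\int_{\mathbb{R}}\int_{\mathbb{R}} |f(u)|\,|f(v)|\,|u-v|^{2\varepsilon-1}\,du\,dv<\infty .$$ Then, as $H\to 1$ (with $H<1$), the Wiener-Rosenblatt integral $\int_{\mathbb{R}} f(u)\,dZ^H(u)$ converges in distribution to $$\frac{1}{\sqrt2}\left(\int_{\mathbb{R}} f(u)\,du\right)(Z^2-1),\qquad Z\sim N(0,1).$$
   Context: Let $(B(y))_{y\in\mathbb{R}}$ be a Wiener process on a probability space $(\Omega,\mathcal{F},P)$ and let $I_2$ denote the multiple (Wiener-Itô) stochastic integral of order two with respect to $B$, normalized so that $\mathbf{E}[I_2(h)^2]=2\|h\|_{L^2(\mathbb{R}^2)}^2$ for symmetric $h\in L^2(\mathbb{R}^2)$. Write $x_+=\max(x,0)$. For $H\in(\frac12,1)$ let $c(H,2)>0$ be given by $$c(H,2)^2=\frac{H(2H-1)}{2\,\beta\left(\frac H2,1-H\right)^2},\qquad \beta(p,q)=\int_0^1 z^{p-1}(1-z)^{q-1}dz .$$ The Rosenblatt process with self-similarity index $H$ is $Z^H(t)=I_2(L^H_t)$, $t\ge0$, where $L^H_t(y_1,y_2)=c(H,2)\int_0^t (u-y_1)_+^{\frac H2-1}(u-y_2)_+^{\frac H2-1}du$. Let $\mathcal{H}_H$ be the set of functions $f:\mathbb{R}\to\mathbb{R}$ with $\|f\|^2_{\mathcal{H}_H}:=H(2H-1)\int_{\mathbb{R}}\int_{\mathbb{R}}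 f(u)f(v)|u-v|^{2H-2}\,du\,dv<\infty$, and $|\mathcal{H}_H|\subset\mathcal{H}_H$ the set of measurable $f$ with $\int_{\mathbb{R}}\int_{\mathbb{R}}|f(u)f(v)||u-v|^{2H-2}\,du\,dv<\infty$. For $f\in\mathcal{H}_H$ the Wiener-Rosenblatt integral is $$\int_{\mathbb{R}} f(u)\,dZ^H(u):=I_2(J_Hf),\qquad (J_Hf)(y_1,y_2)=c(H,2)\int_{\mathbb{R}} f(u)(u-y_1)_+^{\frac H2-1}(u-y_2)_+^{\frac H2-1}du .$$ (Under the hypotheses of the claim, $f\in|\mathcal{H}_H|$ for all $H\in[\frac12+\varepsilon,1)$, so the integral is defined for $H$ close to $1$.) *)

theory Defs
  imports "HOL-Probability.Probability"
begin

locale wiener_process = prob_space M for M :: "'a measure" +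
  fixes B :: "real \<Rightarrow> 'a \<Rightarrow> real"
  assumes measurable_B: "\<And>t. B t \<in> borel_measurable M"
    and start: "AE \<omega> in M. B 0 \<omega> = 0"
    and increments: "\<And>s t. s < t \<Longrightarrow>
      distributed M lborel (\<lambda>\<omega>. B t \<omega> - B s \<omega>) (normal_density 0 (sqrt (t - s)))"
    and indep_increments: "\<And>(n::nat) t. strict_mono_on {..n} t \<Longrightarrow>
      indep_vars (\<lambda>_. borel) (\<lambda>i \<omega>. B (t (Suc i)) \<omega> - B (t i) \<omega>) {..<n}"
    and continuous_paths: "AE \<omega> in M. continuous_on UNIV (\<lambda>t. B t \<omega>)"

(* Elementary kernels are step functions on the grid t 0 < ... < t n that vanish on the
   diagonal squares; no symmetry of the coefficients is required. *)

definition off_diagonal_grid :: "nat \<Rightarrow> (nat \<Rightarrow> real) \<Rightarrow> (nat \<Rightarrow> nat \<Rightarrow> real) \<Rightarrow> bool" where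
  "off_diagonal_grid n t a \<longleftrightarrow> strict_mono_on {..n} t \<and> (\<forall>i<n. a i i = 0)"

definition elementary_kernel ::
    "nat \<Rightarrow> (nat \<Rightarrow> real) \<Rightarrow> (nat \<Rightarrow> nat \<Rightarrow> real) \<Rightarrow> real \<times> real \<Rightarrow> real" where
  "elementary_kernel n t a = (\<lambda>(x, y). \<Sum>i<n. \<Sum>j<n.
     a i j * indicator {t i<..t (Suc i)} x * indicator {t j<..t (Suc j)} y)"

definition elementary_integral ::
    "(real \<Rightarrow> 'a \<Rightarrow> real) \<Rightarrow> nat \<Rightarrow> (nat \<Rightarrow> real) \<Rightarrow> (nat \<Rightarrow> nat \<Rightarrow> real) \<Rightarrow> 'a \<Rightarrow> real" where
  "elementary_integral B n t a = (\<lambda>\<omega>. \<Sum>i<n. \<Sum>j<n.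
     a i j * (B (t (Suc i)) \<omega> - B (t i) \<omega>) * (B (t (Suc j)) \<omega> - B (t j) \<omega>))"

(* X is a version of the double Wiener-Ito integral of h: the L2(M)-limit of the elementary
   integrals along elementary kernels converging to h in L2(R x R).  For symmetric h this is
   the normalization E[X^2] = 2 * (norm of h)^2. *)

definition has_double_wiener_integral ::
    "'a measure \<Rightarrow> (real \<Rightarrow> 'a \<Rightarrow> real) \<Rightarrow> (real \<times> real \<Rightarrow> real) \<Rightarrow> ('a \<Rightarrow> real) \<Rightarrow> bool" where
  "has_double_wiener_integral M B h X \<longleftrightarrow>
     h \<in> borel_measurable lebesgue \<and>
     (\<integral>\<^sup>+ z. ennreal ((h z)\<^sup>2) \<partial>lebesgue) < \<infinity> \<and>
     X \<in> borel_measurable M \<and>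
     (\<exists>n t a. (\<forall>k. off_diagonal_grid (n k) (t k) (a k)) \<and>
        (\<lambda>k. \<integral>\<^sup>+ z. ennreal ((h z - elementary_kernel (n k) (t k) (a k) z)\<^sup>2) \<partial>lebesgue)
          \<longlonglongrightarrow> 0 \<and>
        (\<lambda>k. \<integral>\<^sup>+ \<omega>. ennreal ((X \<omega> - elementary_integral B (n k) (t k) (a k) \<omega>)\<^sup>2) \<partial>M)
          \<longlonglongrightarrow> 0)"

(* For a Wiener process the integral is unique up to almost sure equality, so its
   distribution does not depend on the version chosen here. *)

definition double_wiener_integral ::
    "'a measure \<Rightarrow> (real \<Rightarrow> 'a \<Rightarrow> real) \<Rightarrow> (real \<times> real \<Rightarrow> real) \<Rightarrow> 'a \<Rightarrow> real" where
  "double_wiener_integral M B h = (SOME X. has_double_wiener_integral M B h X)"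

(* Beta from the library is Euler's beta integral for positive arguments, by
   has_integral_Beta_real. *)

definition rosenblatt_const :: "real \<Rightarrow> real" where
  "rosenblatt_const H = sqrt (H * (2 * H - 1) / (2 * (Beta (H / 2) (1 - H))\<^sup>2))"

(* The exponent H/2 - 1 is negative, but 0 powr p = 0 for every p, so that the integrand
   vanishes for u <= y1 and for u <= y2. *)

definition rosenblatt_kernel :: "real \<Rightarrow> (real \<Rightarrow> real) \<Rightarrow> real \<times> real \<Rightarrow> real" where
  "rosenblatt_kernel H f = (\<lambda>(y1, y2). rosenblatt_const H *
     (LINT u|lebesgue. f u * max (u - y1) 0 powr (H / 2 - 1) * max (u - y2) 0 powr (H / 2 - 1)))"

definition wiener_rosenblatt_integral ::
    "'a measure \<Rightarrow> (real \<Rightarrow> 'a \<Rightarrow> real) \<Rightarrow> real \<Rightarrow> (real \<Rightarrow> real) \<Rightarrow> 'a \<Rightarrow> real" where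
  "wiener_rosenblatt_integral M B H f = double_wiener_integral M B (rosenblatt_kernel H f)"

end

theory Submission
  imports Defs
begin

text \<open>
  Put $g_u(y) = (u - y)_+^{H/2-1}$ and $\beta = \beta(H/2, 1-H)$. Since
  $\langle g_u, g_v\rangle = \beta |u - v|^{H-1}$, all inner products of the vectors
  $c(H,2)^{1/2} g_u$ tend to $1/\sqrt 2$ as $H \to 1$: they become parallel. Hence the kernel
  $J_H f = c(H,2) \int f(u)\, g_u \otimes g_u\, du$ is asymptotically of rank one. With
  $e = c(H,2)^{1/2} \int_0^1 g_v\, dv$ and $F = \int f$, expanding the square and dominated
  convergence give $\|J_H f - F\, e \otimes e\| \to 0$ and $\|e\|^2 \to 1/\sqrt 2$.
  On the other hand $I_2(e \otimes e) = I_1(e)^2 - \|e\|^2$ has exactly the law of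
  $\|e\|^2 (Z^2 - 1)$, so the claim follows by the isometry and the continuity theorem for
  characteristic functions.
\<close>

section \<open>Approximation in the square-integrable functions\<close>

text \<open>A single g_u is not square integrable, because (u - y)_+^(H-2) diverges at y = u; only
  pairs u \<noteq> v have a finite inner product. Hence e averages over an interval, of length 1 so
  that its inner product with each c(H,2)^(1/2) g_u still tends to 1/sqrt 2. This value comes from
  c(H,2) \<beta> = sqrt (H (2H - 1) / 2), in which the blow-up of \<beta> at H = 1 cancels. The
  stochastic side is shaped by the integral being a chosen L2-limit of off-diagonal double sums. Its
  existence rests on the density of kernels that vanish on the diagonal squares and on the bound
  E[I_2(k)^2] \<le> 2 ||k||^2 for elementary k. The variable I_2(e \<otimes> e) is never formed: e
  is replaced by a step function s with simple integral Y, which is exactly normal with variance S =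
  ||s||^2. The double sum of s \<otimes> s without its diagonal differs from Y^2 - S by the sum of
  the s_i^2 (D_i^2 - v_i), where D_i is an increment and v_i its variance; this is small in L2 on a
  fine grid. The variables Y for different H need no relation to each other, since only their laws
  enter.\<close>

definition sq_norm :: "'a measure \<Rightarrow> ('a \<Rightarrow> real) \<Rightarrow> ennreal" where
  "sq_norm M f = (\<integral>\<^sup>+ x. ennreal ((f x)\<^sup>2) \<partial>M)"

lemma sq_norm_cong: "(\<And>x. x \<in> space M \<Longrightarrow> f x = g x) \<Longrightarrow> sq_norm M f = sq_norm M g"
  unfolding sq_norm_def by (intro nn_integral_cong) auto

lemma sq_norm_cong_AE: "AE x in M. f x = g x \<Longrightarrow> sq_norm M f = sq_norm M g"
  unfolding sq_norm_def by (intro nn_integral_cong_AE) auto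

lemma sq_norm_minus_commute: "sq_norm M (\<lambda>x. f x - g x) = sq_norm M (\<lambda>x. g x - f x)"
  unfolding sq_norm_def by (simp add: power2_commute)

lemma sq_norm_cmult:
  assumes [measurable]: "f \<in> borel_measurable M"
  shows "sq_norm M (\<lambda>x. c * f x) = ennreal (c\<^sup>2) * sq_norm M f"
  unfolding sq_norm_def by (simp add: power_mult_distrib ennreal_mult nn_integral_cmult)

lemma sq_norm_add_le:
  assumes [measurable]: "f \<in> borel_measurable M" "g \<in> borel_measurable M"
  shows "sq_norm M (\<lambda>x. f x + g x) \<le> 2 * sq_norm M f + 2 * sq_norm M g"
proof -
  have le: "(a + b)\<^sup>2 \<le> 2 * a\<^sup>2 + 2 * b\<^sup>2" for a b :: real
    using zero_le_power2[of "a - b"] by (simp add: power2_eq_square algebra_simps)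
  have "sq_norm M (\<lambda>x. f x + g x) \<le> (\<integral>\<^sup>+ x. 2 * ennreal ((f x)\<^sup>2) + 2 * ennreal ((g x)\<^sup>2) \<partial>M)"
    unfolding sq_norm_def
  proof (intro nn_integral_mono)
    fix x
    have "ennreal ((f x + g x)\<^sup>2) \<le> ennreal (2 * (f x)\<^sup>2 + 2 * (g x)\<^sup>2)"
      by (intro ennreal_leI le)
    then show "ennreal ((f x + g x)\<^sup>2) \<le> 2 * ennreal ((f x)\<^sup>2) + 2 * ennreal ((g x)\<^sup>2)"
      by (simp add: ennreal_mult)
  qed
  then show ?thesis
    by (simp add: sq_norm_def nn_integral_add nn_integral_cmult)
qed

text \<open>The squared norm is used without taking a root, so the triangle inequality costs factors
  2. All numerical constants in the L2 estimates below stem from these factors and from the factor 2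
  of the isometry.\<close>

lemma sq_norm_triangle:
  assumes "f \<in> borel_measurable M" "g \<in> borel_measurable M" "h \<in> borel_measurable M"
  shows "sq_norm M (\<lambda>x. f x - h x)
    \<le> 2 * sq_norm M (\<lambda>x. f x - g x) + 2 * sq_norm M (\<lambda>x. g x - h x)"
  using sq_norm_add_le[of "\<lambda>x. f x - g x" M "\<lambda>x. g x - h x"] assms by simp

lemma ennreal_quarter_less:
  fixes a b :: ennreal
  assumes "a < ennreal (d / 4)" "b < ennreal (d / 4)"
  shows "2 * a + 2 * b < ennreal d"
proof -
  obtain a' where a': "a = ennreal a'" "0 \<le> a'" "a' < d / 4"
    using assms(1) by (cases a) (auto simp: ennreal_less_iff)
  obtain b' where b': "b = ennreal b'" "0 \<le> b'" "b' < d / 4"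
    using assms(2) by (cases b) (auto simp: ennreal_less_iff)
  have "2 * a + 2 * b = ennreal (2 * a' + 2 * b')"
    using a' b' by (simp add: ennreal_mult)
  also have "\<dots> < ennreal d"
    using a' b' by (intro ennreal_lessI) auto
  finally show ?thesis .
qed

lemma tendsto_zero_ennreal_less:
  fixes u :: "nat \<Rightarrow> ennreal"
  assumes "u \<longlonglongrightarrow> 0" "0 < d"
  shows "\<exists>n. u n < d"
  using order_tendstoD(2)[OF assms] by (auto simp: eventually_sequentially)

text \<open>A density principle for a linear space \<open>V\<close>: it is enough to approximate
  indicators of a generating class that is closed under intersection and contains an exhaustion by
  sets of finite measure. It serves twice, for elementary kernels on the plane and for step
  functions on the line.\<close>

lemma square_integrable_approximation:
  fixes h :: "'a \<Rightarrow> real" and A :: "nat \<Rightarrow> 'a set"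
  assumes G: "Int_stable G" "G \<subseteq> Pow (space M)" "sets M = sigma_sets (space M) G"
    and A: "range A \<subseteq> G" "incseq A" "(\<Union>i. A i) = space M" "\<And>i. emeasure M (A i) < \<infinity>"
    and V: "V \<subseteq> borel_measurable M" "\<And>v w x y. v \<in> V \<Longrightarrow> w \<in> V \<Longrightarrow> (\<lambda>z. x * v z + y * w z) \<in> V"
    and approx: "\<And>S d. S \<in> G \<Longrightarrow> 0 < d \<Longrightarrow> \<exists>v\<in>V. sq_norm M (\<lambda>x. indicator S x - v x) < ennreal d"
    and h: "h \<in> borel_measurable M" "sq_norm M h < \<infinity>"
    and d: "0 < d"
  shows "\<exists>v\<in>V. sq_norm M (\<lambda>x. h x - v x) < ennreal d"
proof -
  define App where "App h \<longleftrightarrow> h \<in> borel_measurable M \<and>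
    (\<forall>d>0. \<exists>v\<in>V. sq_norm M (\<lambda>x. h x - v x) < ennreal d)" for h
  have [measurable]: "\<And>v. v \<in> V \<Longrightarrow> v \<in> borel_measurable M"
    using V(1) by auto
  \<comment> \<open>Approximable functions are closed under L2 limits, so every later step may be
    carried out up to an arbitrarily small error.\<close>
  have AppI: "App h" if [measurable]: "h \<in> borel_measurable M"
    and lim: "\<And>d. 0 < d \<Longrightarrow> \<exists>k. App k \<and> sq_norm M (\<lambda>x. h x - k x) < ennreal d" for h
    unfolding App_def
  proof safe
    fix d :: real assume "0 < d"
    then obtain k where k: "App k" "sq_norm M (\<lambda>x. h x - k x) < ennreal (d / 4)"
      using lim[of "d / 4"] by auto
    then obtain v where v: "v \<in> V" "sq_norm M (\<lambda>x. k x - v x) < ennreal (d / 4)"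
      using \<open>0 < d\<close> unfolding App_def by (meson divide_pos_pos zero_less_numeral)
    have [measurable]: "k \<in> borel_measurable M" "v \<in> borel_measurable M"
      using k v by (auto simp: App_def)
    have "sq_norm M (\<lambda>x. h x - v x) \<le> 2 * sq_norm M (\<lambda>x. h x - k x) + 2 * sq_norm M (\<lambda>x. k x - v x)"
      by (intro sq_norm_triangle) auto
    also have "\<dots> < ennreal d"
      using k v by (intro ennreal_quarter_less)
    finally show "\<exists>v\<in>V. sq_norm M (\<lambda>x. h x - v x) < ennreal d"
      using v by auto
  qed fact
  have App_add: "App (\<lambda>z. f z + g z)" if f: "App f" and g: "App g" for f g
    unfolding App_def
  proof safe
    have [measurable]: "f \<in> borel_measurable M" "g \<in> borel_measurable M"
      using f g by (auto simp: App_def)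
    show "(\<lambda>z. f z + g z) \<in> borel_measurable M" by measurable
    fix d :: real assume "0 < d"
    then have "0 < d / 4" by simp
    then obtain v w where vw: "v \<in> V" "sq_norm M (\<lambda>x. f x - v x) < ennreal (d / 4)"
      "w \<in> V" "sq_norm M (\<lambda>x. g x - w x) < ennreal (d / 4)"
      using f g unfolding App_def by meson
    then have [measurable]: "v \<in> borel_measurable M" "w \<in> borel_measurable M"
      by auto
    have "sq_norm M (\<lambda>x. f x + g x - (v x + w x)) = sq_norm M (\<lambda>x. (f x - v x) + (g x - w x))"
      by (simp add: algebra_simps)
    also have "\<dots> \<le> 2 * sq_norm M (\<lambda>x. f x - v x) + 2 * sq_norm M (\<lambda>x. g x - w x)"
      by (intro sq_norm_add_le) auto
    also have "\<dots> < ennreal d"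
      using vw by (intro ennreal_quarter_less)
    finally show "\<exists>v\<in>V. sq_norm M (\<lambda>x. f x + g x - v x) < ennreal d"
      using V(2)[OF vw(1,3), of 1 1] by auto
  qed
  have App_cmult: "App (\<lambda>z. c * f z)" if f: "App f" for f c
    unfolding App_def
  proof safe
    have [measurable]: "f \<in> borel_measurable M"
      using f by (auto simp: App_def)
    show "(\<lambda>z. c * f z) \<in> borel_measurable M" by measurable
    fix d :: real assume "0 < d"
    then have "0 < d / (c\<^sup>2 + 1)" by (simp add: add_nonneg_pos)
    then obtain v where v: "v \<in> V" "sq_norm M (\<lambda>x. f x - v x) < ennreal (d / (c\<^sup>2 + 1))"
      using f unfolding App_def by meson
    then have [measurable]: "v \<in> borel_measurable M"
      by auto
    obtain r where r: "sq_norm M (\<lambda>x. f x - v x) = ennreal r" "0 \<le> r" "r < d / (c\<^sup>2 + 1)"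
      using v(2) by (cases "sq_norm M (\<lambda>x. f x - v x)") (auto simp: ennreal_less_iff)
    have "sq_norm M (\<lambda>x. c * f x - c * v x) = sq_norm M (\<lambda>x. c * (f x - v x))"
      by (simp add: algebra_simps)
    also have "\<dots> = ennreal (c\<^sup>2 * r)"
      by (subst sq_norm_cmult) (auto simp: r ennreal_mult)
    also have "\<dots> < ennreal d"
    proof (intro ennreal_lessI \<open>0 < d\<close>)
      have "c\<^sup>2 * r \<le> r * (c\<^sup>2 + 1)" using r by (simp add: algebra_simps)
      also have "\<dots> < d" using r(3) by (simp add: pos_less_divide_eq add_nonneg_pos)
      finally show "c\<^sup>2 * r < d" .
    qed
    finally show "\<exists>v\<in>V. sq_norm M (\<lambda>x. c * f x - v x) < ennreal d"
      using V(2)[OF v(1) v(1), of c 0] by auto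
  qed
  have App_G: "App (indicator S)" if "S \<in> G" for S
  proof -
    have "S \<in> sets M" using that G(3) by auto
    then show ?thesis using approx[OF that] by (auto simp: App_def)
  qed
  have App_0: "App (\<lambda>_. 0)"
    using App_cmult[OF App_G[of "A 0"], of 0] A(1) by auto
  have App_sum: "App (\<lambda>z. \<Sum>i\<in>I. f i z)" if "finite I" "\<And>i. i \<in> I \<Longrightarrow> App (f i)"
    for I and f :: "'i \<Rightarrow> 'a \<Rightarrow> real"
    using that by (induction I rule: finite_induct) (auto intro: App_0 App_add)
  have A_sets [measurable]: "A i \<in> sets M" for i
    using A(1) G(3) by auto
  \<comment> \<open>The pi-lambda theorem carries the claim from \<open>G\<close> to all measurable
    sets. Cutting with \<open>A i\<close> keeps the measures finite, as continuity from above
    demands in the case of a disjoint union.\<close>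
  have App_ind: "App (indicator (S \<inter> A i))" if S: "S \<in> sets M" for S i
    using G(1,2) S[unfolded G(3)]
  proof (induction S rule: sigma_sets_induct_disjoint)
    case (basic S)
    then have "S \<inter> A i \<in> G" using A(1) G(1) by (auto simp: Int_stable_def)
    then show ?case by (rule App_G)
  next
    case empty
    then show ?case using App_0 by (simp add: indicator_def[abs_def])
  next
    case (compl S)
    have "App (\<lambda>z. indicator (A i) z + (-1) * indicator (S \<inter> A i) z)"
      using A(1) compl.IH by (intro App_add App_cmult App_G[of "A i"]) auto
    also have "(\<lambda>z. indicator (A i) z + (-1) * indicator (S \<inter> A i) z) =
        (indicator ((space M - S) \<inter> A i) :: 'a \<Rightarrow> real)"
      using sets.sets_into_space[OF A_sets[of i]] by (auto simp: indicator_def fun_eq_iff)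
    finally show ?case .
  next
    case (union S)
    have S_sets [measurable]: "S k \<in> sets M" for k
      using union(2) G(3) by auto
    \<comment> \<open>The tail of the union inside \<open>A i\<close>, which is exactly what the
      first n sets leave over. It decreases to the empty set because a point lies in only one
      \<open>S k\<close>.\<close>
    define T where "T n = A i \<inter> (\<Union>k\<in>{n..}. S k)" for n
    have [measurable]: "T n \<in> sets M" for n
      unfolding T_def by measurable
    have ind: "indicator (\<Union> (range S) \<inter> A i) z - (\<Sum>k<n. indicator (S k \<inter> A i) z) =
        (indicator (T n) z :: real)" for n z
    proof -
      have "(\<Sum>k<n. indicator (S k \<inter> A i) z) = (indicator (\<Union>k<n. S k \<inter> A i) z :: real)"
        using union(1) by (intro indicator_UN_disjoint[symmetric])
          (auto simp: disjoint_family_on_def)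
      moreover have "z \<notin> T n" if "z \<in> (\<Union>k<n. S k \<inter> A i)"
      proof
        assume "z \<in> T n"
        then obtain l where l: "z \<in> S l" "n \<le> l" by (auto simp: T_def)
        from that obtain k where k: "z \<in> S k" "k < n" by auto
        have "S k \<inter> S l = {}"
          using union(1) k(2) l(2) by (intro disjoint_family_onD) auto
        with l k show False by auto
      qed
      moreover have "z \<in> \<Union> (range S) \<inter> A i \<longleftrightarrow> z \<in> T n \<or> z \<in> (\<Union>k<n. S k \<inter> A i)"
        unfolding T_def using not_le by blast
      ultimately show ?thesis
        by (auto simp: indicator_def)
    qed
    have "(\<lambda>n. emeasure M (T n)) \<longlonglongrightarrow> emeasure M (\<Inter>n. T n)"
    proof (rule Lim_emeasure_decseq)
      show "decseq T" unfolding T_def decseq_def by (auto intro: order_trans)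
      show "emeasure M (T n) \<noteq> \<infinity>" for n
        using A(4)[of i] emeasure_mono[of "T n" "A i" M] by (auto simp: T_def top_unique less_top)
    qed auto
    also have "(\<Inter>n. T n) = {}"
    proof (rule equals0I)
      fix z assume z: "z \<in> (\<Inter>n. T n)"
      then have "z \<in> T 0" by blast
      then obtain k where k: "z \<in> S k" by (auto simp: T_def)
      have "z \<in> T (Suc k)" using z by blast
      then obtain l where "z \<in> S l" "l \<ge> Suc k" by (auto simp: T_def)
      have "S k \<inter> S l = {}"
        using union(1) \<open>l \<ge> Suc k\<close> by (intro disjoint_family_onD) auto
      with k \<open>z \<in> S l\<close> show False by auto
    qed
    finally have lim: "(\<lambda>n. emeasure M (T n)) \<longlonglongrightarrow> 0" by simp
    show ?case
    proof (rule AppI)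
      show "indicator (\<Union> (range S) \<inter> A i) \<in> borel_measurable M" by measurable
      fix d :: real assume "0 < d"
      then obtain n where n: "emeasure M (T n) < ennreal d"
        using tendsto_zero_ennreal_less[OF lim, of "ennreal d"] by auto
      have "sq_norm M (\<lambda>x. indicator (\<Union> (range S) \<inter> A i) x - (\<Sum>k<n. indicator (S k \<inter> A i) x))
          = sq_norm M (indicator (T n))"
        by (intro sq_norm_cong ind)
      also have "\<dots> = (\<integral>\<^sup>+ x. indicator (T n) x \<partial>M)"
        unfolding sq_norm_def by (intro nn_integral_cong) (auto simp: indicator_def)
      also have "\<dots> = emeasure M (T n)" by simp
      finally show "\<exists>k. App k \<and> sq_norm M (\<lambda>x. indicator (\<Union> (range S) \<inter> A i) x - k x) < ennreal d"
        using n union(3) by (intro exI[of _ "\<lambda>x. \<Sum>k<n. indicator (S k \<inter> A i) x"] conjI App_sum) auto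
    qed
  qed
  have "App h"
  proof (rule AppI)
    fix d :: real assume "0 < d"
    obtain F where F: "\<And>i. simple_function M (F i)"
      "\<And>x. x \<in> space M \<Longrightarrow> (\<lambda>i. F i x) \<longlonglongrightarrow> h x"
      "\<And>i x. x \<in> space M \<Longrightarrow> \<bar>F i x\<bar> \<le> 2 * \<bar>h x\<bar>"
    proof -
      obtain F where "\<forall>i. simple_function M (F i)"
        "\<forall>x\<in>space M. (\<lambda>i. F i x) \<longlonglongrightarrow> h x"
        "\<forall>i. \<forall>x\<in>space M. dist (F i x) 0 \<le> 2 * dist (h x) 0"
        using borel_measurable_implies_sequence_metric[OF h(1), of 0] by blast
      then show ?thesis by (intro that[of F]) auto
    qed
    have [measurable]: "F i \<in> borel_measurable M" "h \<in> borel_measurable M" for i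
      using F(1) h(1) borel_measurable_simple_function by auto
    \<comment> \<open>A simple function cut off to \<open>A i\<close> is a finite combination of the
      indicators treated above.\<close>
    define k where "k i x = F i x * indicator (A i) x" for i x
    have [measurable]: "k i \<in> borel_measurable M" for i
      unfolding k_def by measurable
    have App_k: "App (k i)" for i
    proof -
      have "App (\<lambda>x. \<Sum>y\<in>F i ` space M. y * indicator ((F i -` {y} \<inter> space M) \<inter> A i) x)"
        using F(1)[of i] by (intro App_sum App_cmult App_ind) (auto simp: simple_function_def)
      moreover have "(\<Sum>y\<in>F i ` space M. y * indicator ((F i -` {y} \<inter> space M) \<inter> A i) x) = k i x"
        if "x \<in> space M" for x
      proof -
        have "(\<Sum>y\<in>F i ` space M. y * indicator ((F i -` {y} \<inter> space M) \<inter> A i) x) =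
            (\<Sum>y\<in>F i ` space M. if y = F i x then F i x * indicator (A i) x else 0)"
          using that by (intro sum.cong) (auto simp: indicator_def)
        also have "\<dots> = k i x"
          using that F(1)[of i] by (simp add: simple_function_def k_def)
        finally show ?thesis .
      qed
      ultimately show ?thesis
        unfolding App_def by (auto cong: sq_norm_cong)
    qed
    \<comment> \<open>The bound |F i| \<le> 2 |h| gives |h - k i| \<le> 3 |h|; this is the 9 in the
      dominating function.\<close>
    have "(\<lambda>i. \<integral>\<^sup>+ x. ennreal ((h x - k i x)\<^sup>2) \<partial>M) \<longlonglongrightarrow> (\<integral>\<^sup>+ x. 0 \<partial>M)"
    proof (rule nn_integral_dominated_convergence[where w="\<lambda>x. 9 * ennreal ((h x)\<^sup>2)"])
      show "(\<integral>\<^sup>+ x. 9 * ennreal ((h x)\<^sup>2) \<partial>M) < \<infinity>"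
        using h(2) by (simp add: nn_integral_cmult sq_norm_def ennreal_mult_less_top)
      show "AE x in M. ennreal ((h x - k i x)\<^sup>2) \<le> 9 * ennreal ((h x)\<^sup>2)" for i
      proof (rule AE_I2)
        fix x assume x: "x \<in> space M"
        have "\<bar>h x - k i x\<bar> \<le> \<bar>3 * h x\<bar>"
          using F(3)[OF x, of i] by (auto simp: k_def indicator_def)
        then have "(h x - k i x)\<^sup>2 \<le> (3 * h x)\<^sup>2"
          by (simp only: abs_le_square_iff)
        then have "ennreal ((h x - k i x)\<^sup>2) \<le> ennreal (9 * (h x)\<^sup>2)"
          by (intro ennreal_leI) (simp add: power_mult_distrib)
        then show "ennreal ((h x - k i x)\<^sup>2) \<le> 9 * ennreal ((h x)\<^sup>2)"
          by (simp add: ennreal_mult)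
      qed
      show "AE x in M. (\<lambda>i. ennreal ((h x - k i x)\<^sup>2)) \<longlonglongrightarrow> 0"
      proof (rule AE_I2)
        fix x assume x: "x \<in> space M"
        then obtain j where j: "x \<in> A j" using A(3) by auto
        have "eventually (\<lambda>i. k i x = F i x) sequentially"
          using eventually_ge_at_top[of j]
        proof eventually_elim
          fix i assume "j \<le> i"
          then have "x \<in> A i" using incseqD[OF A(2)] j by blast
          then show "k i x = F i x" by (simp add: k_def)
        qed
        then have "(\<lambda>i. k i x) \<longlonglongrightarrow> h x"
          using F(2)[OF x] by (simp add: tendsto_cong)
        then have "(\<lambda>i. (h x - k i x)\<^sup>2) \<longlonglongrightarrow> (h x - h x)\<^sup>2"
          by (intro tendsto_intros)
        from tendsto_ennrealI[OF this] show "(\<lambda>i. ennreal ((h x - k i x)\<^sup>2)) \<longlonglongrightarrow> 0"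
          by simp
      qed
    qed auto
    then have "(\<lambda>i. sq_norm M (\<lambda>x. h x - k i x)) \<longlonglongrightarrow> 0"
      by (simp add: sq_norm_def)
    then obtain i where "sq_norm M (\<lambda>x. h x - k i x) < ennreal d"
      using tendsto_zero_ennreal_less[of _ "ennreal d"] \<open>0 < d\<close> by auto
    then show "\<exists>k. App k \<and> sq_norm M (\<lambda>x. h x - k x) < ennreal d"
      using App_k by blast
  qed fact
  then show ?thesis using d by (auto simp: App_def)
qed

section \<open>Refinement of grids\<close>

abbreviation gap :: "(nat \<Rightarrow> real) \<Rightarrow> nat \<Rightarrow> real" where
  "gap t i \<equiv> t (Suc i) - t i"

abbreviation grid :: "nat \<Rightarrow> (nat \<Rightarrow> real) \<Rightarrow> bool" where
  "grid n t \<equiv> strict_mono_on {..n} t"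

definition increment :: "(nat \<Rightarrow> real) \<Rightarrow> nat \<Rightarrow> (real \<Rightarrow> real) \<Rightarrow> real" where
  "increment t i b = b (t (Suc i)) - b (t i)"

text \<open>
  The function \<open>b\<close> is either a path of the process or an indicator \<open>indicator {x..}\<close>, whose
  increments are the indicators of the grid cells. Identities that hold for all \<open>b\<close> and \<open>b'\<close>
  therefore transfer from kernels to integrals.
\<close>

definition step_sum ::
    "nat \<Rightarrow> (nat \<Rightarrow> real) \<Rightarrow> (nat \<Rightarrow> nat \<Rightarrow> real) \<Rightarrow> (real \<Rightarrow> real) \<Rightarrow> (real \<Rightarrow> real) \<Rightarrow> real" where
  "step_sum n t a b b' = (\<Sum>i<n. \<Sum>j<n. a i j * increment t i b * increment t j b')"

lemma elementary_integral_eq_step_sum: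
  "elementary_integral B n t a w = step_sum n t a (\<lambda>s. B s w) (\<lambda>s. B s w)"
  by (simp add: elementary_integral_def step_sum_def increment_def)

lemma increment_indicator:
  assumes "grid n t" "i < n"
  shows "increment t i (indicator {x..}) = indicator {t i<..t (Suc i)} x"
proof -
  have "t i < t (Suc i)"
    using assms by (auto simp: strict_mono_on_def)
  then show ?thesis
    by (auto simp: increment_def indicator_def)
qed

lemma elementary_kernel_eq_step_sum:
  assumes "grid n t"
  shows "elementary_kernel n t a z = step_sum n t a (indicator {fst z..}) (indicator {snd z..})"
  unfolding elementary_kernel_def step_sum_def
  by (simp add: case_prod_beta increment_indicator[OF assms])

text \<open>The coefficient \<open>r i j\<close> tells whether fine cell j lies in coarse cell i,
  and the increments telescope. That a fine cell lies in at most one coarse cell will keep diagonals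
  zero; that the coefficients are 0 or 1 will keep refined step functions bounded.\<close>

lemma grid_refinement:
  assumes t: "grid n t" and T: "grid m T"
    and sub: "t ` {..n} \<subseteq> T ` {..m}"
  obtains r :: "nat \<Rightarrow> nat \<Rightarrow> real" where
    "\<And>i b. i < n \<Longrightarrow> increment t i b = (\<Sum>j<m. r i j * increment T j b)"
    "\<And>i i' j. i < n \<Longrightarrow> i' < n \<Longrightarrow> i \<noteq> i' \<Longrightarrow> r i j * r i' j = 0"
    "\<And>i j. r i j = 0 \<or> r i j = 1"
proof -
  have "\<forall>i\<in>{..n}. \<exists>k. k \<le> m \<and> T k = t i"
    using sub by (force simp: image_subset_iff image_iff)
  \<comment> \<open>\<open>p i\<close> is the position of the coarse point \<open>t i\<close> on the
    fine grid, so coarse cell i consists of the fine cells from \<open>p i\<close> up to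
    \<open>p (Suc i) - 1\<close>.\<close>
  then obtain p where p: "\<And>i. i \<le> n \<Longrightarrow> p i \<le> m" "\<And>i. i \<le> n \<Longrightarrow> T (p i) = t i"
    by (metis atMost_iff)
  have mono: "p i < p i'" if "i < i'" "i' \<le> n" for i i'
  proof -
    have "T (p i) < T (p i')"
      using that p t by (auto simp: strict_mono_on_def)
    then show ?thesis
      using strict_mono_on_leD[OF T, of "p i'" "p i"] p(1)[of i] p(1)[of i'] that by fastforce
  qed
  define r :: "nat \<Rightarrow> nat \<Rightarrow> real" where "r i j = of_bool (p i \<le> j \<and> j < p (Suc i))" for i j
  have "increment t i b = (\<Sum>j<m. r i j * increment T j b)" if "i < n" for i b
  proof -
    have lt: "p i < p (Suc i)" "p (Suc i) \<le> m" using mono[of i "Suc i"] p(1)[of "Suc i"] that by auto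
    have "(\<Sum>j<m. r i j * increment T j b) = (\<Sum>j\<in>{p i..<p (Suc i)}. r i j * increment T j b)"
      using lt by (intro sum.mono_neutral_right) (auto simp: r_def)
    also have "\<dots> = (\<Sum>j\<in>{p i..<p (Suc i)}. b (T (Suc j)) - b (T j))"
      by (intro sum.cong) (auto simp: r_def increment_def)
    also have "\<dots> = b (T (p (Suc i))) - b (T (p i))"
      using lt by (intro sum_Suc_diff'[of _ _ "\<lambda>j. b (T j)"]) auto
    finally show ?thesis
      using p(2) that by (simp add: increment_def)
  qed
  moreover have "r i j * r i' j = 0" if "i < n" "i' < n" "i \<noteq> i'" for i i' j
  proof -
    have "p (Suc i) \<le> p i' \<or> p (Suc i') \<le> p i"
    proof (cases "i < i'")
      case True
      then show ?thesis using mono[of "Suc i" i'] that by (cases "Suc i = i'") auto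
    next
      case False
      then show ?thesis using mono[of "Suc i'" i] that by (cases "Suc i' = i") auto
    qed
    then show ?thesis by (auto simp: r_def)
  qed
  moreover have "r i j = 0 \<or> r i j = 1" for i j
    by (simp add: r_def)
  ultimately show thesis by (rule that)
qed

text \<open>The points of \<open>S\<close> are merged with equidistant points running from
  \<open>lo\<close> to \<open>hi\<close> in steps of size \<delta> \<le> \<eta>; sorting the union
  yields the grid.\<close>

lemma fine_grid:
  fixes S :: "real set"
  assumes S: "finite S" "S \<subseteq> {lo..hi}" and "lo < hi" "0 < \<eta>"
  obtains m T where "grid m T" "S \<subseteq> T ` {..m}" "T 0 = lo" "T m = hi"
    "\<And>i. i < m \<Longrightarrow> gap T i \<le> \<eta>"
proof -
  obtain N :: nat where N: "(hi - lo) / \<eta> < N" using reals_Archimedean2 by blast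
  moreover have "0 < (hi - lo) / \<eta>" using assms by simp
  ultimately have N0: "0 < real N" by linarith
  define \<delta> where "\<delta> = (hi - lo) / N"
  have \<delta>: "0 < \<delta>" "\<delta> \<le> \<eta>" "real N * \<delta> = hi - lo"
    using N N0 assms by (auto simp: \<delta>_def field_simps)
  define P where "P = S \<union> (\<lambda>k. lo + real k * \<delta>) ` {..N}"
  have P: "finite P" "lo \<in> P" "hi \<in> P"
    using S \<delta>(3) by (auto simp: P_def intro: image_eqI[of _ _ 0] image_eqI[of _ _ N])
  have P_sub: "P \<subseteq> {lo..hi}"
  proof -
    have "real k * \<delta> \<le> hi - lo" if "k \<le> N" for k
      unfolding \<delta>(3)[symmetric] using that \<delta>(1) by (intro mult_right_mono) auto
    then show ?thesis
      using S \<delta>(1) by (auto simp: P_def algebra_simps)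
  qed
  define xs where "xs = sorted_list_of_set P"
  have xs: "set xs = P" "sorted_wrt (<) xs"
    using P(1) by (auto simp: xs_def)
  define m where "m = length xs - 1"
  define T where "T i = xs ! i" for i
  have len: "length xs = Suc m"
    using xs(1) P(2) by (cases xs) (auto simp: m_def)
  have T_img: "T ` {..m} = P"
    using xs(1) len by (auto simp: T_def set_conv_nth less_Suc_eq_le)
  have mono: "grid m T"
    using sorted_wrt_nth_less[OF xs(2)] len by (auto simp: strict_mono_on_def T_def)
  have T_mem: "T i \<in> {lo..hi}" if "i \<le> m" for i
    using that T_img P_sub by blast
  have "T 0 = lo"
  proof -
    obtain j where j: "j \<le> m" "T j = lo" using P(2) T_img by (metis atMost_iff imageE)
    then have "T 0 \<le> lo" using strict_mono_on_leD[OF mono, of 0 j] by auto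
    then show ?thesis using T_mem[of 0] by auto
  qed
  moreover have "T m = hi"
  proof -
    obtain j where j: "j \<le> m" "T j = hi" using P(3) T_img by (metis atMost_iff imageE)
    then have "hi \<le> T m" using strict_mono_on_leD[OF mono, of j m] by auto
    then show ?thesis using T_mem[of m] by auto
  qed
  moreover have "gap T i \<le> \<eta>" if i: "i < m" for i
  proof (rule ccontr)
    assume "\<not> gap T i \<le> \<eta>"
    then have gap: "T i + \<delta> < T (Suc i)" using \<delta> by auto
    \<comment> \<open>\<open>lo + k * \<delta>\<close> is the first equidistant point strictly
      beyond \<open>T i\<close>. In a gap longer than \<delta> it would lie strictly between two
      neighbouring grid points although it is itself a grid point.\<close>
    define k where "k = Suc (nat \<lfloor>(T i - lo) / \<delta>\<rfloor>)"
    have nonneg: "0 \<le> (T i - lo) / \<delta>" using T_mem[of i] i \<delta> by auto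
    have "(T i - lo) / \<delta> < real k" "real k \<le> (T i - lo) / \<delta> + 1"
      using nonneg unfolding k_def by linarith+
    then have k: "T i < lo + real k * \<delta>" "lo + real k * \<delta> \<le> T i + \<delta>"
      using \<delta>(1) by (auto simp: field_simps)
    have "real k * \<delta> < real N * \<delta>"
      using k gap T_mem[of "Suc i"] i \<delta>(3) by auto
    then have "k \<le> N" using \<delta>(1) by auto
    then have "lo + real k * \<delta> \<in> T ` {..m}"
      unfolding T_img by (auto simp: P_def)
    then obtain j where j: "j \<le> m" "T j = lo + real k * \<delta>" by auto
    have "T i < T j" "T j < T (Suc i)" using j k gap by auto
    then have "i < j" "j < Suc i"
      using strict_mono_on_leD[OF mono, of j i] strict_mono_on_leD[OF mono, of "Suc i" j] i j(1)
      by (auto simp: not_le[symmetric])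
    then show False by simp
  qed
  moreover have "S \<subseteq> T ` {..m}"
    unfolding T_img by (auto simp: P_def)
  ultimately show thesis using mono that by blast
qed

lemma common_grid:
  assumes "finite S"
  shows "\<exists>m (T :: nat \<Rightarrow> real). grid m T \<and> S \<subseteq> T ` {..m}"
proof -
  define lo hi where "lo = Min (insert 0 S)" and "hi = Max (insert 0 S) + 1"
  have "S \<subseteq> {lo..hi}" "lo < hi"
  proof -
    have *: "lo \<le> x" "x \<le> hi - 1" if "x \<in> insert 0 S" for x
      using that assms unfolding lo_def hi_def by (auto simp del: Min_insert Max_insert)
    show "S \<subseteq> {lo..hi}" using *(1) *(2) by fastforce
    show "lo < hi" using *[of 0] by auto
  qed
  from fine_grid[OF assms this zero_less_one] show ?thesis by metis
qed

text \<open>A fine cell meets at most one coarse cell, so a diagonal coefficient on the fine grid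
  involves only diagonal coefficients of the coarse one, and these vanish.\<close>

lemma step_sum_refine:
  assumes a: "off_diagonal_grid n t a" and T: "grid m T"
    and sub: "t ` {..n} \<subseteq> T ` {..m}"
  shows "\<exists>c. off_diagonal_grid m T c \<and> (\<forall>b b'. step_sum m T c b b' = step_sum n t a b b')"
proof -
  have t: "grid n t" using a by (simp add: off_diagonal_grid_def)
  obtain r :: "nat \<Rightarrow> nat \<Rightarrow> real" where
    r: "\<And>i b. i < n \<Longrightarrow> increment t i b = (\<Sum>j<m. r i j * increment T j b)"
    "\<And>i i' j. i < n \<Longrightarrow> i' < n \<Longrightarrow> i \<noteq> i' \<Longrightarrow> r i j * r i' j = 0"
    by (rule grid_refinement[OF t T sub]) blast
  define c where "c j k = (\<Sum>p\<in>{..<n} \<times> {..<n}. a (fst p) (snd p) * r (fst p) j * r (snd p) k)" for j k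
  have "off_diagonal_grid m T c"
    unfolding off_diagonal_grid_def
  proof (intro conjI allI impI T)
    fix j
    show "c j j = 0"
      unfolding c_def
    proof (intro sum.neutral ballI)
      fix p assume "p \<in> {..<n} \<times> {..<n}"
      then show "a (fst p) (snd p) * r (fst p) j * r (snd p) j = 0"
        using a r(2)[of "fst p" "snd p" j] by (cases "fst p = snd p") (auto simp: off_diagonal_grid_def)
    qed
  qed
  moreover have "step_sum m T c b b' = step_sum n t a b b'" for b b'
  proof -
    have "step_sum n t a b b' = (\<Sum>p\<in>{..<n} \<times> {..<n}.
        a (fst p) (snd p) * increment t (fst p) b * increment t (snd p) b')"
      by (simp add: step_sum_def sum.cartesian_product case_prod_beta)
    also have "\<dots> = (\<Sum>p\<in>{..<n} \<times> {..<n}. \<Sum>q\<in>{..<m} \<times> {..<m}.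
        a (fst p) (snd p) * r (fst p) (fst q) * r (snd p) (snd q)
          * increment T (fst q) b * increment T (snd q) b')"
    proof (intro sum.cong refl)
      fix p assume p: "p \<in> {..<n} \<times> {..<n}"
      have "increment t (fst p) b * increment t (snd p) b' =
          (\<Sum>q\<in>{..<m} \<times> {..<m}. (r (fst p) (fst q) * increment T (fst q) b)
            * (r (snd p) (snd q) * increment T (snd q) b'))"
        using p r(1) by (auto simp: sum_product sum.cartesian_product case_prod_beta)
      from arg_cong[OF this, of "\<lambda>w. a (fst p) (snd p) * w"]
      show "a (fst p) (snd p) * increment t (fst p) b * increment t (snd p) b' =
          (\<Sum>q\<in>{..<m} \<times> {..<m}. a (fst p) (snd p) * r (fst p) (fst q) * r (snd p) (snd q)
            * increment T (fst q) b * increment T (snd q) b')"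
        by (simp add: sum_distrib_left mult_ac)
    qed
    also have "\<dots> = (\<Sum>q\<in>{..<m} \<times> {..<m}. c (fst q) (snd q) * increment T (fst q) b * increment T (snd q) b')"
      by (subst sum.swap) (simp add: c_def sum_distrib_right)
    also have "\<dots> = step_sum m T c b b'"
      by (simp add: step_sum_def sum.cartesian_product case_prod_beta)
    finally show ?thesis by simp
  qed
  ultimately show ?thesis by metis
qed

lemma step_sum_linear_combination:
  assumes a: "off_diagonal_grid n t a" and a': "off_diagonal_grid n' t' a'"
  shows "\<exists>m T c. off_diagonal_grid m T c \<and>
    (\<forall>b b'. step_sum m T c b b' = x * step_sum n t a b b' + y * step_sum n' t' a' b b')"
proof -
  have fin: "finite (t ` {..n} \<union> t' ` {..n'})"
    by simp
  obtain m :: nat and T where T: "grid m T" "t ` {..n} \<union> t' ` {..n'} \<subseteq> T ` {..m}"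
    using common_grid[OF fin] by metis
  then have sub: "t ` {..n} \<subseteq> T ` {..m}" "t' ` {..n'} \<subseteq> T ` {..m}"
    by auto
  obtain c where c: "off_diagonal_grid m T c" "\<And>b b'. step_sum m T c b b' = step_sum n t a b b'"
    using step_sum_refine[OF a T(1) sub(1)] by metis
  obtain c' where c': "off_diagonal_grid m T c'" "\<And>b b'. step_sum m T c' b b' = step_sum n' t' a' b b'"
    using step_sum_refine[OF a' T(1) sub(2)] by metis
  show ?thesis
  proof (intro exI conjI allI)
    show "off_diagonal_grid m T (\<lambda>i j. x * c i j + y * c' i j)"
      using c(1) c'(1) by (simp add: off_diagonal_grid_def)
    show "step_sum m T (\<lambda>i j. x * c i j + y * c' i j) b b' =
        x * step_sum n t a b b' + y * step_sum n' t' a' b b'" for b b'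
    proof -
      have "step_sum m T (\<lambda>i j. x * c i j + y * c' i j) b b' =
          x * step_sum m T c b b' + y * step_sum m T c' b b'"
        unfolding step_sum_def sum_distrib_left sum.distrib[symmetric]
        by (intro sum.cong refl) (simp add: algebra_simps)
      then show ?thesis by (simp only: c(2) c'(2))
    qed
  qed
qed

text \<open>The bound on the new coefficients does not depend on the fine grid. This uniformity
  makes the diagonal contribution vanish as the mesh shrinks.\<close>

lemma step_refine:
  assumes t: "grid n t" and T: "grid m T"
    and sub: "t ` {..n} \<subseteq> T ` {..m}"
  obtains s' where "\<And>b. (\<Sum>j<m. s' j * increment T j b) = (\<Sum>i<n. s i * increment t i b)"
    "\<And>j. \<bar>s' j\<bar> \<le> (\<Sum>i<n. \<bar>s i\<bar>)"
proof -
  obtain r :: "nat \<Rightarrow> nat \<Rightarrow> real" where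
    r: "\<And>i b. i < n \<Longrightarrow> increment t i b = (\<Sum>j<m. r i j * increment T j b)"
    "\<And>i j. r i j = 0 \<or> r i j = 1"
    by (rule grid_refinement[OF t T sub]) blast
  define s' where "s' j = (\<Sum>i<n. s i * r i j)" for j
  show thesis
  proof (rule that)
    show "(\<Sum>j<m. s' j * increment T j b) = (\<Sum>i<n. s i * increment t i b)" for b
    proof -
      have "(\<Sum>i<n. s i * increment t i b) = (\<Sum>i<n. \<Sum>j<m. s i * r i j * increment T j b)"
        by (intro sum.cong refl) (simp add: r(1) sum_distrib_left mult.assoc)
      also have "\<dots> = (\<Sum>j<m. s' j * increment T j b)"
        unfolding s'_def sum_distrib_right by (rule sum.swap)
      finally show ?thesis by simp
    qed
    show "\<bar>s' j\<bar> \<le> (\<Sum>i<n. \<bar>s i\<bar>)" for j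
    proof -
      have "\<bar>s' j\<bar> \<le> (\<Sum>i<n. \<bar>s i * r i j\<bar>)" unfolding s'_def by (rule sum_abs)
      also have "\<dots> \<le> (\<Sum>i<n. \<bar>s i\<bar>)"
      proof (intro sum_mono)
        show "\<bar>s i * r i j\<bar> \<le> \<bar>s i\<bar>" for i
          using r(2)[of i j] by auto
      qed
      finally show ?thesis .
    qed
  qed
qed

text \<open>The \<open>d p\<close> stand for values of indicators of disjoint sets, abstracted to
  idempotent numbers that annihilate each other. Squaring then acts on the coefficients
  alone.\<close>

lemma orthogonal_sum_square:
  fixes d :: "'i \<Rightarrow> real"
  assumes "finite A" "\<And>p q. p \<in> A \<Longrightarrow> q \<in> A \<Longrightarrow> p \<noteq> q \<Longrightarrow> d p * d q = 0"
    "\<And>p. p \<in> A \<Longrightarrow> d p * d p = d p"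
  shows "(\<Sum>p\<in>A. a p * d p)\<^sup>2 = (\<Sum>p\<in>A. (a p)\<^sup>2 * d p)"
proof -
  have "(\<Sum>p\<in>A. a p * d p)\<^sup>2 = (\<Sum>p\<in>A. \<Sum>q\<in>A. (a p * d p) * (a q * d q))"
    by (simp add: power2_eq_square sum_product)
  also have "\<dots> = (\<Sum>p\<in>A. \<Sum>q\<in>A. if p = q then (a p)\<^sup>2 * d p else 0)"
  proof (intro sum.cong refl)
    fix p q assume pq: "p \<in> A" "q \<in> A"
    have "(a p * d p) * (a q * d q) = (a p * a q) * (d p * d q)" by (simp add: mult_ac)
    also have "\<dots> = (if p = q then (a p)\<^sup>2 * d p else 0)"
      using assms(2,3) pq by (auto simp: power2_eq_square)
    finally show "(a p * d p) * (a q * d q) = (if p = q then (a p)\<^sup>2 * d p else 0)" .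
  qed
  also have "\<dots> = (\<Sum>p\<in>A. (a p)\<^sup>2 * d p)"
    using assms(1) by simp
  finally show ?thesis .
qed

section \<open>Norms of step functions and elementary kernels\<close>

abbreviation lborel2 :: "(real \<times> real) measure" where
  "lborel2 \<equiv> lborel \<Otimes>\<^sub>M lborel"

definition cell :: "(nat \<Rightarrow> real) \<Rightarrow> nat \<Rightarrow> real \<Rightarrow> real" where
  "cell t i = indicator {t i<..t (Suc i)}"

lemma cell_measurable [measurable]: "cell t i \<in> borel_measurable borel"
  by (simp add: cell_def)

lemma cell_nonneg: "0 \<le> cell t i x"
  by (simp add: cell_def)

lemma cell_idem: "cell t i x * cell t i x = cell t i x"
  by (simp add: cell_def indicator_def)

lemma cell_disjoint:
  assumes t: "grid n t" and "i < n" "j < n" "i \<noteq> j"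
  shows "cell t i x * cell t j x = 0"
proof -
  have "t (Suc i) \<le> t j \<or> t (Suc j) \<le> t i"
    using assms strict_mono_on_leD[OF t, of "Suc i" j] strict_mono_on_leD[OF t, of "Suc j" i]
    by (cases "i < j") auto
  then show ?thesis
    by (auto simp: cell_def indicator_def)
qed

lemma nn_integral_cell:
  assumes "grid n t" "i < n"
  shows "(\<integral>\<^sup>+ x. ennreal (cell t i x) \<partial>lborel) = ennreal (gap t i)"
proof -
  have "t i \<le> t (Suc i)" using assms by (auto intro: strict_mono_on_leD)
  then show ?thesis
    by (simp add: cell_def ennreal_indicator)
qed

lemma increment_nonneg: "strict_mono_on {..n} (t :: nat \<Rightarrow> real) \<Longrightarrow> i < n \<Longrightarrow> 0 \<le> gap t i"
  using strict_mono_on_leD[of "{..n}" t i "Suc i"] by auto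

lemma step_eq_increment:
  assumes "grid n t"
  shows "(\<Sum>i<n. s i * cell t i x) = (\<Sum>i<n. s i * increment t i (indicator {x..}))"
  by (intro sum.cong refl) (simp add: increment_indicator[OF assms] cell_def)

lemma elementary_kernel_cell:
  "elementary_kernel n t a z = (\<Sum>i<n. \<Sum>j<n. a i j * cell t i (fst z) * cell t j (snd z))"
  by (simp add: elementary_kernel_def cell_def case_prod_beta)

lemma elementary_kernel_measurable [measurable]:
  "elementary_kernel n t a \<in> borel_measurable borel"
proof -
  have "(\<lambda>z. \<Sum>i<n. \<Sum>j<n. a i j * cell t i (fst z) * cell t j (snd z)) \<in> borel_measurable borel"
    unfolding borel_prod[symmetric] by measurable
  then show ?thesis by (simp add: elementary_kernel_cell[abs_def])
qed

lemma sq_norm_step: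
  assumes t: "grid n t"
  shows "sq_norm lborel (\<lambda>x. \<Sum>i<n. s i * cell t i x) = ennreal (\<Sum>i<n. (s i)\<^sup>2 * gap t i)"
proof -
  have "(\<Sum>i<n. s i * cell t i x)\<^sup>2 = (\<Sum>i<n. (s i)\<^sup>2 * cell t i x)" for x
    by (intro orthogonal_sum_square) (auto simp: cell_idem cell_disjoint[OF t])
  then have "sq_norm lborel (\<lambda>x. \<Sum>i<n. s i * cell t i x) =
      (\<integral>\<^sup>+ x. (\<Sum>i<n. ennreal ((s i)\<^sup>2) * ennreal (cell t i x)) \<partial>lborel)"
    unfolding sq_norm_def
    by (simp add: sum_ennreal[symmetric] cell_nonneg ennreal_mult del: sum_ennreal)
  also have "\<dots> = (\<Sum>i<n. ennreal ((s i)\<^sup>2) * ennreal (gap t i))"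
    by (simp add: nn_integral_sum nn_integral_cmult nn_integral_cell[OF t])
  also have "\<dots> = ennreal (\<Sum>i<n. (s i)\<^sup>2 * gap t i)"
    using increment_nonneg[OF t]
    by (subst sum_ennreal[symmetric]) (auto simp: ennreal_mult)
  finally show ?thesis .
qed

lemma sq_norm_prod:
  fixes f g :: "real \<Rightarrow> real"
  assumes [measurable]: "f \<in> borel_measurable borel" "g \<in> borel_measurable borel"
  shows "sq_norm lborel (\<lambda>z. f (fst z) * g (snd z)) = sq_norm lborel f * sq_norm lborel g"
proof -
  have "sq_norm lborel (\<lambda>z. f (fst z) * g (snd z)) =
      (\<integral>\<^sup>+ z. ennreal ((f (fst z))\<^sup>2) * ennreal ((g (snd z))\<^sup>2) \<partial>lborel2)"
    by (simp add: sq_norm_def lborel_prod power_mult_distrib ennreal_mult)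
  also have "\<dots> = (\<integral>\<^sup>+ x. (\<integral>\<^sup>+ y. ennreal ((f x)\<^sup>2) * ennreal ((g y)\<^sup>2) \<partial>lborel) \<partial>lborel)"
    by (subst lborel.nn_integral_fst[symmetric]) auto
  also have "\<dots> = sq_norm lborel f * sq_norm lborel g"
    by (simp add: sq_norm_def nn_integral_cmult nn_integral_multc)
  finally show ?thesis .
qed

lemma sq_norm_elementary_kernel:
  assumes t: "grid n t"
  shows "sq_norm lborel (elementary_kernel n t a) =
    ennreal (\<Sum>i<n. \<Sum>j<n. (a i j)\<^sup>2 * (gap t i * gap t j))"
proof -
  define d where "d p z = cell t (fst p) (fst z) * cell t (snd p) (snd z)"
    for p :: "nat \<times> nat" and z :: "real \<times> real"
  define A where "A = {..<n} \<times> {..<n}"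
  define v where "v p = (t (Suc (fst p)) - t (fst p)) * (t (Suc (snd p)) - t (snd p))" for p
  have ker: "elementary_kernel n t a z = (\<Sum>p\<in>A. a (fst p) (snd p) * d p z)" for z
    by (simp add: elementary_kernel_cell A_def d_def sum.cartesian_product case_prod_beta mult.assoc)
  have sq: "(\<Sum>p\<in>A. a (fst p) (snd p) * d p z)\<^sup>2 = (\<Sum>p\<in>A. (a (fst p) (snd p))\<^sup>2 * d p z)" for z
  proof (intro orthogonal_sum_square)
    show "finite A" by (simp add: A_def)
    fix p q assume pq: "p \<in> A" "q \<in> A" "p \<noteq> q"
    have "d p z * d q z = (cell t (fst p) (fst z) * cell t (fst q) (fst z)) *
        (cell t (snd p) (snd z) * cell t (snd q) (snd z))"
      by (simp add: d_def mult_ac)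
    also have "\<dots> = 0"
    proof (cases "fst p = fst q")
      case True
      then have "cell t (snd p) (snd z) * cell t (snd q) (snd z) = 0"
        using pq by (intro cell_disjoint[OF t]) (auto simp: A_def prod_eq_iff)
      then show ?thesis by simp
    next
      case False
      then have "cell t (fst p) (fst z) * cell t (fst q) (fst z) = 0"
        using pq by (intro cell_disjoint[OF t]) (auto simp: A_def)
      then show ?thesis by simp
    qed
    finally show "d p z * d q z = 0" .
  next
    fix p
    have "d p z * d p z = (cell t (fst p) (fst z) * cell t (fst p) (fst z)) *
        (cell t (snd p) (snd z) * cell t (snd p) (snd z))"
      by (simp add: d_def mult_ac)
    then show "d p z * d p z = d p z" by (simp add: cell_idem d_def)
  qed
  have d_meas [measurable]: "d p \<in> borel_measurable lborel2" for p
    unfolding d_def by measurable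
  have d_int: "(\<integral>\<^sup>+ z. ennreal (d p z) \<partial>lborel2) = ennreal (v p)" if "p \<in> A" for p
  proof -
    have "(\<integral>\<^sup>+ z. ennreal (d p z) \<partial>lborel2) =
       (\<integral>\<^sup>+ x. (\<integral>\<^sup>+ y. ennreal (cell t (fst p) x) * ennreal (cell t (snd p) y) \<partial>lborel) \<partial>lborel)"
      by (subst lborel.nn_integral_fst[symmetric]) (auto simp: d_def ennreal_mult cell_nonneg)
    also have "\<dots> = ennreal (v p)"
      using that increment_nonneg[OF t]
      by (auto simp: nn_integral_cmult nn_integral_multc nn_integral_cell[OF t] A_def v_def
          ennreal_mult)
    finally show ?thesis .
  qed
  have "sq_norm lborel (elementary_kernel n t a) =
      (\<integral>\<^sup>+ z. (\<Sum>p\<in>A. ennreal ((a (fst p) (snd p))\<^sup>2) * ennreal (d p z)) \<partial>lborel2)"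
    unfolding sq_norm_def ker sq lborel_prod
    by (simp add: sum_ennreal[symmetric] cell_nonneg ennreal_mult d_def del: sum_ennreal)
  also have "\<dots> = (\<Sum>p\<in>A. ennreal ((a (fst p) (snd p))\<^sup>2) * ennreal (v p))"
    by (simp add: nn_integral_sum nn_integral_cmult d_int)
  also have "\<dots> = ennreal (\<Sum>p\<in>A. (a (fst p) (snd p))\<^sup>2 * v p)"
  proof -
    have "0 \<le> v p" if "p \<in> A" for p
      using that increment_nonneg[OF t] by (auto simp: A_def v_def)
    then show ?thesis
      by (subst sum_ennreal[symmetric]) (auto simp: ennreal_mult intro!: sum.cong)
  qed
  finally show ?thesis
    by (simp add: A_def v_def sum.cartesian_product case_prod_beta)
qed

abbreviation off_diag :: "(nat \<Rightarrow> real) \<Rightarrow> (nat \<Rightarrow> real) \<Rightarrow> nat \<Rightarrow> nat \<Rightarrow> real" where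
  "off_diag s r \<equiv> \<lambda>i j. if i = j then 0 else s i * r j"

text \<open>The cost of deleting the diagonal squares from a tensor product: on the i-th square the
  product equals \<open>s i * r i\<close>, and the area of that square is the squared gap.\<close>

lemma sq_norm_diagonal:
  assumes t: "grid n t"
  shows "sq_norm lborel (\<lambda>z. (\<Sum>i<n. s i * cell t i (fst z)) * (\<Sum>j<n. r j * cell t j (snd z))
      - elementary_kernel n t (off_diag s r) z) =
    ennreal (\<Sum>i<n. (s i * r i)\<^sup>2 * (gap t i)\<^sup>2)"
proof -
  have "(\<Sum>i<n. s i * cell t i (fst z)) * (\<Sum>j<n. r j * cell t j (snd z))
      - elementary_kernel n t (off_diag s r) z =
      elementary_kernel n t (\<lambda>i j. if i = j then s i * r j else 0) z" for z
    unfolding elementary_kernel_cell sum_product sum_subtractf[symmetric]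
    by (intro sum.cong refl) (auto simp: mult_ac)
  moreover have "(\<Sum>j<n. (if i = j then s i * r j else 0)\<^sup>2 * (gap t i * gap t j)) =
      (s i * r i)\<^sup>2 * (gap t i)\<^sup>2" if "i < n" for i
  proof -
    have "(\<Sum>j<n. (if i = j then s i * r j else 0)\<^sup>2 * (gap t i * gap t j)) =
      (\<Sum>j<n. if i = j then (s i * r i)\<^sup>2 * (gap t i)\<^sup>2 else 0)"
      by (intro sum.cong refl) (auto simp: power2_eq_square)
    then show ?thesis using that by simp
  qed
  ultimately show ?thesis
    by (simp add: sq_norm_elementary_kernel[OF t])
qed

section \<open>Double sums of independent increments\<close>

lemma integrable_mult_of_squares:
  fixes X Y :: "'a \<Rightarrow> real"
  assumes [measurable]: "X \<in> borel_measurable M" "Y \<in> borel_measurable M"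
    and X: "integrable M (\<lambda>x. (X x)\<^sup>2)" and Y: "integrable M (\<lambda>x. (Y x)\<^sup>2)"
  shows "integrable M (\<lambda>x. X x * Y x)"
proof (rule Bochner_Integration.integrable_bound)
  show "integrable M (\<lambda>x. (X x)\<^sup>2 + (Y x)\<^sup>2)"
    using X Y by simp
  have "\<bar>a * b\<bar> \<le> a\<^sup>2 + b\<^sup>2" for a b :: real
  proof -
    have "2 * (\<bar>a\<bar> * \<bar>b\<bar>) \<le> a\<^sup>2 + b\<^sup>2"
      using zero_le_power2[of "\<bar>a\<bar> - \<bar>b\<bar>"] by (simp add: power2_diff)
    moreover have "0 \<le> \<bar>a\<bar> * \<bar>b\<bar>" by simp
    ultimately show ?thesis by (simp only: abs_mult)
  qed
  then show "AE x in M. norm (X x * Y x) \<le> norm ((X x)\<^sup>2 + (Y x)\<^sup>2)"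
    by (intro AE_I2) simp
qed measurable

text \<open>\<open>Q\<close> and \<open>L\<close> see only the variables before \<open>D k\<close>,
  so the cross term 2 D_k Q L has expectation E[D_k] E[Q L] = 0, while (D_k)^2 and L^2 are
  independent. They are given as functions on the product space so that the independence of
  \<open>D k\<close> from the whole block \<open>X\<close> passes to them by composition.\<close>

lemma (in prob_space) indep_square_step:
  fixes D :: "nat \<Rightarrow> 'a \<Rightarrow> real"
  assumes ind: "indep_vars (\<lambda>_. borel) D {..<n}" and k: "k < n"
    and Q: "Q \<in> borel_measurable (PiM {..<k} (\<lambda>_. borel))"
    and L: "L \<in> borel_measurable (PiM {..<k} (\<lambda>_. borel))"
    and X_def: "X = (\<lambda>w. restrict (\<lambda>i. D i w) {..<k})"
    and D2: "integrable M (\<lambda>w. (D k w)\<^sup>2)" and D1: "expectation (D k) = 0"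
    and Q2: "integrable M (\<lambda>w. (Q (X w))\<^sup>2)" and L2: "integrable M (\<lambda>w. (L (X w))\<^sup>2)"
  shows "integrable M (\<lambda>w. (Q (X w) + D k w * L (X w))\<^sup>2)" (is ?A)
    and "expectation (\<lambda>w. (Q (X w) + D k w * L (X w))\<^sup>2) =
      expectation (\<lambda>w. (Q (X w))\<^sup>2) + expectation (\<lambda>w. (D k w)\<^sup>2) * expectation (\<lambda>w. (L (X w))\<^sup>2)"
      (is ?B)
proof -
  have rv: "random_variable borel (D i)" if "i < n" for i
    using ind that by (auto simp: indep_vars_def2)
  have Dk: "D k \<in> borel_measurable M" using rv k by simp
  have X: "X \<in> measurable M (PiM {..<k} (\<lambda>_. borel))"
    unfolding X_def using rv k by (intro measurable_restrict) auto
  note QX = measurable_compose[OF X Q] and LX = measurable_compose[OF X L]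
  have QL: "(\<lambda>x. Q x * L x) \<in> borel_measurable (PiM {..<k} (\<lambda>_. borel))"
    using Q L by (rule borel_measurable_times)
  have LL: "(\<lambda>x. (L x)\<^sup>2) \<in> borel_measurable (PiM {..<k} (\<lambda>_. borel))"
    using L by (rule borel_measurable_power)
  have ind': "indep_var borel (\<lambda>w. g (D k w)) borel (\<lambda>w. h (X w))"
    if g: "g \<in> borel_measurable borel" and h: "h \<in> borel_measurable (PiM {..<k} (\<lambda>_. borel))"
    for g :: "real \<Rightarrow> real" and h :: "(nat \<Rightarrow> real) \<Rightarrow> real"
  proof -
    have *: "indep_var (PiM {k} (\<lambda>_. borel)) (\<lambda>w. restrict (\<lambda>i. D i w) {k}) (PiM {..<k} (\<lambda>_. borel)) X"
      unfolding X_def by (rule indep_var_restrict[OF ind]) (use k in auto)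
    have "(\<lambda>x. x k) \<in> measurable (PiM {k} (\<lambda>_. borel :: real measure)) borel"
      by (rule measurable_component_singleton[of k "{k}" "\<lambda>_. borel", OF singletonI])
    from measurable_compose[OF this g]
    have "(\<lambda>x. g (x k)) \<in> borel_measurable (PiM {k} (\<lambda>_. borel))" .
    from indep_var_compose[OF * this h] show ?thesis
      by (simp add: comp_def)
  qed
  have i1: "integrable M (D k)"
    by (rule square_integrable_imp_integrable[OF Dk D2])
  have i2: "integrable M (\<lambda>w. Q (X w) * L (X w))"
    by (rule integrable_mult_of_squares[OF QX LX Q2 L2])
  have ind1: "indep_var borel (D k) borel (\<lambda>w. Q (X w) * L (X w))"
    by (rule ind'[of "\<lambda>x. x", OF _ QL]) simp
  have ind2: "indep_var borel (\<lambda>w. (D k w)\<^sup>2) borel (\<lambda>w. (L (X w))\<^sup>2)"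
    by (rule ind'[of "\<lambda>x. x\<^sup>2", OF _ LL]) simp
  note c1 = indep_var_integrable[OF ind1 i1 i2] indep_var_lebesgue_integral[OF ind1 i1 i2]
  note c2 = indep_var_integrable[OF ind2 D2 L2] indep_var_lebesgue_integral[OF ind2 D2 L2]
  have eq: "(Q (X w) + D k w * L (X w))\<^sup>2 =
    (Q (X w))\<^sup>2 + 2 * (D k w * (Q (X w) * L (X w))) + (D k w)\<^sup>2 * (L (X w))\<^sup>2" for w
    by (simp add: power2_eq_square algebra_simps)
  show ?A unfolding eq using c1(1) c2(1) Q2 by auto
  show ?B unfolding eq using c1 c2 Q2 D1 by simp
qed

text \<open>The case of a constant \<open>L\<close> in the preceding step, iterated. It is applied
  to the increments themselves and later to their compensated squares.\<close>

lemma (in prob_space) indep_linear_form_square: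
  fixes D :: "nat \<Rightarrow> 'a \<Rightarrow> real"
  assumes ind: "indep_vars (\<lambda>_. borel) D {..<n}"
    and D2: "\<And>i. i < n \<Longrightarrow> integrable M (\<lambda>w. (D i w)\<^sup>2)"
    and D1: "\<And>i. i < n \<Longrightarrow> expectation (D i) = 0"
    and v: "\<And>i. i < n \<Longrightarrow> expectation (\<lambda>w. (D i w)\<^sup>2) = v i"
    and "k \<le> n"
  shows "integrable M (\<lambda>w. (\<Sum>i<k. c i * D i w)\<^sup>2) \<and>
    expectation (\<lambda>w. (\<Sum>i<k. c i * D i w)\<^sup>2) = (\<Sum>i<k. (c i)\<^sup>2 * v i)"
  using \<open>k \<le> n\<close>
proof (induction k)
  case (Suc k)
  then have k: "k < n" by simp
  define X where "X = (\<lambda>w. restrict (\<lambda>i. D i w) {..<k})"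
  define Q where "Q x = (\<Sum>i<k. c i * x i)" for x :: "nat \<Rightarrow> real"
  have Q: "Q (X w) = (\<Sum>i<k. c i * D i w)" for w
    unfolding Q_def X_def by (intro sum.cong) auto
  have Qm: "Q \<in> borel_measurable (PiM {..<k} (\<lambda>_. borel))"
    unfolding Q_def by measurable
  have IH: "integrable M (\<lambda>w. (Q (X w))\<^sup>2)" "expectation (\<lambda>w. (Q (X w))\<^sup>2) = (\<Sum>i<k. (c i)\<^sup>2 * v i)"
    using Suc by (simp_all add: Q)
  have C2: "integrable M (\<lambda>w. (c k)\<^sup>2)" by simp
  have Cm: "(\<lambda>_. c k) \<in> borel_measurable (PiM {..<k} (\<lambda>_. borel))" by simp
  note step = indep_square_step[where Q=Q and L="\<lambda>_. c k" and X=X, OF ind k Qm Cm X_def D2[OF k] D1[OF k] IH(1) C2]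
  have eq: "(\<Sum>i<Suc k. c i * D i w) = Q (X w) + D k w * c k" for w
    by (simp add: Q)
  show ?case
    unfolding eq using step(1) unfolding step(2) IH(2) v[OF k] by (simp add: prob_space)
qed (simp add: prob_space)

lemma sum_lessThan_Suc_square:
  fixes f :: "nat \<Rightarrow> nat \<Rightarrow> real"
  shows "(\<Sum>i<Suc k. \<Sum>j<Suc k. f i j) = (\<Sum>i<k. \<Sum>j<k. f i j) + (\<Sum>i<k. f i k + f k i) + f k k"
  by (simp add: sum.distrib)

text \<open>Splitting off the last index gives Q + D_k L, where L is linear with coefficients
  \<open>a i k + a k i\<close>; the zero diagonal excludes a term in (D_k)^2. Since \<open>a\<close>
  may be asymmetric, (x + y)^2 \<le> 2 (x^2 + y^2) turns the isometry into an inequality, with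
  equality in the symmetric case.\<close>

lemma (in prob_space) indep_quadratic_form_square:
  fixes D :: "nat \<Rightarrow> 'a \<Rightarrow> real"
  assumes ind: "indep_vars (\<lambda>_. borel) D {..<n}"
    and D2: "\<And>i. i < n \<Longrightarrow> integrable M (\<lambda>w. (D i w)\<^sup>2)"
    and D1: "\<And>i. i < n \<Longrightarrow> expectation (D i) = 0"
    and v: "\<And>i. i < n \<Longrightarrow> expectation (\<lambda>w. (D i w)\<^sup>2) = v i"
    and diag: "\<And>i. i < n \<Longrightarrow> a i i = 0"
    and "k \<le> n"
  shows "integrable M (\<lambda>w. (\<Sum>i<k. \<Sum>j<k. a i j * D i w * D j w)\<^sup>2) \<and>
    expectation (\<lambda>w. (\<Sum>i<k. \<Sum>j<k. a i j * D i w * D j w)\<^sup>2) \<le>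
      2 * (\<Sum>i<k. \<Sum>j<k. (a i j)\<^sup>2 * (v i * v j))"
  using \<open>k \<le> n\<close>
proof (induction k)
  case (Suc k)
  then have k: "k < n" by simp
  have v0: "0 \<le> v i" if "i < n" for i
    unfolding v[OF that, symmetric] by simp
  define X where "X = (\<lambda>w. restrict (\<lambda>i. D i w) {..<k})"
  define Q where "Q x = (\<Sum>i<k. \<Sum>j<k. a i j * x i * x j)" for x :: "nat \<Rightarrow> real"
  define L where "L x = (\<Sum>i<k. (a i k + a k i) * x i)" for x :: "nat \<Rightarrow> real"
  have Q: "Q (X w) = (\<Sum>i<k. \<Sum>j<k. a i j * D i w * D j w)" for w
    unfolding Q_def X_def by (intro sum.cong) auto
  have L: "L (X w) = (\<Sum>i<k. (a i k + a k i) * D i w)" for w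
    unfolding L_def X_def by (intro sum.cong) auto
  have m: "Q \<in> borel_measurable (PiM {..<k} (\<lambda>_. borel))" "L \<in> borel_measurable (PiM {..<k} (\<lambda>_. borel))"
    unfolding Q_def L_def by measurable
  have IH: "integrable M (\<lambda>w. (Q (X w))\<^sup>2)"
    "expectation (\<lambda>w. (Q (X w))\<^sup>2) \<le> 2 * (\<Sum>i<k. \<Sum>j<k. (a i j)\<^sup>2 * (v i * v j))"
    using Suc by (simp_all add: Q)
  have lin: "integrable M (\<lambda>w. (L (X w))\<^sup>2)"
    "expectation (\<lambda>w. (L (X w))\<^sup>2) = (\<Sum>i<k. (a i k + a k i)\<^sup>2 * v i)"
    using indep_linear_form_square[OF ind D2 D1 v, of k "\<lambda>i. a i k + a k i"] k by (simp_all add: L)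
  have eq: "(\<Sum>i<Suc k. \<Sum>j<Suc k. a i j * D i w * D j w) = Q (X w) + D k w * L (X w)" for w
  proof -
    have "(\<Sum>i<k. a i k * D i w * D k w + a k i * D k w * D i w) = D k w * L (X w)"
      unfolding L sum_distrib_left by (intro sum.cong refl) (simp add: algebra_simps)
    then show ?thesis
      unfolding sum_lessThan_Suc_square Q by (simp add: diag[OF k])
  qed
  have "2 * (\<Sum>i<Suc k. \<Sum>j<Suc k. (a i j)\<^sup>2 * (v i * v j)) =
      2 * (\<Sum>i<k. \<Sum>j<k. (a i j)\<^sup>2 * (v i * v j)) + v k * (\<Sum>i<k. 2 * ((a i k)\<^sup>2 + (a k i)\<^sup>2) * v i)"
  proof -
    have "2 * (\<Sum>i<k. (a i k)\<^sup>2 * (v i * v k) + (a k i)\<^sup>2 * (v k * v i)) =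
        v k * (\<Sum>i<k. 2 * ((a i k)\<^sup>2 + (a k i)\<^sup>2) * v i)"
      unfolding sum_distrib_left by (intro sum.cong refl) (simp add: algebra_simps)
    then show ?thesis
      unfolding sum_lessThan_Suc_square by (simp add: diag[OF k])
  qed
  moreover have "v k * (\<Sum>i<k. (a i k + a k i)\<^sup>2 * v i) \<le> v k * (\<Sum>i<k. 2 * ((a i k)\<^sup>2 + (a k i)\<^sup>2) * v i)"
  proof (intro mult_left_mono sum_mono mult_right_mono)
    show "(x + y)\<^sup>2 \<le> 2 * (x\<^sup>2 + y\<^sup>2)" for x y :: real
      using zero_le_power2[of "x - y"] by (simp add: power2_eq_square algebra_simps)
  qed (use v0 k in auto)
  moreover note step = indep_square_step[where Q=Q and L=L and X=X, OF ind k m X_def D2[OF k] D1[OF k] IH(1) lin(1)]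
  ultimately show ?case
    using IH(2) unfolding eq lin(2) v[OF k] by linarith
qed (simp add: prob_space)

lemma (in prob_space) centered_normal_moments:
  assumes "0 < \<sigma>" and X: "distributed M lborel X (normal_density 0 \<sigma>)"
  shows "integrable M (\<lambda>w. (X w)\<^sup>2)" "expectation X = 0" "expectation (\<lambda>w. (X w)\<^sup>2) = \<sigma>\<^sup>2"
    "integrable M (\<lambda>w. (X w) ^ 4)" "expectation (\<lambda>w. (X w) ^ 4) = 3 * \<sigma> ^ 4"
proof -
  have even: "has_bochner_integral lborel (\<lambda>x. normal_density 0 \<sigma> x * x ^ (2 * k))
      (fact (2 * k) / ((2 / \<sigma>\<^sup>2) ^ k * fact k))" for k
    using normal_moment_even[OF \<open>0 < \<sigma>\<close>, of 0 k] by simp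
  have int: "integrable M (\<lambda>w. (X w) ^ (2 * k))" for k
    using distributed_integrable[OF X, of "\<lambda>x. x ^ (2 * k)"] integrable.intros[OF even[of k]] by simp
  have exp: "expectation (\<lambda>w. (X w) ^ (2 * k)) = fact (2 * k) / ((2 / \<sigma>\<^sup>2) ^ k * fact k)" for k
    using distributed_integral[OF X, of "\<lambda>x. x ^ (2 * k)"] has_bochner_integral_integral_eq[OF even[of k]]
    by simp
  show "integrable M (\<lambda>w. (X w)\<^sup>2)" using int[of 1] by simp
  show "expectation (\<lambda>w. (X w)\<^sup>2) = \<sigma>\<^sup>2" using exp[of 1] by simp
  show "integrable M (\<lambda>w. (X w) ^ 4)" using int[of 2] by simp
  show "expectation (\<lambda>w. (X w) ^ 4) = 3 * \<sigma> ^ 4"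
    using exp[of 2] \<open>0 < \<sigma>\<close> by (simp add: fact_numeral power_divide field_simps eval_nat_numeral)
  show "expectation X = 0"
    by (rule normal_distributed_expectation[OF \<open>0 < \<sigma>\<close> X])
qed

lemma (in prob_space) sq_norm_eq_expectation:
  "integrable M (\<lambda>w. (X w)\<^sup>2) \<Longrightarrow> sq_norm M X = ennreal (expectation (\<lambda>w. (X w)\<^sup>2))"
  unfolding sq_norm_def by (intro nn_integral_eq_integral) auto

section \<open>Second moments of elementary double integrals\<close>

context wiener_process
begin

lemma elementary_integral_measurable: "elementary_integral B n t a \<in> borel_measurable M"
  unfolding elementary_integral_def
  by (intro borel_measurable_sum borel_measurable_times borel_measurable_diff borel_measurable_const
      measurable_B)

lemma grid_increments:
  assumes t: "grid n t"
  shows "indep_vars (\<lambda>_. borel) (\<lambda>i w. B (t (Suc i)) w - B (t i) w) {..<n}"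
    and "\<And>i. i < n \<Longrightarrow> distributed M lborel (\<lambda>w. B (t (Suc i)) w - B (t i) w)
      (normal_density 0 (sqrt (gap t i)))"
    and "\<And>i. i < n \<Longrightarrow> 0 < gap t i"
proof -
  show pos: "0 < gap t i" if "i < n" for i
    using strict_mono_onD[OF t, of i "Suc i"] that by auto
  show "indep_vars (\<lambda>_. borel) (\<lambda>i w. B (t (Suc i)) w - B (t i) w) {..<n}"
    by (rule indep_increments[OF t])
  show "distributed M lborel (\<lambda>w. B (t (Suc i)) w - B (t i) w)
      (normal_density 0 (sqrt (gap t i)))" if "i < n" for i
    using pos[OF that] by (intro increments) simp
qed

text \<open>The last three claims concern the compensated square D^2 - v, of which the discrepancy
  between a squared simple integral and its off-diagonal double sum is made. Its variance is 3 v^2 -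
  2 v^2 + v^2 = 2 v^2, by the fourth moment of the normal law.\<close>

lemma grid_increment_moments:
  assumes t: "grid n t" and "i < n"
  defines "D \<equiv> \<lambda>w. B (t (Suc i)) w - B (t i) w" and "v \<equiv> gap t i"
  shows "integrable M (\<lambda>w. (D w)\<^sup>2)" "expectation D = 0" "expectation (\<lambda>w. (D w)\<^sup>2) = v"
    "integrable M (\<lambda>w. ((D w)\<^sup>2 - v)\<^sup>2)" "expectation (\<lambda>w. (D w)\<^sup>2 - v) = 0"
    "expectation (\<lambda>w. ((D w)\<^sup>2 - v)\<^sup>2) = 2 * v\<^sup>2"
proof -
  have pos: "0 < v" using grid_increments(3)[OF t \<open>i < n\<close>] by (simp add: v_def)
  have sq: "0 < sqrt v" "(sqrt v)\<^sup>2 = v" "sqrt v ^ 4 = v\<^sup>2"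
    using pos by (auto simp: power2_eq_square eval_nat_numeral)
  have D: "distributed M lborel D (normal_density 0 (sqrt v))"
    unfolding D_def v_def by (rule grid_increments(2)[OF t \<open>i < n\<close>])
  note m = centered_normal_moments[OF sq(1) D, unfolded sq(2,3)]
  show "integrable M (\<lambda>w. (D w)\<^sup>2)" "expectation D = 0" "expectation (\<lambda>w. (D w)\<^sup>2) = v"
    by (rule m)+
  have eq: "((D w)\<^sup>2 - v)\<^sup>2 = D w ^ 4 - 2 * v * (D w)\<^sup>2 + v\<^sup>2" for w
    by (simp add: power2_eq_square eval_nat_numeral algebra_simps)
  show "integrable M (\<lambda>w. ((D w)\<^sup>2 - v)\<^sup>2)" unfolding eq using m by simp
  show "expectation (\<lambda>w. (D w)\<^sup>2 - v) = 0" using m by (simp add: prob_space)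
  show "expectation (\<lambda>w. ((D w)\<^sup>2 - v)\<^sup>2) = 2 * v\<^sup>2"
    unfolding eq using m by (simp add: prob_space power2_eq_square)
qed

lemma sq_norm_elementary_integral_le:
  assumes a: "off_diagonal_grid n t a"
  shows "sq_norm M (elementary_integral B n t a) \<le> 2 * sq_norm lborel (elementary_kernel n t a)"
proof -
  have t: "grid n t" and diag: "\<And>i. i < n \<Longrightarrow> a i i = 0"
    using a by (auto simp: off_diagonal_grid_def)
  let ?S = "\<Sum>i<n. \<Sum>j<n. (a i j)\<^sup>2 * (gap t i * gap t j)"
  note q = indep_quadratic_form_square[where a=a and k=n and n=n and v="\<lambda>i. gap t i"
      and D="\<lambda>i w. B (t (Suc i)) w - B (t i) w", OF grid_increments(1)[OF t]
      grid_increment_moments(1)[OF t] grid_increment_moments(2)[OF t] grid_increment_moments(3)[OF t]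
      diag order_refl]
  have "integrable M (\<lambda>w. (elementary_integral B n t a w)\<^sup>2)"
    "expectation (\<lambda>w. (elementary_integral B n t a w)\<^sup>2) \<le> 2 * ?S"
    using q unfolding elementary_integral_def by auto
  then have "sq_norm M (elementary_integral B n t a) \<le> ennreal (2 * ?S)"
    by (simp add: sq_norm_eq_expectation ennreal_leI)
  also have "\<dots> = 2 * ennreal ?S"
    by (subst ennreal_mult) (auto intro!: sum_nonneg mult_nonneg_nonneg increment_nonneg[OF t])
  finally show ?thesis
    by (simp add: sq_norm_elementary_kernel[OF t])
qed

text \<open>One coefficient array on a common refinement represents the difference of the kernels,
  when \<open>b\<close> is an indicator, and the difference of the integrals, when \<open>b\<close>
  is a path. The bound for a single kernel then applies to the difference.\<close>

lemma sq_norm_elementary_integral_diff_le: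
  assumes a: "off_diagonal_grid n t a" and a': "off_diagonal_grid n' t' a'"
  shows "sq_norm M (\<lambda>w. elementary_integral B n t a w - elementary_integral B n' t' a' w) \<le>
    2 * sq_norm lborel (\<lambda>z. elementary_kernel n t a z - elementary_kernel n' t' a' z)"
proof -
  have t: "grid n t" "strict_mono_on {..n'} t'"
    using a a' by (auto simp: off_diagonal_grid_def)
  obtain m :: nat and T c where c: "off_diagonal_grid m T c"
    "\<And>b b'. step_sum m T c b b' = 1 * step_sum n t a b b' + (- 1) * step_sum n' t' a' b b'"
    using step_sum_linear_combination[OF a a', of 1 "- 1"] by metis
  then have T: "grid m T" by (simp add: off_diagonal_grid_def)
  have "elementary_integral B n t a w - elementary_integral B n' t' a' w = elementary_integral B m T c w" for w
    unfolding elementary_integral_eq_step_sum c(2) by simp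
  moreover have "elementary_kernel n t a z - elementary_kernel n' t' a' z = elementary_kernel m T c z" for z
    unfolding elementary_kernel_eq_step_sum[OF t(1)] elementary_kernel_eq_step_sum[OF t(2)]
      elementary_kernel_eq_step_sum[OF T] c(2) by simp
  ultimately show ?thesis
    using sq_norm_elementary_integral_le[OF c(1)] by simp
qed

end

text \<open>Completeness of L2 for a rapidly Cauchy sequence: the absolute differences of successive
  members have a summable expectation, so the sequence converges almost surely, and Fatou's lemma
  upgrades this to L2.\<close>

lemma (in prob_space) sq_norm_Cauchy_convergent:
  fixes Y :: "nat \<Rightarrow> 'a \<Rightarrow> real"
  assumes [measurable]: "\<And>k. Y k \<in> borel_measurable M"
    and cauchy: "\<And>k m. k \<le> m \<Longrightarrow> sq_norm M (\<lambda>w. Y m w - Y k w) \<le> ennreal ((1 / 4) ^ k)"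
  shows "\<exists>X\<in>borel_measurable M. (\<lambda>k. sq_norm M (\<lambda>w. X w - Y k w)) \<longlonglongrightarrow> 0"
proof -
  define d where "d k w = Y (Suc k) w - Y k w" for k w
  have [measurable]: "d k \<in> borel_measurable M" for k
    unfolding d_def by measurable
  have d_le: "(\<integral>\<^sup>+ w. ennreal \<bar>d k w\<bar> \<partial>M) \<le> ennreal (2 * (1 / 2) ^ k)" for k
  proof -
    \<comment> \<open>A substitute for the Cauchy-Schwarz inequality, by cases on whether |x|
      exceeds 2^(-k). Taking expectations gives 2^k 4^(-k) + 2^(-k) = 2 * 2^(-k), which is
      summable.\<close>
    have le: "\<bar>x\<bar> \<le> 2 ^ k * x\<^sup>2 + (1 / 2) ^ k" for x :: real
    proof (cases "\<bar>x\<bar> \<le> (1 / 2) ^ k")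
      case True
      then show ?thesis by (simp add: add_increasing)
    next
      case False
      then have "1 \<le> 2 ^ k * \<bar>x\<bar>" by (simp add: power_one_over field_simps)
      then have "\<bar>x\<bar> * 1 \<le> \<bar>x\<bar> * (2 ^ k * \<bar>x\<bar>)" by (intro mult_left_mono) auto
      then have "\<bar>x\<bar> \<le> 2 ^ k * x\<^sup>2"
        by (simp add: mult_ac power2_eq_square)
      then show ?thesis by (simp add: add_increasing2)
    qed
    have "(\<integral>\<^sup>+ w. ennreal \<bar>d k w\<bar> \<partial>M) \<le>
        (\<integral>\<^sup>+ w. ennreal (2 ^ k) * ennreal ((d k w)\<^sup>2) + ennreal ((1 / 2) ^ k) \<partial>M)"
      by (intro nn_integral_mono) (simp add: le ennreal_mult[symmetric] ennreal_plus[symmetric] ennreal_leI del: ennreal_plus)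
    also have "\<dots> = ennreal (2 ^ k) * sq_norm M (d k) + ennreal ((1 / 2) ^ k)"
      by (simp add: nn_integral_add nn_integral_cmult sq_norm_def emeasure_space_1)
    also have "\<dots> \<le> ennreal (2 ^ k) * ennreal ((1 / 4) ^ k) + ennreal ((1 / 2) ^ k)"
      using cauchy[of k "Suc k"] by (intro add_mono mult_left_mono) (auto simp: d_def[abs_def])
    also have "\<dots> = ennreal (2 * (1 / 2) ^ k)"
      by (simp add: ennreal_mult[symmetric] ennreal_plus[symmetric] power_mult_distrib[symmetric] del: ennreal_plus)
    finally show ?thesis .
  qed
  have "(\<integral>\<^sup>+ w. (\<Sum>k. ennreal \<bar>d k w\<bar>) \<partial>M) = (\<Sum>k. \<integral>\<^sup>+ w. ennreal \<bar>d k w\<bar> \<partial>M)"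
    by (intro nn_integral_suminf) auto
  also have "\<dots> \<le> (\<Sum>k. ennreal (2 * (1 / 2) ^ k))"
    by (intro suminf_le d_le) auto
  also have "\<dots> < \<infinity>"
    by (subst suminf_ennreal2) (auto intro!: summable_mult summable_geometric)
  finally have "AE w in M. (\<Sum>k. ennreal \<bar>d k w\<bar>) \<noteq> \<infinity>"
    by (intro nn_integral_PInf_AE) auto
  then have conv: "AE w in M. convergent (\<lambda>k. Y k w)"
  proof eventually_elim
    fix w assume "(\<Sum>k. ennreal \<bar>d k w\<bar>) \<noteq> \<infinity>"
    then have "summable (\<lambda>k. \<bar>d k w\<bar>)"
      by (intro summable_suminf_not_top) auto
    then have "summable (\<lambda>k. d k w)" by (rule summable_rabs_cancel)
    then have "convergent (\<lambda>n. \<Sum>k<n. d k w)" by (simp add: summable_iff_convergent)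
    moreover have "(\<Sum>k<n. d k w) = Y n w - Y 0 w" for n
      unfolding d_def by (rule sum_lessThan_telescope)
    ultimately have "convergent (\<lambda>n. (Y n w - Y 0 w) + Y 0 w)"
      by (intro convergent_add) (auto simp: convergent_const)
    then show "convergent (\<lambda>k. Y k w)" by simp
  qed
  define X where "X w = lim (\<lambda>k. Y k w)" for w
  have [measurable]: "X \<in> borel_measurable M"
    unfolding X_def by measurable
  have le: "sq_norm M (\<lambda>w. X w - Y k w) \<le> ennreal ((1 / 4) ^ k)" for k
  proof -
    \<comment> \<open>Writing the square as a lower limit makes Fatou's lemma applicable: the Cauchy
      bound for \<open>Y m - Y k\<close> passes to \<open>X - Y k\<close>.\<close>
    have "sq_norm M (\<lambda>w. X w - Y k w) = (\<integral>\<^sup>+ w. liminf (\<lambda>m. ennreal ((Y m w - Y k w)\<^sup>2)) \<partial>M)"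
      unfolding sq_norm_def
    proof (intro nn_integral_cong_AE)
      from conv show "AE w in M. ennreal ((X w - Y k w)\<^sup>2) = liminf (\<lambda>m. ennreal ((Y m w - Y k w)\<^sup>2))"
      proof eventually_elim
        fix w assume "convergent (\<lambda>k. Y k w)"
        then have "(\<lambda>m. Y m w) \<longlonglongrightarrow> X w"
          by (simp add: X_def convergent_LIMSEQ_iff)
        then have "(\<lambda>m. ennreal ((Y m w - Y k w)\<^sup>2)) \<longlonglongrightarrow> ennreal ((X w - Y k w)\<^sup>2)"
          by (intro tendsto_intros)
        then show "ennreal ((X w - Y k w)\<^sup>2) = liminf (\<lambda>m. ennreal ((Y m w - Y k w)\<^sup>2))"
          by (intro lim_imp_Liminf[symmetric]) auto
      qed
    qed
    also have "\<dots> \<le> liminf (\<lambda>m. sq_norm M (\<lambda>w. Y m w - Y k w))"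
      unfolding sq_norm_def by (intro nn_integral_liminf) auto
    also have "\<dots> \<le> liminf (\<lambda>m. ennreal ((1 / 4) ^ k))"
      using cauchy[of k] by (intro Liminf_mono eventually_sequentiallyI[of k])
    also have "\<dots> = ennreal ((1 / 4) ^ k)" by (simp add: Liminf_const)
    finally show ?thesis .
  qed
  have "(\<lambda>k. (1 / 4 :: real) ^ k) \<longlonglongrightarrow> 0"
    by (rule LIMSEQ_realpow_zero) auto
  from tendsto_ennrealI[OF this] have lim: "(\<lambda>k. ennreal ((1 / 4) ^ k)) \<longlonglongrightarrow> 0"
    by simp
  have "(\<lambda>k. sq_norm M (\<lambda>w. X w - Y k w)) \<longlonglongrightarrow> 0"
    by (rule tendsto_sandwich[OF _ _ tendsto_const lim]) (simp_all add: le)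
  then show ?thesis by (rule bexI[of _ X]) fact
qed

section \<open>Existence of the double Wiener integral\<close>

lemma real_interval_step:
  fixes a b :: real
  assumes "a < b" and T: "grid m T" and ab: "{a, b} \<subseteq> T ` {..m}"
  shows "\<exists>s. (\<forall>x. (\<Sum>j<m. s j * cell T j x) = indicator {a<..b} x) \<and> (\<forall>j. \<bar>s j\<bar> \<le> 1)"
proof -
  \<comment> \<open>The interval is regarded as a grid with a single cell, so that refining a step
    function covers this case.\<close>
  define t where "t i = (if i = 0 then a else b)" for i :: nat
  have t: "grid 1 t"
    using \<open>a < b\<close> by (auto simp: t_def strict_mono_on_def)
  have sub: "t ` {..1} \<subseteq> T ` {..m}"
    using ab by (auto simp: t_def)
  obtain s where s: "\<And>b. (\<Sum>j<m. s j * increment T j b) = (\<Sum>i<1. (\<lambda>_. 1) i * increment t i b)"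
    "\<And>j. \<bar>s j\<bar> \<le> (\<Sum>i<1. \<bar>(\<lambda>_::nat. 1) i\<bar>)"
    by (rule step_refine[OF t T sub, where s="\<lambda>_. 1"]) blast
  have "(\<Sum>j<m. s j * cell T j x) = indicator {a<..b} x" for x
  proof -
    have "(\<Sum>j<m. s j * cell T j x) = increment t 0 (indicator {x..})"
      unfolding step_eq_increment[OF T] s(1) by simp
    also have "\<dots> = indicator {a<..b} x"
      using increment_indicator[OF t, of 0] by (simp add: t_def)
    finally show ?thesis .
  qed
  then show ?thesis using s(2) by auto
qed

text \<open>One factor of each squared gap is bounded by the mesh and the other telescopes to the
  length of the grid, so the diagonal squares have total area of order \<eta>.\<close>

lemma diagonal_sum_le:
  assumes T: "grid m T" and mesh: "\<And>i. i < m \<Longrightarrow> gap T i \<le> \<eta>"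
    and C: "\<And>i. \<bar>s i * r i\<bar> \<le> C" and "0 \<le> \<eta>"
  shows "(\<Sum>i<m. (s i * r i)\<^sup>2 * (gap T i)\<^sup>2) \<le> C\<^sup>2 * \<eta> * (T m - T 0 :: real)"
proof -
  have "(\<Sum>i<m. (s i * r i)\<^sup>2 * (gap T i)\<^sup>2) \<le> (\<Sum>i<m. C\<^sup>2 * \<eta> * gap T i)"
  proof (rule sum_mono)
    fix i assume "i \<in> {..<m}"
    then have i: "i < m" by simp
    have "0 \<le> gap T i" by (rule increment_nonneg[OF T i])
    moreover have "(s i * r i)\<^sup>2 \<le> C\<^sup>2"
      using C[of i] abs_ge_self[of C] by (intro power2_le_iff_abs_le[THEN iffD2]) auto
    moreover have "(gap T i)\<^sup>2 \<le> \<eta> * gap T i"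
      unfolding power2_eq_square using calculation(1) mesh[OF i] by (intro mult_right_mono)
    ultimately have "(s i * r i)\<^sup>2 * (gap T i)\<^sup>2 \<le> C\<^sup>2 * (\<eta> * gap T i)"
      by (intro mult_mono) auto
    then show "(s i * r i)\<^sup>2 * (gap T i)\<^sup>2 \<le> C\<^sup>2 * \<eta> * gap T i"
      by (simp add: mult.assoc)
  qed
  also have "\<dots> = C\<^sup>2 * \<eta> * (T m - T 0)"
    unfolding sum_distrib_left[symmetric] by (simp add: sum_lessThan_telescope)
  finally show ?thesis .
qed

text \<open>A rectangle that meets the diagonal is not an off-diagonal kernel. On a grid through its
  corners it becomes one when the diagonal squares are deleted, and a fine mesh makes this
  cheap.\<close>

lemma sq_norm_indicator_rectangle_approx:
  fixes a b c d :: real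
  assumes "a < b" "c < d" "0 < e"
  shows "\<exists>n t k. off_diagonal_grid n t k \<and>
    sq_norm lborel (\<lambda>z. indicator {a<..b} (fst z) * indicator {c<..d} (snd z) - elementary_kernel n t k z) < ennreal e"
proof -
  define lo hi where "lo = min a c" and "hi = max b d"
  have lohi: "lo < hi" "{a, b, c, d} \<subseteq> {lo..hi}"
    using assms by (auto simp: lo_def hi_def)
  \<comment> \<open>The indicators have coefficients at most 1, so the diagonal error is at most
    \<eta> (hi - lo) = e/2.\<close>
  define \<eta> where "\<eta> = e / (2 * (hi - lo))"
  have \<eta>: "0 < \<eta>" using lohi assms by (simp add: \<eta>_def)
  obtain m :: nat and T where T: "grid m T" "{a, b, c, d} \<subseteq> T ` {..m}" "T 0 = lo" "T m = hi"
    "\<And>i. i < m \<Longrightarrow> gap T i \<le> \<eta>"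
    by (rule fine_grid[of "{a, b, c, d}" lo hi \<eta>]) (use lohi \<eta> in \<open>simp; fail\<close> | blast)+
  have "{a, b} \<subseteq> T ` {..m}" "{c, d} \<subseteq> T ` {..m}" using T(2) by auto
  note steps = real_interval_step[OF \<open>a < b\<close> T(1) this(1)] real_interval_step[OF \<open>c < d\<close> T(1) this(2)]
  obtain s where s: "\<And>x. (\<Sum>j<m. s j * cell T j x) = indicator {a<..b} x" "\<And>j. \<bar>s j\<bar> \<le> 1"
    using steps(1) by blast
  obtain r where r: "\<And>x. (\<Sum>j<m. r j * cell T j x) = indicator {c<..d} x" "\<And>j. \<bar>r j\<bar> \<le> 1"
    using steps(2) by blast
  have "\<bar>s i * r i\<bar> \<le> 1" for i
    using mult_mono[OF s(2)[of i] r(2)[of i]] by (simp add: abs_mult)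
  from diagonal_sum_le[OF T(1,5) this] \<eta>
  have "(\<Sum>i<m. (s i * r i)\<^sup>2 * (gap T i)\<^sup>2) \<le> \<eta> * (hi - lo)"
    using T(3,4) by simp
  also have "\<eta> * (hi - lo) = e / 2" using lohi(1) by (simp add: \<eta>_def field_simps)
  also have "\<dots> < e" using \<open>0 < e\<close> by simp
  finally have "sq_norm lborel (\<lambda>z. indicator {a<..b} (fst z) * indicator {c<..d} (snd z)
      - elementary_kernel m T (off_diag s r) z) < ennreal e"
    using sq_norm_diagonal[OF T(1), of s r] \<open>0 < e\<close> by (simp add: s(1) r(1) ennreal_lessI)
  moreover have "off_diagonal_grid m T (off_diag s r)"
    using T(1) by (simp add: off_diagonal_grid_def)
  ultimately show ?thesis by (intro exI conjI)
qed

text \<open>The conditions on \<open>G\<close> and \<open>A\<close> in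
  \<open>square_integrable_approximation\<close>, for the line and the plane at once.\<close>

lemma box_generator:
  fixes G :: "'a::euclidean_space set set"
  defines "G \<equiv> range (\<lambda>(a, b). box a b)" and "A \<equiv> \<lambda>i::nat. box (- (real i *\<^sub>R One)) (real i *\<^sub>R One :: 'a)"
  shows "Int_stable G" "G \<subseteq> Pow (space lborel)" "sets (lborel :: 'a measure) = sigma_sets (space lborel) G"
    "range A \<subseteq> G" "incseq A" "(\<Union>i. A i) = space lborel" "emeasure lborel (A i) < \<infinity>"
proof -
  show "Int_stable G" by (auto simp: G_def Int_stable_def box_Int_box)
  show "G \<subseteq> Pow (space lborel)" by simp
  show "sets (lborel :: 'a measure) = sigma_sets (space lborel) G"
    unfolding G_def sets_lborel by (subst borel_eq_box) (simp add: sets_measure_of)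
  show "range A \<subseteq> G" by (auto simp: A_def G_def)
  show "incseq A"
    unfolding A_def incseq_def by (auto simp: box_def intro: le_less_trans less_le_trans) (force+)?
  show "(\<Union>i. A i) = space lborel"
    using UN_box_eq_UNIV by (simp add: A_def)
  show "emeasure lborel (A i) < \<infinity>"
    by (simp add: A_def emeasure_lborel_box_finite)
qed

text \<open>The diagonal is a null set of the plane, so kernels that vanish on the diagonal squares
  still reach all of L2. This is what extends the integral beyond elementary kernels.\<close>

lemma off_diagonal_dense:
  assumes h: "h \<in> borel_measurable borel" "sq_norm lborel h < \<infinity>" and "0 < d"
  shows "\<exists>n t a. off_diagonal_grid n t a \<and> sq_norm lborel (\<lambda>z. h z - elementary_kernel n t a z) < ennreal d"
proof -
  define V where "V = {elementary_kernel n t a | n t a. off_diagonal_grid n t a}"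
  have "\<exists>v\<in>V. sq_norm lborel (\<lambda>z. h z - v z) < ennreal d"
  proof (rule square_integrable_approximation[OF box_generator])
    show "V \<subseteq> borel_measurable lborel" by (auto simp: V_def)
    show "(\<lambda>z. x * v z + y * w z) \<in> V" if vw: "v \<in> V" "w \<in> V" for v w x y
    proof -
      obtain n t a where v: "v = elementary_kernel n t a" "off_diagonal_grid n t a"
        using vw(1) by (auto simp: V_def)
      obtain n' t' a' where w: "w = elementary_kernel n' t' a'" "off_diagonal_grid n' t' a'"
        using vw(2) by (auto simp: V_def)
      have t: "grid n t" "strict_mono_on {..n'} t'"
        using v(2) w(2) by (auto simp: off_diagonal_grid_def)
      obtain m :: nat and T c where c: "off_diagonal_grid m T c"
        "\<And>b b'. step_sum m T c b b' = x * step_sum n t a b b' + y * step_sum n' t' a' b b'"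
        using step_sum_linear_combination[OF v(2) w(2), of x y] by metis
      then have T: "grid m T" by (simp add: off_diagonal_grid_def)
      have "(\<lambda>z. x * v z + y * w z) = elementary_kernel m T c"
        unfolding v(1) w(1) fun_eq_iff elementary_kernel_eq_step_sum[OF t(1)]
          elementary_kernel_eq_step_sum[OF t(2)] elementary_kernel_eq_step_sum[OF T] c(2) by simp
      then show ?thesis using c(1) by (auto simp: V_def)
    qed
    show "\<exists>v\<in>V. sq_norm lborel (\<lambda>x. indicator S x - v x) < ennreal e"
      if S: "S \<in> range (\<lambda>(a, b). box a b)" and "0 < e" for S e
    proof -
      obtain a b c d where S: "S = box (a, c) (b, d)"
        using S by auto
      have off0: "off_diagonal_grid 0 (\<lambda>_. 0) (\<lambda>_ _. 0)"
        by (auto simp: off_diagonal_grid_def strict_mono_on_def)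
      show ?thesis
      proof (cases "a < b \<and> c < d")
        case False
        then have "S = {}" unfolding S by (auto simp: box_def Basis_prod_def)
        then have "sq_norm lborel (\<lambda>x. indicator S x - elementary_kernel 0 (\<lambda>_. 0) (\<lambda>_ _. 0) x) = 0"
          by (simp add: sq_norm_def elementary_kernel_cell)
        then show ?thesis using off0 \<open>0 < e\<close> unfolding V_def by (auto intro!: exI bexI)
      next
        case True
        then obtain n t k where k: "off_diagonal_grid n t k"
          "sq_norm lborel (\<lambda>z. indicator {a<..b} (fst z) * indicator {c<..d} (snd z) - elementary_kernel n t k z) < ennreal e"
          using sq_norm_indicator_rectangle_approx[of a b c d e] \<open>0 < e\<close> by auto
        \<comment> \<open>The generating boxes are open whereas grid cells are half-open; the two
          rectangles differ only on the lines through the right and the upper edge.\<close>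
        have "AE z in lborel2. fst z \<noteq> b \<and> snd z \<noteq> (d :: real)"
        proof (rule lborel_pair.AE_pair_measure)
          show "{z \<in> space lborel2. fst z \<noteq> b \<and> snd z \<noteq> (d :: real)} \<in> sets lborel2"
            by measurable
          have "AE x in lborel. x \<noteq> b" "AE y in lborel. y \<noteq> d"
            by (rule AE_lborel_singleton)+
          then show "AE x in lborel. AE y in lborel. fst (x, y) \<noteq> b \<and> snd (x, y) \<noteq> d"
            by (auto elim!: eventually_mono)
        qed
        then have "AE z in lborel. indicator S z - elementary_kernel n t k z =
            indicator {a<..b} (fst z) * indicator {c<..d} (snd z) - elementary_kernel n t k z"
          unfolding lborel_prod
        proof eventually_elim
          fix z :: "real \<times> real" assume "fst z \<noteq> b \<and> snd z \<noteq> d"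
          then show "indicator S z - elementary_kernel n t k z =
            indicator {a<..b} (fst z) * indicator {c<..d} (snd z) - elementary_kernel n t k z"
            unfolding S by (cases z) (auto simp: indicator_def box_def Basis_prod_def)
        qed
        from sq_norm_cong_AE[OF this] k(2)
        have "sq_norm lborel (\<lambda>z. indicator S z - elementary_kernel n t k z) < ennreal e" by simp
        moreover have "elementary_kernel n t k \<in> V" using k(1) by (auto simp: V_def)
        ultimately show ?thesis by blast
      qed
    qed
  qed (use assms in auto)
  then show ?thesis by (auto simp: V_def)
qed

section \<open>The double integral of a square-integrable kernel\<close>

context wiener_process
begin

lemma has_double_wiener_integral_exists:
  assumes h: "h \<in> borel_measurable borel" "sq_norm lborel h < \<infinity>"
  shows "\<exists>X. has_double_wiener_integral M B h X"
proof -
  \<comment> \<open>The factor 1/8 absorbs the triangle inequality, 2 \<epsilon> m + 2 \<epsilon> k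
    \<le> 4 \<epsilon> k, and the factor 2 of the isometry bound, leaving exactly (1/4)^k.\<close>
  define \<epsilon> where "\<epsilon> k = (1 / 4) ^ k / (8::real)" for k :: nat
  have \<epsilon>: "0 < \<epsilon> k" for k by (simp add: \<epsilon>_def)
  have "\<exists>n t a. off_diagonal_grid n t a \<and> sq_norm lborel (\<lambda>z. h z - elementary_kernel n t a z) < ennreal (\<epsilon> k)" for k
    using off_diagonal_dense[OF h \<epsilon>] .
  then obtain n t a where nta: "\<And>k. off_diagonal_grid (n k) (t k) (a k)"
    "\<And>k. sq_norm lborel (\<lambda>z. h z - elementary_kernel (n k) (t k) (a k) z) < ennreal (\<epsilon> k)"
    by metis
  define K where "K k = elementary_kernel (n k) (t k) (a k)" for k
  define Y where "Y k = elementary_integral B (n k) (t k) (a k)" for k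
  have K: "K k \<in> borel_measurable lborel" for k by (simp add: K_def)
  have hK: "sq_norm lborel (\<lambda>z. h z - K k z) \<le> ennreal (\<epsilon> k)" for k
    using nta(2)[of k] by (simp add: K_def)
  have "\<exists>X\<in>borel_measurable M. (\<lambda>k. sq_norm M (\<lambda>w. X w - Y k w)) \<longlonglongrightarrow> 0"
  proof (rule sq_norm_Cauchy_convergent)
    show "Y k \<in> borel_measurable M" for k
      unfolding Y_def by (rule elementary_integral_measurable)
    fix k m :: nat assume "k \<le> m"
    then have "\<epsilon> m \<le> \<epsilon> k" unfolding \<epsilon>_def by (intro divide_right_mono power_decreasing) auto
    have "sq_norm lborel (\<lambda>z. K m z - K k z) \<le>
        2 * sq_norm lborel (\<lambda>z. K m z - h z) + 2 * sq_norm lborel (\<lambda>z. h z - K k z)"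
      using h(1) K by (intro sq_norm_triangle) auto
    also have "\<dots> \<le> 2 * ennreal (\<epsilon> m) + 2 * ennreal (\<epsilon> k)"
      by (intro add_mono mult_left_mono hK, subst sq_norm_minus_commute) (auto intro: hK)
    also have "\<dots> \<le> 2 * ennreal (\<epsilon> k) + 2 * ennreal (\<epsilon> k)"
      using \<open>\<epsilon> m \<le> \<epsilon> k\<close> by (intro add_mono mult_left_mono ennreal_leI) auto
    finally have "2 * sq_norm lborel (\<lambda>z. K m z - K k z) \<le> 2 * (2 * ennreal (\<epsilon> k) + 2 * ennreal (\<epsilon> k))"
      by (intro mult_left_mono) auto
    also have "\<dots> = ennreal (2 * (2 * \<epsilon> k + 2 * \<epsilon> k))"
      using \<epsilon>[of k] by (simp add: ennreal_mult mult_2[symmetric] mult.assoc[symmetric])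
    also have "2 * (2 * \<epsilon> k + 2 * \<epsilon> k) = (1 / 4) ^ k" by (simp add: \<epsilon>_def)
    finally show "sq_norm M (\<lambda>w. Y m w - Y k w) \<le> ennreal ((1 / 4) ^ k)"
      unfolding Y_def K_def
      by (rule order_trans[OF sq_norm_elementary_integral_diff_le[OF nta(1) nta(1)]])
  qed
  then obtain X where X: "X \<in> borel_measurable M" "(\<lambda>k. sq_norm M (\<lambda>w. X w - Y k w)) \<longlonglongrightarrow> 0"
    by auto
  have "(\<lambda>k. (1 / 4 :: real) ^ k) \<longlonglongrightarrow> 0"
    by (rule LIMSEQ_realpow_zero) auto
  from tendsto_divide[OF this tendsto_const[of 8]] have "\<epsilon> \<longlonglongrightarrow> 0"
    by (simp add: \<epsilon>_def[abs_def])
  from tendsto_ennrealI[OF this] have lim: "(\<lambda>k. ennreal (\<epsilon> k)) \<longlonglongrightarrow> 0" by simp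
  have "(\<lambda>k. sq_norm lborel (\<lambda>z. h z - K k z)) \<longlonglongrightarrow> 0"
    by (rule tendsto_sandwich[OF _ _ tendsto_const lim]) (simp_all add: hK)
  then have "has_double_wiener_integral M B h X"
    unfolding has_double_wiener_integral_def
    using h X nta(1)
    by (intro conjI exI[of _ n] exI[of _ t] exI[of _ a])
      (auto simp: nn_integral_completion sq_norm_def K_def Y_def intro: measurable_completion)
  then show ?thesis by blast
qed

lemma double_wiener_integral:
  assumes h: "h \<in> borel_measurable borel" "sq_norm lborel h < \<infinity>"
  shows "has_double_wiener_integral M B h (double_wiener_integral M B h)"
  unfolding double_wiener_integral_def by (rule someI_ex[OF has_double_wiener_integral_exists[OF h]])

text \<open>A version \<open>X\<close> comes with an approximating sequence of its own, unrelated to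
  the given kernel. The two are compared through the k-th member of that sequence, and k tends to
  infinity. The constant 8 is 2 * 2 * 2, from two triangle inequalities and the isometry
  bound.\<close>

lemma sq_norm_double_wiener_integral_diff_le:
  assumes X: "has_double_wiener_integral M B h X" and h: "h \<in> borel_measurable borel"
    and a: "off_diagonal_grid n t a"
  shows "sq_norm M (\<lambda>w. X w - elementary_integral B n t a w) \<le>
    8 * sq_norm lborel (\<lambda>z. h z - elementary_kernel n t a z)"
proof -
  obtain N T c where c: "\<And>k. off_diagonal_grid (N k) (T k) (c k)"
    and hlim: "(\<lambda>k. sq_norm lborel (\<lambda>z. h z - elementary_kernel (N k) (T k) (c k) z)) \<longlonglongrightarrow> 0"
    and Xlim: "(\<lambda>k. sq_norm M (\<lambda>w. X w - elementary_integral B (N k) (T k) (c k) w)) \<longlonglongrightarrow> 0"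
    and Xm: "X \<in> borel_measurable M"
    using X unfolding has_double_wiener_integral_def by (auto simp: nn_integral_completion sq_norm_def)
  define K where "K k = elementary_kernel (N k) (T k) (c k)" for k
  define Y where "Y k = elementary_integral B (N k) (T k) (c k)" for k
  define L where "L = elementary_kernel n t a"
  define Z where "Z = elementary_integral B n t a"
  have m: "Y k \<in> borel_measurable M" "Z \<in> borel_measurable M" "K k \<in> borel_measurable lborel"
    "L \<in> borel_measurable lborel" "h \<in> borel_measurable lborel" for k
    using h by (auto simp: Y_def Z_def K_def L_def elementary_integral_measurable)
  let ?R = "\<lambda>k. 2 * sq_norm M (\<lambda>w. X w - Y k w) +
    2 * (2 * (2 * sq_norm lborel (\<lambda>z. h z - K k z) + 2 * sq_norm lborel (\<lambda>z. h z - L z)))"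
  have "sq_norm M (\<lambda>w. X w - Z w) \<le> ?R k" for k
  proof -
    have "sq_norm M (\<lambda>w. X w - Z w) \<le>
        2 * sq_norm M (\<lambda>w. X w - Y k w) + 2 * sq_norm M (\<lambda>w. Y k w - Z w)"
      by (rule sq_norm_triangle[OF Xm m(1) m(2)])
    moreover have "sq_norm M (\<lambda>w. Y k w - Z w) \<le> 2 * sq_norm lborel (\<lambda>z. K k z - L z)"
      unfolding Y_def Z_def K_def L_def by (rule sq_norm_elementary_integral_diff_le[OF c a])
    moreover have "sq_norm lborel (\<lambda>z. K k z - L z) \<le>
        2 * sq_norm lborel (\<lambda>z. h z - K k z) + 2 * sq_norm lborel (\<lambda>z. h z - L z)"
      using sq_norm_triangle[OF m(3)[of k] m(5) m(4)] sq_norm_minus_commute[of lborel "K k" h] by simp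
    ultimately show ?thesis
      by (meson add_left_mono mult_left_mono order_trans zero_le)
  qed
  moreover have "?R \<longlonglongrightarrow> 2 * 0 + 2 * (2 * (2 * 0 + 2 * sq_norm lborel (\<lambda>z. h z - L z)))"
    using hlim Xlim unfolding K_def[symmetric] Y_def[symmetric]
    by (intro tendsto_add tendsto_const ennreal_tendsto_cmult) auto
  ultimately have "sq_norm M (\<lambda>w. X w - Z w) \<le> 2 * 0 + 2 * (2 * (2 * 0 + 2 * sq_norm lborel (\<lambda>z. h z - L z)))"
    by (intro LIMSEQ_le_const) auto
  also have "\<dots> = 8 * sq_norm lborel (\<lambda>z. h z - L z)"
    by (simp add: mult.assoc[symmetric])
  finally show ?thesis by (simp add: L_def Z_def)
qed

end

section \<open>Tensor squares\<close>

lemma step_function_linear_combination: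
  assumes t: "grid n t" and t': "strict_mono_on {..n'} t'"
  shows "\<exists>(m::nat) T r. grid m T \<and>
    (\<forall>z. (\<Sum>i<m. r i * cell T i z) = x * (\<Sum>i<n. s i * cell t i z) + y * (\<Sum>i<n'. s' i * cell t' i z))"
proof -
  have fin: "finite (t ` {..n} \<union> t' ` {..n'})" by simp
  obtain m :: nat and T where T: "grid m T" "t ` {..n} \<union> t' ` {..n'} \<subseteq> T ` {..m}"
    using common_grid[OF fin] by metis
  then have sub: "t ` {..n} \<subseteq> T ` {..m}" "t' ` {..n'} \<subseteq> T ` {..m}" by auto
  obtain r where r: "\<And>b. (\<Sum>j<m. r j * increment T j b) = (\<Sum>i<n. s i * increment t i b)"
    by (rule step_refine[OF t T(1) sub(1), where s=s]) blast
  obtain r' where r': "\<And>b. (\<Sum>j<m. r' j * increment T j b) = (\<Sum>i<n'. s' i * increment t' i b)"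
    by (rule step_refine[OF t' T(1) sub(2), where s=s']) blast
  have "(\<Sum>i<m. (x * r i + y * r' i) * cell T i z) =
      x * (\<Sum>i<n. s i * cell t i z) + y * (\<Sum>i<n'. s' i * cell t' i z)" for z
  proof -
    have "(\<Sum>i<m. (x * r i + y * r' i) * cell T i z) =
        x * (\<Sum>i<m. r i * cell T i z) + y * (\<Sum>i<m. r' i * cell T i z)"
      unfolding sum_distrib_left sum.distrib[symmetric] by (intro sum.cong refl) (simp add: algebra_simps)
    then show ?thesis
      unfolding step_eq_increment[OF t] step_eq_increment[OF t'] step_eq_increment[OF T(1)] r r' .
  qed
  then show ?thesis using T(1) by (intro exI conjI allI)
qed

lemma step_functions_dense:
  fixes h :: "real \<Rightarrow> real"
  assumes h: "h \<in> borel_measurable borel" "sq_norm lborel h < \<infinity>" and "0 < d"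
  shows "\<exists>(n::nat) t s. grid n t \<and>
    sq_norm lborel (\<lambda>x. h x - (\<Sum>i<n. s i * cell t i x)) < ennreal d"
proof -
  define V where "V = {\<lambda>x. (\<Sum>i<n. s i * cell t i x) | (n::nat) t s. grid n t}"
  have "\<exists>v\<in>V. sq_norm lborel (\<lambda>z. h z - v z) < ennreal d"
  proof (rule square_integrable_approximation[OF box_generator])
    show "V \<subseteq> borel_measurable lborel"
      by (auto simp: V_def intro!: borel_measurable_sum borel_measurable_times)
    show "(\<lambda>z. x * v z + y * w z) \<in> V" if vw: "v \<in> V" "w \<in> V" for v w x y
    proof -
      obtain n :: nat and t s where v: "v = (\<lambda>x. (\<Sum>i<n. s i * cell t i x))" "grid n t"
        using vw(1) by (auto simp: V_def)
      obtain n' :: nat and t' s' where w: "w = (\<lambda>x. (\<Sum>i<n'. s' i * cell t' i x))" "strict_mono_on {..n'} t'"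
        using vw(2) by (auto simp: V_def)
      obtain m :: nat and T r where c: "grid m T"
        "\<And>z. (\<Sum>i<m. r i * cell T i z) = x * (\<Sum>i<n. s i * cell t i z) + y * (\<Sum>i<n'. s' i * cell t' i z)"
        using step_function_linear_combination[OF v(2) w(2)] by metis
      have "(\<lambda>z. x * v z + y * w z) = (\<lambda>z. \<Sum>i<m. r i * cell T i z)"
        unfolding c(2) v(1) w(1) ..
      then show ?thesis unfolding V_def using c(1) by blast
    qed
    show "\<exists>v\<in>V. sq_norm lborel (\<lambda>x. indicator S x - v x) < ennreal e"
      if S: "S \<in> range (\<lambda>(a, b). box a b)" and "0 < e" for S :: "real set" and e
    proof -
      obtain a b where S: "S = {a<..<b}"
        using S by (auto simp: box_real)
      show ?thesis
      proof (cases "a < b")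
        case False
        have "strict_mono_on {..0::nat} (\<lambda>_. 0 :: real)" by (auto simp: strict_mono_on_def)
        then have "(\<lambda>_. 0) \<in> V"
          unfolding V_def mem_Collect_eq
          by (intro exI[of _ "0 :: nat"] exI[of _ "\<lambda>_. 0 :: real"]) simp
        moreover have "sq_norm lborel (\<lambda>x. indicator S x - 0) = 0"
          using False by (simp add: S sq_norm_def)
        ultimately show ?thesis using \<open>0 < e\<close> by (intro bexI[of _ "\<lambda>_. 0"]) auto
      next
        case True
        define t where "t i = (if i = 0 then a else b)" for i :: nat
        have t: "grid 1 t"
          using True by (auto simp: t_def strict_mono_on_def)
        define v where "v x = (\<Sum>i<1. (\<lambda>_. 1) i * cell t i x)" for x
        have "v \<in> V"
          unfolding V_def v_def[abs_def] mem_Collect_eq using t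
          by (intro exI[of _ "1 :: nat"] exI[of _ t] exI[of _ "\<lambda>_. 1 :: real"]) simp
        moreover have "AE x in lborel. indicator S x - v x = 0"
          using AE_lborel_singleton[of b]
        proof eventually_elim
          fix x assume "x \<noteq> b"
          then show "indicator S x - v x = 0"
            by (auto simp: v_def S t_def cell_def indicator_def)
        qed
        then have "sq_norm lborel (\<lambda>x. indicator S x - v x) = sq_norm lborel (\<lambda>_ :: real. 0)"
          by (rule sq_norm_cong_AE)
        ultimately show ?thesis using \<open>0 < e\<close> by (intro bexI[of _ v]) (auto simp: sq_norm_def)
      qed
    qed
  qed (use assms in auto)
  then show ?thesis unfolding V_def by blast
qed

text \<open>Continuity of the squared norm in a quantitative form: p^2 - q^2 = (p - q)(p + q),
  together with a b \<le> a^2/\<tau> + \<tau> b^2. A small \<tau> makes the multiple of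
  \<open>E\<close> small, and for this fixed \<tau> a small \<open>x\<close> controls the
  rest.\<close>

lemma sq_norm_close:
  assumes [measurable]: "f \<in> borel_measurable M" "e \<in> borel_measurable M"
    and S: "sq_norm M f = ennreal S" "0 \<le> S" and E: "sq_norm M e = ennreal E" "0 \<le> E"
    and x: "sq_norm M (\<lambda>y. e y - f y) = ennreal x" "0 \<le> x" and \<tau>: "0 < \<tau>"
  shows "\<bar>S - E\<bar> \<le> (1 / \<tau> + 2 * \<tau>) * x + 8 * \<tau> * E"
proof -
  have pw: "\<bar>p\<^sup>2 - q\<^sup>2\<bar> \<le> (1 / \<tau> + 2 * \<tau>) * (q - p)\<^sup>2 + 8 * \<tau> * q\<^sup>2" for p q :: real
  proof -
    define a b where "a = \<bar>p - q\<bar>" and "b = \<bar>p + q\<bar>"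
    have "0 \<le> (a / sqrt \<tau> - sqrt \<tau> * b / 2)\<^sup>2" by simp
    also have "\<dots> = a\<^sup>2 / \<tau> + \<tau> * b\<^sup>2 / 4 - a * b"
      using \<tau> by (simp add: power2_diff power_divide power_mult_distrib)
    finally have ab: "a * b \<le> a\<^sup>2 / \<tau> + \<tau> * b\<^sup>2"
      using \<tau> zero_le_power2[of b] mult_nonneg_nonneg[of \<tau> "b\<^sup>2"] by linarith
    \<comment> \<open>The difference of the two sides is exactly (p - 3q)^2.\<close>
    have "b\<^sup>2 \<le> 2 * a\<^sup>2 + 8 * q\<^sup>2"
      using zero_le_power2[of "p - 3 * q"] unfolding a_def b_def
      by (simp add: power2_eq_square algebra_simps)
    then have "\<tau> * b\<^sup>2 \<le> \<tau> * (2 * a\<^sup>2 + 8 * q\<^sup>2)" using \<tau> by (intro mult_left_mono) auto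
    moreover have "\<bar>p\<^sup>2 - q\<^sup>2\<bar> = a * b"
      unfolding a_def b_def abs_mult[symmetric] by (simp add: power2_eq_square algebra_simps)
    moreover have "a\<^sup>2 = (q - p)\<^sup>2" by (simp add: a_def power2_commute)
    ultimately show ?thesis using ab by (simp add: algebra_simps)
  qed
  define c where "c = 1 / \<tau> + 2 * \<tau>"
  have c: "0 \<le> c" using \<tau> by (simp add: c_def)
  have bound: "ennreal A \<le> ennreal (P + c * x + 8 * \<tau> * E)"
    if a: "sq_norm M a = ennreal A" and p: "p \<in> borel_measurable M" "sq_norm M p = ennreal P" "0 \<le> P"
      and le: "\<And>y. (a y)\<^sup>2 \<le> (p y)\<^sup>2 + c * (e y - f y)\<^sup>2 + 8 * \<tau> * (e y)\<^sup>2" for a p A P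
  proof -
    note [measurable] = p(1)
    have "ennreal A \<le> (\<integral>\<^sup>+ y. ennreal ((p y)\<^sup>2) + ennreal c * ennreal ((e y - f y)\<^sup>2)
        + ennreal (8 * \<tau>) * ennreal ((e y)\<^sup>2) \<partial>M)"
      unfolding a[symmetric] sq_norm_def
      using ennreal_leI[OF le] c \<tau> by (intro nn_integral_mono) (simp add: ennreal_mult ennreal_plus)
    also have "\<dots> = sq_norm M p + ennreal c * sq_norm M (\<lambda>y. e y - f y) + ennreal (8 * \<tau>) * sq_norm M e"
      by (simp add: sq_norm_def nn_integral_add nn_integral_cmult)
    finally show ?thesis
      using p E x c \<tau> by (simp add: ennreal_mult[symmetric] ennreal_plus[symmetric] del: ennreal_plus)
  qed
  have le: "(f y)\<^sup>2 \<le> (e y)\<^sup>2 + c * (e y - f y)\<^sup>2 + 8 * \<tau> * (e y)\<^sup>2"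
    "(e y)\<^sup>2 \<le> (f y)\<^sup>2 + c * (e y - f y)\<^sup>2 + 8 * \<tau> * (e y)\<^sup>2" for y
    using pw[of "f y" "e y"] unfolding c_def by linarith+
  have nonneg: "0 \<le> c * x" "0 \<le> 8 * \<tau> * E" using c x E \<tau> by auto
  have "S \<le> E + c * x + 8 * \<tau> * E" "E \<le> S + c * x + 8 * \<tau> * E"
    by (rule ennreal_le_iff[THEN iffD1, OF _ bound[OF S(1) assms(2) E le(1)]],
        use nonneg E(2) in linarith)
      (rule ennreal_le_iff[THEN iffD1, OF _ bound[OF E(1) assms(1) S le(2)]], use nonneg S(2) in linarith)
  then show ?thesis unfolding c_def[symmetric] by linarith
qed

text \<open>The approximation has two scales. A step function \<open>u\<close> close to
  \<open>e\<close> is fixed, and only afterwards is its grid refined: this changes neither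
  \<open>u\<close> nor its norm but shrinks the diagonal squares. All three smallness claims hold
  for the same refined grid.\<close>

lemma tensor_square_approx:
  fixes e :: "real \<Rightarrow> real"
  assumes e [measurable]: "e \<in> borel_measurable borel" and E: "sq_norm lborel e = ennreal E" "0 \<le> E"
    and \<delta>: "0 < \<delta>"
  shows "\<exists>(n::nat) t s. grid n t \<and>
    (\<Sum>i<n. (s i * s i)\<^sup>2 * (gap t i)\<^sup>2) < \<delta> \<and>
    sq_norm lborel (\<lambda>z. e (fst z) * e (snd z)
      - elementary_kernel n t (off_diag s s) z) < ennreal \<delta> \<and>
    \<bar>(\<Sum>i<n. (s i)\<^sup>2 * gap t i) - E\<bar> < \<delta>"
proof -
  \<comment> \<open>Makes the last term of \<open>sq_norm_close\<close> small: 8 \<tau> E = \<delta>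
    E / (2 (E + 1)) < \<delta>/2.\<close>
  define \<tau> where "\<tau> = \<delta> / (16 * (E + 1))"
  have \<tau>: "0 < \<tau>" "8 * \<tau> * E < \<delta> / 2 + 0 * E"
    using \<delta> E(2) by (auto simp: \<tau>_def field_simps)
  define c where "c = 1 / \<tau> + 2 * \<tau>"
  have c: "0 < c" using \<tau>(1) by (simp add: c_def add_pos_pos)
  \<comment> \<open>The first entry gives c x \<le> \<delta>/2 in the norm estimate. The second
    serves the tensor product: e \<otimes> e - u \<otimes> u costs 2 x (E + S) with S < E +
    \<delta>, hence less than \<delta>/4.\<close>
  define d where "d = min (\<delta> / (2 * c)) (\<delta> / (8 * (2 * E + \<delta>)))"
  have d: "0 < d" using \<delta> c E(2) by (simp add: d_def)
  obtain n :: nat and t s where t: "grid n t"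
    and close: "sq_norm lborel (\<lambda>x. e x - (\<Sum>i<n. s i * cell t i x)) < ennreal d"
    using step_functions_dense[OF e _ d] E(1) by (auto simp: less_top[symmetric])
  define u where "u x = (\<Sum>i<n. s i * cell t i x)" for x
  have u [measurable]: "u \<in> borel_measurable borel"
    unfolding u_def by (intro borel_measurable_sum borel_measurable_times) auto
  obtain x where x: "sq_norm lborel (\<lambda>y. e y - u y) = ennreal x" "0 \<le> x" "x < d"
    using close by (cases "sq_norm lborel (\<lambda>y. e y - u y)") (auto simp: u_def ennreal_less_iff)
  define S where "S = (\<Sum>i<n. (s i)\<^sup>2 * gap t i)"
  have S: "sq_norm lborel u = ennreal S" "0 \<le> S"
    unfolding u_def S_def by (auto simp: sq_norm_step[OF t] intro!: sum_nonneg mult_nonneg_nonneg increment_nonneg[OF t])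
  have "\<bar>S - E\<bar> \<le> c * x + 8 * \<tau> * E"
    unfolding c_def by (rule sq_norm_close[OF _ _ S E x(1,2) \<tau>(1)]) auto
  moreover have "c * x \<le> \<delta> / 2"
  proof -
    have "c * x \<le> c * (\<delta> / (2 * c))" using x c by (intro mult_left_mono) (auto simp: d_def)
    then show ?thesis using c by simp
  qed
  ultimately have SE: "\<bar>S - E\<bar> < \<delta>" using \<tau>(2) by linarith
  define C where "C = (\<Sum>i<n. \<bar>s i\<bar>)"
  have C: "0 \<le> C" unfolding C_def by (intro sum_nonneg) auto
  \<comment> \<open>The refined grid receives a margin of 1 on each side, because
    \<open>fine_grid\<close> asks for a nondegenerate interval while \<open>t\<close> may consist of
    a single point. Hence the summand 2.\<close>
  define L where "L = t n - t 0 + 2"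
  have tn: "t 0 \<le> t i" "t i \<le> t n" if "i \<le> n" for i
    using that t by (auto intro!: strict_mono_on_leD[OF t])
  have L: "0 < L" using tn(1)[of n] by (simp add: L_def)
  \<comment> \<open>\<open>C\<close> bounds the coefficients on every refinement, so the diagonal
    sum is at most (C C)^2 \<eta> L \<le> \<delta>/8. The added 1 keeps the denominator positive
    when C = 0.\<close>
  define \<eta> where "\<eta> = \<delta> / (8 * (((C * C)\<^sup>2 + 1) * L))"
  have \<eta>: "0 < \<eta>" using \<delta> L by (simp add: \<eta>_def add_nonneg_pos)
  obtain m :: nat and T where T: "grid m T" "t ` {..n} \<subseteq> T ` {..m}"
    "T 0 = t 0 - 1" "T m = t n + 1" "\<And>i. i < m \<Longrightarrow> gap T i \<le> \<eta>"
  proof (rule fine_grid[of "t ` {..n}" "t 0 - 1" "t n + 1" \<eta>])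
    show "t ` {..n} \<subseteq> {t 0 - 1..t n + 1}" using tn by fastforce
    show "t 0 - 1 < t n + 1" using tn(1)[of n] by simp
  qed (use \<eta> in auto)
  obtain r where r: "\<And>b. (\<Sum>j<m. r j * increment T j b) = (\<Sum>i<n. s i * increment t i b)"
    "\<And>j. \<bar>r j\<bar> \<le> C"
    unfolding C_def by (rule step_refine[OF t T(1,2), where s=s]) blast
  have ur: "u x = (\<Sum>j<m. r j * cell T j x)" for x
    unfolding u_def step_eq_increment[OF t] step_eq_increment[OF T(1)] r(1) ..
  \<comment> \<open>The refined coefficients describe the same function \<open>u\<close>, so the
    closeness of \<open>S\<close> to \<open>E\<close> survives the refinement.\<close>
  have SR: "S = (\<Sum>j<m. (r j)\<^sup>2 * gap T j)"
  proof -
    have "ennreal S = ennreal (\<Sum>j<m. (r j)\<^sup>2 * gap T j)"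
      unfolding S(1)[symmetric] ur[abs_def] by (rule sq_norm_step[OF T(1)])
    moreover have "0 \<le> (\<Sum>j<m. (r j)\<^sup>2 * gap T j)"
      by (intro sum_nonneg mult_nonneg_nonneg increment_nonneg[OF T(1)]) auto
    ultimately show ?thesis using S(2) by simp
  qed
  have rr: "\<bar>r i * r i\<bar> \<le> C * C" for i
    unfolding abs_mult using r(2)[of i] by (intro mult_mono) auto
  have "(\<Sum>i<m. (r i * r i)\<^sup>2 * (gap T i)\<^sup>2) \<le> (C * C)\<^sup>2 * \<eta> * (T m - T 0)"
    using \<eta> by (intro diagonal_sum_le[OF T(1,5) rr]) auto
  also have "T m - T 0 = L" using T(3,4) by (simp add: L_def)
  also have "(C * C)\<^sup>2 * \<eta> * L = (C * C)\<^sup>2 * (\<eta> * L)" by (rule mult.assoc)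
  also have "\<dots> \<le> ((C * C)\<^sup>2 + 1) * (\<eta> * L)" using \<eta> L by (intro mult_right_mono) auto
  also have "\<dots> = \<eta> * (((C * C)\<^sup>2 + 1) * L)" by (simp only: mult_ac)
  also have "\<dots> = \<delta> / 8"
  proof -
    have cancel: "\<delta> / (8 * X) * X = \<delta> / 8" if "0 < X" for X
      using that by simp
    have "0 < ((C * C)\<^sup>2 + 1) * L"
      using L by (simp add: add_nonneg_pos)
    then show ?thesis
      unfolding \<eta>_def by (rule cancel)
  qed
  also have "\<dots> < \<delta> / 4" using \<delta> by simp
  finally have diag: "(\<Sum>i<m. (r i * r i)\<^sup>2 * (gap T i)\<^sup>2) < \<delta> / 4" .
  define K where "K = elementary_kernel m T (off_diag r r)"
  have eu: "sq_norm lborel (\<lambda>z. e (fst z) * e (snd z) - u (fst z) * u (snd z)) < ennreal (\<delta> / 4)"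
  proof -
    have "sq_norm lborel (\<lambda>z. e (fst z) * e (snd z) - u (fst z) * u (snd z)) =
        sq_norm lborel (\<lambda>z. (e (fst z) - u (fst z)) * e (snd z) + u (fst z) * (e (snd z) - u (snd z)))"
      by (simp add: algebra_simps)
    also have "\<dots> \<le> 2 * sq_norm lborel (\<lambda>z. (e (fst z) - u (fst z)) * e (snd z)) +
        2 * sq_norm lborel (\<lambda>z. u (fst z) * (e (snd z) - u (snd z)))"
      by (intro sq_norm_add_le) (auto simp: borel_prod[symmetric])
    also have "\<dots> = 2 * (ennreal x * ennreal E) + 2 * (ennreal S * ennreal x)"
      using sq_norm_prod[of "\<lambda>y. e y - u y" e] sq_norm_prod[of u "\<lambda>y. e y - u y"]
      by (simp add: x(1) E(1) S(1))
    also have "\<dots> = ennreal (2 * (x * E) + 2 * (S * x))"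
      using x E S by (simp add: ennreal_mult ennreal_plus)
    also have "\<dots> < ennreal (\<delta> / 4)"
    proof (rule ennreal_lessI)
      have "2 * (x * E) + 2 * (S * x) = x * (2 * (E + S))" by (simp add: algebra_simps)
      also have "\<dots> \<le> x * (2 * (2 * E + \<delta>))" using x SE by (intro mult_left_mono) auto
      also have "\<dots> < \<delta> / (8 * (2 * E + \<delta>)) * (2 * (2 * E + \<delta>))"
        using x \<delta> E(2) by (intro mult_strict_right_mono) (auto simp: d_def)
      also have "\<dots> = \<delta> / 4"
      proof -
        have "2 * E + \<delta> \<noteq> 0" using \<delta> E(2) by simp
        then show ?thesis by (simp add: field_simps)
      qed
      finally show "2 * (x * E) + 2 * (S * x) < \<delta> / 4" .
    qed (use \<delta> in simp)
    finally show ?thesis .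
  qed
  have uK: "sq_norm lborel (\<lambda>z. u (fst z) * u (snd z) - K z) < ennreal (\<delta> / 4)"
    unfolding ur K_def sq_norm_diagonal[OF T(1)] using diag \<delta> by (intro ennreal_lessI) auto
  have "sq_norm lborel (\<lambda>z. e (fst z) * e (snd z) - K z) \<le>
      2 * sq_norm lborel (\<lambda>z. e (fst z) * e (snd z) - u (fst z) * u (snd z)) +
      2 * sq_norm lborel (\<lambda>z. u (fst z) * u (snd z) - K z)"
    by (rule sq_norm_triangle) (auto simp: K_def borel_prod[symmetric], simp add: borel_prod)
  also have "\<dots> < ennreal \<delta>" using eu uK by (rule ennreal_quarter_less)
  finally have eK: "sq_norm lborel (\<lambda>z. e (fst z) * e (snd z) - K z) < ennreal \<delta>" .
  have diag': "(\<Sum>i<m. (r i * r i)\<^sup>2 * (gap T i)\<^sup>2) < \<delta>" using diag \<delta> by linarith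
  have "\<bar>(\<Sum>i<m. (r i)\<^sup>2 * gap T i) - E\<bar> < \<delta>" using SE unfolding SR .
  with T(1) diag' eK show ?thesis unfolding K_def by (intro exI conjI)
qed

section \<open>Limits of double integrals of almost rank-one kernels\<close>

lemma iexp_diff_le: "cmod (iexp a - iexp b) \<le> \<bar>a - b\<bar>"
proof -
  have "iexp a - iexp b = iexp b * (iexp (a - b) - 1)"
    by (simp add: algebra_simps exp_add[symmetric])
  then have "cmod (iexp a - iexp b) = cmod (iexp (a - b) - 1)"
    by (simp add: norm_mult)
  also have "\<dots> \<le> \<bar>a - b\<bar>"
    using iexp_approx1[of "a - b" 0] by simp
  finally show ?thesis .
qed

lemma (in prob_space) expectation_abs_le_sqrt:
  fixes D :: "'a \<Rightarrow> real"
  assumes [measurable]: "D \<in> borel_measurable M" and D: "integrable M (\<lambda>w. (D w)\<^sup>2)"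
  shows "integrable M D" "expectation (\<lambda>w. \<bar>D w\<bar>) \<le> sqrt (expectation (\<lambda>w. (D w)\<^sup>2))"
proof -
  show i: "integrable M D"
    by (rule square_integrable_imp_integrable[OF _ D]) simp
  have "0 \<le> variance (\<lambda>w. \<bar>D w\<bar>)" by (rule integral_nonneg_AE) simp
  also have "\<dots> = expectation (\<lambda>w. \<bar>D w\<bar>\<^sup>2) - (expectation (\<lambda>w. \<bar>D w\<bar>))\<^sup>2"
    using i D by (intro variance_eq) auto
  finally show "expectation (\<lambda>w. \<bar>D w\<bar>) \<le> sqrt (expectation (\<lambda>w. (D w)\<^sup>2))"
    by (intro real_le_rsqrt) simp
qed

lemma (in prob_space) char_distr:
  assumes [measurable]: "X \<in> borel_measurable M"
  shows "char (distr M borel X) t = (CLINT w|M. iexp (t * X w))"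
  unfolding char_def by (subst integral_distr) auto

text \<open>\<open>iexp\<close> is 1-Lipschitz on the real line, and on a probability space the L1
  norm is at most the L2 norm.\<close>

lemma (in prob_space) char_distr_diff_le:
  assumes [measurable]: "X \<in> borel_measurable M" "Y \<in> borel_measurable M"
    and fin: "sq_norm M (\<lambda>w. X w - Y w) < \<infinity>"
  shows "cmod (char (distr M borel X) t - char (distr M borel Y) t)
    \<le> \<bar>t\<bar> * sqrt (enn2real (sq_norm M (\<lambda>w. X w - Y w)))"
proof -
  have int: "integrable M (\<lambda>w. (X w - Y w)\<^sup>2)"
    using fin unfolding sq_norm_def by (intro integrableI_nonneg) auto
  then have eq: "enn2real (sq_norm M (\<lambda>w. X w - Y w)) = expectation (\<lambda>w. (X w - Y w)\<^sup>2)"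
    by (simp add: sq_norm_eq_expectation)
  note abs = expectation_abs_le_sqrt[OF _ int]
  have "char (distr M borel X) t - char (distr M borel Y) t = (CLINT w|M. iexp (t * X w) - iexp (t * Y w))"
    by (simp add: char_distr integrable_iexp)
  also have "cmod \<dots> \<le> (LINT w|M. cmod (iexp (t * X w) - iexp (t * Y w)))"
    by (rule integral_norm_bound)
  also have "\<dots> \<le> (LINT w|M. \<bar>t\<bar> * \<bar>X w - Y w\<bar>)"
  proof (rule integral_mono)
    show "integrable M (\<lambda>w. cmod (iexp (t * X w) - iexp (t * Y w)))"
      by (intro integrable_norm Bochner_Integration.integrable_diff integrable_iexp) auto
    show "integrable M (\<lambda>w. \<bar>t\<bar> * \<bar>X w - Y w\<bar>)"
      using abs(1) by auto
    show "cmod (iexp (t * X w) - iexp (t * Y w)) \<le> \<bar>t\<bar> * \<bar>X w - Y w\<bar>" for w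
      using iexp_diff_le[of "t * X w" "t * Y w"] by (simp add: abs_mult[symmetric] right_diff_distrib)
  qed
  also have "\<dots> = \<bar>t\<bar> * expectation (\<lambda>w. \<bar>X w - Y w\<bar>)" by simp
  also have "\<dots> \<le> \<bar>t\<bar> * sqrt (expectation (\<lambda>w. (X w - Y w)\<^sup>2))"
    using abs(2) by (intro mult_left_mono) auto
  finally show ?thesis unfolding eq .
qed

text \<open>Slutsky's argument on the level of characteristic functions: an L2 distance tending to 0
  does not affect their limit, so Levy's continuity theorem for \<open>X\<close> can be fed with the
  laws of \<open>Y\<close>.\<close>

lemma (in prob_space) weak_conv_of_sq_norm_close:
  assumes X: "\<And>n. X n \<in> borel_measurable M" and Y: "\<And>n. Y n \<in> borel_measurable M"
    and close: "(\<lambda>n. sq_norm M (\<lambda>w. X n w - Y n w)) \<longlonglongrightarrow> 0"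
    and \<nu>: "real_distribution \<nu>"
    and char: "\<And>t. (\<lambda>n. char (distr M borel (Y n)) t) \<longlonglongrightarrow> char \<nu> t"
  shows "weak_conv_m (\<lambda>n. distr M borel (X n)) \<nu>"
proof (rule levy_continuity)
  show "real_distribution (distr M borel (X n))" for n
    by (rule real_distribution_distr[OF X])
  show "real_distribution \<nu>" by fact
  fix t
  have "(\<lambda>n. char (distr M borel (X n)) t - char (distr M borel (Y n)) t) \<longlonglongrightarrow> 0"
  proof (rule Lim_null_comparison)
    show "\<forall>\<^sub>F n in sequentially. norm (char (distr M borel (X n)) t - char (distr M borel (Y n)) t) \<le>
        \<bar>t\<bar> * sqrt (enn2real (sq_norm M (\<lambda>w. X n w - Y n w)))"
      using order_tendstoD(2)[OF close, of \<infinity>] by (auto elim!: eventually_mono intro: char_distr_diff_le[OF X Y])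
    have "(\<lambda>n. enn2real (sq_norm M (\<lambda>w. X n w - Y n w))) \<longlonglongrightarrow> 0"
      by (rule tendsto_enn2real) (use close in simp_all)
    then show "(\<lambda>n. \<bar>t\<bar> * sqrt (enn2real (sq_norm M (\<lambda>w. X n w - Y n w)))) \<longlonglongrightarrow> 0"
      using tendsto_mult[OF tendsto_const tendsto_real_sqrt, of _ 0 sequentially "\<bar>t\<bar>"] by simp
  qed
  from tendsto_add[OF this char[of t]]
  show "(\<lambda>n. char (distr M borel (X n)) t) \<longlonglongrightarrow> char \<nu> t" by simp
qed

text \<open>After standardization the variance \<open>S\<close> appears only in the integrand and
  the measure is fixed, so its limit can be taken by dominated convergence.\<close>

lemma (in prob_space) char_normal_square:
  assumes X: "distributed M lborel X (normal_density 0 (sqrt S))" and S: "0 < S"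
  shows "char (distr M borel (\<lambda>w. F * ((X w)\<^sup>2 - S))) t =
    (CLINT z|std_normal_distribution. iexp (t * (F * S * (z\<^sup>2 - 1))))"
proof -
  have sq: "0 < sqrt S" using S by simp
  have Z: "distributed M lborel (\<lambda>w. X w / sqrt S) std_normal_density"
    using X normal_standard_normal_convert[OF sq, of X 0] by simp
  have [measurable]: "X \<in> borel_measurable M"
    using distributed_measurable[OF X] by simp
  have "std_normal_distribution = distr M lborel (\<lambda>w. X w / sqrt S)"
    using distributed_distr_eq_density[OF Z] by simp
  then have std: "(CLINT z|std_normal_distribution. iexp (t * (F * S * (z\<^sup>2 - 1)))) =
      (CLINT w|M. iexp (t * (F * S * ((X w / sqrt S)\<^sup>2 - 1))))"
    by (simp add: integral_distr)
  have "F * S * ((X w / sqrt S)\<^sup>2 - 1) = F * ((X w)\<^sup>2 - S)" for w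
    using S by (simp add: power_divide field_simps)
  then show ?thesis
    unfolding std by (simp only:) (rule char_distr, measurable)
qed

lemma char_normal_square_tendsto:
  assumes "S \<longlonglongrightarrow> c"
  shows "(\<lambda>n. CLINT z|std_normal_distribution. iexp (t * (F * S n * (z\<^sup>2 - 1))))
    \<longlonglongrightarrow> char (distr std_normal_distribution borel (\<lambda>z. F * c * (z\<^sup>2 - 1))) t"
proof -
  interpret N: real_distribution std_normal_distribution by (rule real_dist_normal_dist)
  have "(\<lambda>n. CLINT z|std_normal_distribution. iexp (t * (F * S n * (z\<^sup>2 - 1))))
      \<longlonglongrightarrow> (CLINT z|std_normal_distribution. iexp (t * (F * c * (z\<^sup>2 - 1))))"
  proof (rule integral_dominated_convergence[where w="\<lambda>_. 1"])
    show "AE z in std_normal_distribution.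
        (\<lambda>n. iexp (t * (F * S n * (z\<^sup>2 - 1)))) \<longlonglongrightarrow> iexp (t * (F * c * (z\<^sup>2 - 1)))"
      using assms by (intro AE_I2 tendsto_intros)
  qed auto
  then show ?thesis by (simp add: N.char_distr)
qed

section \<open>Replacing double integrals by squares of normal variables\<close>

context wiener_process
begin

lemma step_integral_distributed:
  assumes t: "grid n t" and S: "S = (\<Sum>i<n. (s i)\<^sup>2 * gap t i)" "0 < S"
  shows "distributed M lborel (\<lambda>w. \<Sum>i<n. s i * (B (t (Suc i)) w - B (t i) w)) (normal_density 0 (sqrt S))"
proof -
  \<comment> \<open>Indices with coefficient 0 are removed, as a degenerate normal law has no
    density. By \<open>0 < S\<close> some index remains.\<close>
  define I where "I = {i\<in>{..<n}. s i \<noteq> 0}"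
  define D where "D i w = s i * (B (t (Suc i)) w - B (t i) w)" for i w
  define \<sigma> where "\<sigma> i = \<bar>s i\<bar> * sqrt (gap t i)" for i
  have fin: "finite I" by (simp add: I_def)
  have pos: "0 < gap t i" if "i \<in> I" for i
    using grid_increments(3)[OF t, of i] that by (simp add: I_def)
  have sum_I: "S = (\<Sum>i\<in>I. (\<sigma> i)\<^sup>2)"
  proof -
    have "S = (\<Sum>i\<in>I. (s i)\<^sup>2 * gap t i)"
      unfolding S(1) I_def by (rule sum.mono_neutral_right) auto
    also have "\<dots> = (\<Sum>i\<in>I. (\<sigma> i)\<^sup>2)"
      using pos by (intro sum.cong refl) (auto simp: \<sigma>_def power_mult_distrib less_imp_le)
    finally show ?thesis .
  qed
  have "I \<noteq> {}" using sum_I S(2) by auto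
  have indep: "indep_vars (\<lambda>_. borel) D {..<n}"
    unfolding D_def by (rule indep_vars_compose2[OF grid_increments(1)[OF t], where Y="\<lambda>i x. s i * x"]) simp
  then have "indep_vars (\<lambda>_. borel) D I"
    by (rule indep_vars_subset) (auto simp: I_def)
  then have "distributed M lborel (\<lambda>w. \<Sum>i\<in>I. D i w) (normal_density (\<Sum>i\<in>I. (\<lambda>_. 0) i) (sqrt (\<Sum>i\<in>I. (\<sigma> i)\<^sup>2)))"
  proof (rule sum_indep_normal[OF fin \<open>I \<noteq> {}\<close>])
    show "0 < \<sigma> i" if "i \<in> I" for i
      using pos[OF that] that by (simp add: \<sigma>_def I_def)
    show "distributed M lborel (D i) (normal_density 0 (\<sigma> i))" if "i \<in> I" for i
    proof -
      have i: "i < n" "s i \<noteq> 0" using that by (auto simp: I_def)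
      have "distributed M lborel (\<lambda>w. 0 + s i * (B (t (Suc i)) w - B (t i) w))
          (normal_density (0 + s i * 0) (\<bar>s i\<bar> * sqrt (gap t i)))"
        using pos[OF that] i by (intro normal_density_affine grid_increments(2)[OF t]) auto
      then show ?thesis by (simp add: D_def[abs_def] \<sigma>_def)
    qed
  qed
  moreover have "(\<Sum>i\<in>I. D i w) = (\<Sum>i<n. s i * (B (t (Suc i)) w - B (t i) w))" for w
    unfolding D_def I_def by (rule sum.mono_neutral_left) auto
  ultimately show ?thesis by (simp add: sum_I)
qed

text \<open>The off-diagonal double sum is the full square minus its diagonal, so the difference
  equals -F times the sum of s_i^2 (D_i^2 - v_i). This is a linear form in independent centred
  variables of variance 2 v_i^2, which explains the factor 2.\<close>

lemma elementary_integral_square: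
  fixes s :: "nat \<Rightarrow> real" and F :: real
  assumes t: "grid n t" and S: "S = (\<Sum>i<n. (s i)\<^sup>2 * gap t i)"
  shows "sq_norm M (\<lambda>w. elementary_integral B n t (\<lambda>i j. F * (if i = j then 0 else s i * s j)) w -
      F * ((\<Sum>i<n. s i * (B (t (Suc i)) w - B (t i) w))\<^sup>2 - S))
    = ennreal (2 * F\<^sup>2 * (\<Sum>i<n. (s i * s i)\<^sup>2 * (gap t i)\<^sup>2))"
proof -
  define D where "D i w = B (t (Suc i)) w - B (t i) w" for i w
  define v where "v i = gap t i" for i
  define W where "W i w = (D i w)\<^sup>2 - v i" for i w
  define c where "c i = - F * (s i)\<^sup>2" for i
  have ind: "indep_vars (\<lambda>_. borel) W {..<n}"
    unfolding W_def D_def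
    by (rule indep_vars_compose2[OF grid_increments(1)[OF t], where Y="\<lambda>i x. x\<^sup>2 - v i"]) simp
  note m = grid_increment_moments(4,5,6)[OF t]
  have W: "integrable M (\<lambda>w. (\<Sum>i<n. c i * W i w)\<^sup>2)"
    "expectation (\<lambda>w. (\<Sum>i<n. c i * W i w)\<^sup>2) = (\<Sum>i<n. (c i)\<^sup>2 * (2 * (v i)\<^sup>2))"
    using indep_linear_form_square[where n=n and k=n and D=W and c=c and v="\<lambda>i. 2 * (v i)\<^sup>2", OF ind]
      m unfolding W_def D_def v_def by auto
  have "elementary_integral B n t (\<lambda>i j. F * (if i = j then 0 else s i * s j)) w -
      F * ((\<Sum>i<n. s i * D i w)\<^sup>2 - S) = (\<Sum>i<n. c i * W i w)" for w
  proof -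
    have "elementary_integral B n t (\<lambda>i j. F * (if i = j then 0 else s i * s j)) w =
        (\<Sum>i<n. \<Sum>j<n. F * ((s i * D i w) * (s j * D j w)) - (if i = j then F * (s i * D i w)\<^sup>2 else 0))"
      unfolding elementary_integral_def D_def
      by (intro sum.cong refl) (auto simp: power2_eq_square mult_ac)
    also have "\<dots> = F * (\<Sum>i<n. s i * D i w)\<^sup>2 - F * (\<Sum>i<n. (s i * D i w)\<^sup>2)"
    proof -
      have "(\<Sum>i<n. s i * D i w)\<^sup>2 = (\<Sum>i<n. \<Sum>j<n. (s i * D i w) * (s j * D j w))"
        by (simp only: power2_eq_square sum_product)
      then show ?thesis
        by (simp only: sum_subtractf sum_distrib_left) simp
    qed
    finally have "elementary_integral B n t (\<lambda>i j. F * (if i = j then 0 else s i * s j)) w -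
      F * ((\<Sum>i<n. s i * D i w)\<^sup>2 - S) = F * S - F * (\<Sum>i<n. (s i * D i w)\<^sup>2)"
      by (simp add: algebra_simps)
    also have "\<dots> = (\<Sum>i<n. c i * W i w)"
      unfolding S sum_distrib_left sum_subtractf[symmetric]
      by (intro sum.cong refl) (simp add: c_def W_def v_def power_mult_distrib algebra_simps)
    finally show ?thesis .
  qed
  then have "sq_norm M (\<lambda>w. elementary_integral B n t (\<lambda>i j. F * (if i = j then 0 else s i * s j)) w -
      F * ((\<Sum>i<n. s i * D i w)\<^sup>2 - S)) = ennreal (\<Sum>i<n. (c i)\<^sup>2 * (2 * (v i)\<^sup>2))"
    using sq_norm_eq_expectation[OF W(1)] W(2) by simp
  also have "(\<Sum>i<n. (c i)\<^sup>2 * (2 * (v i)\<^sup>2)) = 2 * F\<^sup>2 * (\<Sum>i<n. (s i * s i)\<^sup>2 * (v i)\<^sup>2)"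
    unfolding sum_distrib_left
    by (intro sum.cong refl) (simp add: c_def power_mult_distrib power2_eq_square mult_ac)
  finally show ?thesis by (simp add: D_def v_def)
qed

text \<open>The integral of a kernel near F e \<otimes> e is compared with a variable whose law is
  explicit. The constant 32 is 2 * 8 * 2, from the comparison with an elementary integral between
  two triangle inequalities. The terms in F^2 \<delta> add up to 32 + 4 = 36, rounded up to
  40.\<close>

lemma tensor_square_integral_approx:
  fixes F :: real and e :: "real \<Rightarrow> real" and h :: "real \<times> real \<Rightarrow> real"
  assumes h: "h \<in> borel_measurable borel" and X: "has_double_wiener_integral M B h X"
    and e: "e \<in> borel_measurable borel" "sq_norm lborel e = ennreal E" "0 < E" and "0 < \<delta>"
  shows "\<exists>Y S. Y \<in> borel_measurable M \<and> distributed M lborel Y (normal_density 0 (sqrt S)) \<and> 0 < S \<and>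
    \<bar>S - E\<bar> < \<delta> \<and>
    sq_norm M (\<lambda>w. X w - F * ((Y w)\<^sup>2 - S)) \<le>
      32 * sq_norm lborel (\<lambda>z. h z - F * (e (fst z) * e (snd z))) + ennreal (40 * F\<^sup>2 * \<delta>)"
proof -
  \<comment> \<open>With d \<le> E the estimate |S - E| < d forces S > 0, so that the normal law of
    \<open>Y\<close> is nondegenerate.\<close>
  define d where "d = min \<delta> E"
  have d: "0 < d" "d \<le> \<delta>" "d \<le> E" using \<open>0 < \<delta>\<close> e(3) by (auto simp: d_def)
  obtain n :: nat and t s where t: "grid n t"
    and diag: "(\<Sum>i<n. (s i * s i)\<^sup>2 * (gap t i)\<^sup>2) < d"
    and K: "sq_norm lborel (\<lambda>z. e (fst z) * e (snd z)
      - elementary_kernel n t (off_diag s s) z) < ennreal d"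
    and S: "\<bar>(\<Sum>i<n. (s i)\<^sup>2 * gap t i) - E\<bar> < d"
    using tensor_square_approx[OF e(1,2) less_imp_le[OF e(3)] d(1)] by blast
  define S where "S = (\<Sum>i<n. (s i)\<^sup>2 * gap t i)"
  define Y where "Y w = (\<Sum>i<n. s i * (B (t (Suc i)) w - B (t i) w))" for w
  define a where "a i j = F * (if i = j then 0 else s i * s j)" for i j :: nat
  define k where "k = elementary_kernel n t (off_diag s s)"
  define T where "T z = e (fst z) * e (snd z)" for z
  have S0: "0 < S" "\<bar>S - E\<bar> < \<delta>" using S d unfolding S_def by linarith+
  have Y: "Y \<in> borel_measurable M"
    unfolding Y_def by (intro borel_measurable_sum borel_measurable_times borel_measurable_diff
        borel_measurable_const measurable_B)
  have Xm: "X \<in> borel_measurable M" using X by (simp add: has_double_wiener_integral_def)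
  have a: "off_diagonal_grid n t a" using t by (simp add: off_diagonal_grid_def a_def)
  have ker: "elementary_kernel n t a z = F * k z" for z
    unfolding elementary_kernel_cell k_def a_def sum_distrib_left by (intro sum.cong refl) simp
  have m: "T \<in> borel_measurable lborel" "k \<in> borel_measurable lborel" "h \<in> borel_measurable lborel"
  proof -
    have "(\<lambda>z. e (fst z) * e (snd z)) \<in> borel_measurable (borel \<Otimes>\<^sub>M borel)"
      using e(1) by measurable
    then show "T \<in> borel_measurable lborel" by (simp add: T_def[abs_def] borel_prod)
  qed (use h in \<open>auto simp: k_def\<close>)
  have FT: "(\<lambda>z. F * T z) \<in> borel_measurable lborel" "(\<lambda>z. F * k z) \<in> borel_measurable lborel"
    using m by (auto intro: borel_measurable_times)
  let ?I = "elementary_integral B n t a"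
  have 1: "sq_norm lborel (\<lambda>z. F * T z - F * k z) \<le> ennreal (F\<^sup>2 * \<delta>)"
  proof -
    have "sq_norm lborel (\<lambda>z. F * T z - F * k z) = ennreal (F\<^sup>2) * sq_norm lborel (\<lambda>z. T z - k z)"
      unfolding right_diff_distrib[symmetric] using m by (intro sq_norm_cmult) auto
    also have "\<dots> \<le> ennreal (F\<^sup>2) * ennreal \<delta>"
      using K d unfolding T_def k_def by (intro mult_left_mono) (auto intro: less_imp_le order_trans ennreal_leI)
    finally show ?thesis using \<open>0 < \<delta>\<close> by (simp add: ennreal_mult)
  qed
  have 2: "sq_norm lborel (\<lambda>z. h z - F * k z) \<le> 2 * sq_norm lborel (\<lambda>z. h z - F * T z) + 2 * ennreal (F\<^sup>2 * \<delta>)"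
    using sq_norm_triangle[OF m(3) FT] 1 by (meson add_left_mono mult_left_mono order_trans zero_le)
  have 3: "sq_norm M (\<lambda>w. X w - ?I w) \<le>
      8 * (2 * sq_norm lborel (\<lambda>z. h z - F * T z) + 2 * ennreal (F\<^sup>2 * \<delta>))"
    using sq_norm_double_wiener_integral_diff_le[OF X h a] 2 unfolding ker
    by (meson mult_left_mono order_trans zero_le)
  have 4: "sq_norm M (\<lambda>w. ?I w - F * ((Y w)\<^sup>2 - S)) \<le> ennreal (2 * F\<^sup>2 * \<delta>)"
    using elementary_integral_square[OF t S_def, of F] diag d
    unfolding Y_def a_def by (auto intro!: ennreal_leI mult_left_mono)
  have FY: "(\<lambda>w. F * ((Y w)\<^sup>2 - S)) \<in> borel_measurable M" using Y by measurable
  have "sq_norm M (\<lambda>w. X w - F * ((Y w)\<^sup>2 - S)) \<le>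
      2 * sq_norm M (\<lambda>w. X w - ?I w) + 2 * sq_norm M (\<lambda>w. ?I w - F * ((Y w)\<^sup>2 - S))"
    by (rule sq_norm_triangle[OF Xm elementary_integral_measurable FY])
  also have "\<dots> \<le> 2 * (8 * (2 * sq_norm lborel (\<lambda>z. h z - F * T z) + 2 * ennreal (F\<^sup>2 * \<delta>))) +
      2 * ennreal (2 * F\<^sup>2 * \<delta>)"
    using 3 4 by (intro add_mono mult_left_mono) auto
  also have "\<dots> = 32 * sq_norm lborel (\<lambda>z. h z - F * T z) + (32 * ennreal (F\<^sup>2 * \<delta>) + 2 * ennreal (2 * F\<^sup>2 * \<delta>))"
    by (simp add: distrib_left mult.assoc[symmetric] add.assoc)
  also have "32 * ennreal (F\<^sup>2 * \<delta>) + 2 * ennreal (2 * F\<^sup>2 * \<delta>) = ennreal (32 * (F\<^sup>2 * \<delta>) + 2 * (2 * F\<^sup>2 * \<delta>))"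
  proof -
    have num: "numeral k * ennreal u = ennreal (numeral k * u)" if "0 \<le> u" for k u
      using that by (simp add: ennreal_mult)
    have u: "0 \<le> F\<^sup>2 * \<delta>" "0 \<le> 2 * F\<^sup>2 * \<delta>" using \<open>0 < \<delta>\<close> by auto
    show ?thesis
      unfolding num[OF u(1)] num[OF u(2)] by (rule ennreal_plus[symmetric]) (use u in simp_all)
  qed
  also have "\<dots> \<le> ennreal (40 * F\<^sup>2 * \<delta>)"
    using \<open>0 < \<delta>\<close> by (intro ennreal_leI) (simp add: algebra_simps)
  finally show ?thesis
    using step_integral_distributed[OF t S_def S0(1)] Y S0 unfolding T_def Y_def[symmetric]
    by (intro exI[of _ Y] exI[of _ S] conjI) (auto simp: add_left_mono)
qed

text \<open>For the n-th kernel the step function approximation is made with its own accuracy 1/(n +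
  1). The resulting \<open>Y n\<close> need not converge as random variables: the law of F (Y_n^2 -
  S_n) is determined by F and S_n, and S_n has the same limit as \<open>E n\<close>.\<close>

theorem second_chaos_limit:
  fixes F :: real and e :: "nat \<Rightarrow> real \<Rightarrow> real" and h :: "nat \<Rightarrow> real \<times> real \<Rightarrow> real"
  assumes h: "\<And>n. h n \<in> borel_measurable borel" "\<And>n. sq_norm lborel (h n) < \<infinity>"
    and e: "\<And>n. e n \<in> borel_measurable borel" "\<And>n. sq_norm lborel (e n) = ennreal (E n)" "\<And>n. 0 < E n"
    and E: "E \<longlonglongrightarrow> c"
    and lim: "(\<lambda>n. sq_norm lborel (\<lambda>z. h n z - F * (e n (fst z) * e n (snd z)))) \<longlonglongrightarrow> 0"
  shows "weak_conv_m (\<lambda>n. distr M borel (double_wiener_integral M B (h n)))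
    (distr std_normal_distribution borel (\<lambda>z. F * c * (z\<^sup>2 - 1)))"
proof -
  define \<delta> where "\<delta> n = 1 / real (Suc n)" for n
  have \<delta>: "0 < \<delta> n" for n by (simp add: \<delta>_def)
  have \<delta>0: "\<delta> \<longlonglongrightarrow> 0"
    unfolding \<delta>_def[abs_def] using LIMSEQ_inverse_real_of_nat by (simp add: inverse_eq_divide)
  define X where "X n = double_wiener_integral M B (h n)" for n
  have X: "has_double_wiener_integral M B (h n) (X n)" for n
    unfolding X_def by (rule double_wiener_integral[OF h])
  define P where "P n Y S \<longleftrightarrow> Y \<in> borel_measurable M \<and>
    distributed M lborel Y (normal_density 0 (sqrt S)) \<and> 0 < S \<and> \<bar>S - E n\<bar> < \<delta> n \<and>
    sq_norm M (\<lambda>w. X n w - F * ((Y w)\<^sup>2 - S)) \<le>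
      32 * sq_norm lborel (\<lambda>z. h n z - F * (e n (fst z) * e n (snd z))) + ennreal (40 * F\<^sup>2 * \<delta> n)" for n Y S
  have "\<exists>Y S. P n Y S" for n
    unfolding P_def by (rule tensor_square_integral_approx[OF h(1) X e(1) e(2) e(3) \<delta>])
  then obtain Y S where "\<And>n. P n (Y n) (S n)" by metis
  then have Y: "\<And>n. Y n \<in> borel_measurable M"
    "\<And>n. distributed M lborel (Y n) (normal_density 0 (sqrt (S n)))" "\<And>n. 0 < S n" "\<And>n. \<bar>S n - E n\<bar> < \<delta> n"
    and le: "\<And>n. sq_norm M (\<lambda>w. X n w - F * ((Y n w)\<^sup>2 - S n)) \<le>
      32 * sq_norm lborel (\<lambda>z. h n z - F * (e n (fst z) * e n (snd z))) + ennreal (40 * F\<^sup>2 * \<delta> n)"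
    by (simp_all add: P_def)
  have "(\<lambda>n. S n - E n) \<longlonglongrightarrow> 0"
    by (rule Lim_null_comparison[OF always_eventually \<delta>0]) (use Y(4) in \<open>auto intro: less_imp_le\<close>)
  from tendsto_add[OF this E] have S: "S \<longlonglongrightarrow> c" by simp
  have "(\<lambda>n. 40 * F\<^sup>2 * \<delta> n) \<longlonglongrightarrow> 40 * F\<^sup>2 * 0" by (intro tendsto_intros \<delta>0)
  from tendsto_ennrealI[OF this] have "(\<lambda>n. ennreal (40 * F\<^sup>2 * \<delta> n)) \<longlonglongrightarrow> 0" by simp
  from tendsto_add[OF ennreal_tendsto_cmult[OF _ lim, of 32] this]
  have lim': "(\<lambda>n. 32 * sq_norm lborel (\<lambda>z. h n z - F * (e n (fst z) * e n (snd z))) + ennreal (40 * F\<^sup>2 * \<delta> n)) \<longlonglongrightarrow> 0"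
    by simp
  have "weak_conv_m (\<lambda>n. distr M borel (X n)) (distr std_normal_distribution borel (\<lambda>z. F * c * (z\<^sup>2 - 1)))"
  proof (rule weak_conv_of_sq_norm_close)
    show "X n \<in> borel_measurable M" for n using X[of n] by (simp add: has_double_wiener_integral_def)
    show "(\<lambda>w. F * ((Y n w)\<^sup>2 - S n)) \<in> borel_measurable M" for n
      using Y(1)[of n] by measurable
    show "(\<lambda>n. sq_norm M (\<lambda>w. X n w - F * ((Y n w)\<^sup>2 - S n))) \<longlonglongrightarrow> 0"
      by (rule tendsto_sandwich[OF _ _ tendsto_const lim']) (simp_all add: le)
    interpret N: real_distribution std_normal_distribution by (rule real_dist_normal_dist)
    show "real_distribution (distr std_normal_distribution borel (\<lambda>z. F * c * (z\<^sup>2 - 1)))"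
      by (rule N.real_distribution_distr) simp
    show "(\<lambda>n. char (distr M borel (\<lambda>w. F * ((Y n w)\<^sup>2 - S n))) t)
        \<longlonglongrightarrow> char (distr std_normal_distribution borel (\<lambda>z. F * c * (z\<^sup>2 - 1))) t" for t
      unfolding char_normal_square[OF Y(2) Y(3)] by (rule char_normal_square_tendsto[OF S])
  qed
  then show ?thesis by (simp add: X_def)
qed

end

section \<open>Inner products of the Riesz kernels\<close>

text \<open>The substitution z = x/(1 + x) maps the positive half-line onto (0,1). As 1 - z = 1/(1 +
  x) and dz = dx/(1 + x)^2, it turns Euler's integral into this form.\<close>

lemma nn_integral_Beta_half_line:
  fixes a b :: real
  assumes a: "0 < a" and b: "0 < b"
  shows "(\<integral>\<^sup>+ x. ennreal (x powr (a - 1) * (1 + x) powr (- a - b)) * indicator {0<..} x \<partial>lborel) =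
    ennreal (Beta a b)"
proof -
  define f where "f z = z powr (a - 1) * (1 - z) powr (b - 1)" for z :: real
  define g where "g x = x / (1 + x)" for x :: real
  define g' where "g' x = 1 / (1 + x)\<^sup>2" for x :: real
  have "(f has_integral Beta a b) {0..1}"
    using has_integral_Beta_real[OF a b] by (simp add: f_def[abs_def])
  then have "(f has_integral Beta a b) {0<..<1}"
    by (simp add: has_integral_Icc_iff_Ioo)
  moreover have img: "g ` {0<..} = {0<..<1}"
  proof (intro equalityI subsetI)
    fix z :: real assume z: "z \<in> {0<..<1}"
    then have "z = g (z / (1 - z))" "0 < z / (1 - z)" by (auto simp: g_def field_simps)
    then show "z \<in> g ` {0<..}" by blast
  qed (auto simp: g_def field_simps)
  ultimately have f: "(f has_integral Beta a b) (g ` {0<..})" by simp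
  have "f absolutely_integrable_on (g ` {0<..})"
    by (intro nonnegative_absolutely_integrable_1 has_integral_integrable[OF f]) (simp add: f_def)
  moreover have "integral (g ` {0<..}) f = Beta a b" using f by (rule integral_unique)
  moreover have "(\<lambda>x. \<bar>g' x\<bar> * f (g x)) absolutely_integrable_on {0<..} \<and>
      integral {0<..} (\<lambda>x. \<bar>g' x\<bar> * f (g x)) = Beta a b \<longleftrightarrow>
      f absolutely_integrable_on (g ` {0<..}) \<and> integral (g ` {0<..}) f = Beta a b"
  proof (rule has_absolute_integral_change_of_variables_1')
    show "(g has_field_derivative g' x) (at x within {0<..})" if "x \<in> {0<..}" for x
      using that unfolding g_def g'_def
      by (auto intro!: derivative_eq_intros simp: field_simps power2_eq_square)
    show "inj_on g {0<..}" by (auto simp: inj_on_def g_def field_simps)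
  qed simp
  ultimately have "(\<lambda>x. \<bar>g' x\<bar> * f (g x)) absolutely_integrable_on {0<..}"
    "integral {0<..} (\<lambda>x. \<bar>g' x\<bar> * f (g x)) = Beta a b" by auto
  then have int: "((\<lambda>x. \<bar>g' x\<bar> * f (g x)) has_integral Beta a b) {0<..}"
    by (metis has_integral_integral set_lebesgue_integral_eq_integral(1))
  have eq: "\<bar>g' x\<bar> * f (g x) = x powr (a - 1) * (1 + x) powr (- a - b)" if "x \<in> {0<..}" for x
  proof -
    have x: "0 < x" "0 < 1 + x" using that by auto
    have g1: "1 - g x = 1 / (1 + x)" using x by (simp add: g_def field_simps)
    have "g x powr (a - 1) = x powr (a - 1) * (1 + x) powr (- (a - 1))"
      unfolding g_def using x powr_minus_divide[of "1 + x" "a - 1"] by (simp add: powr_divide)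
    moreover have "(1 / (1 + x)) powr (b - 1) = (1 + x) powr (- (b - 1))"
      using x powr_minus_divide[of "1 + x" "b - 1"] by (simp add: powr_divide)
    moreover have "g' x = (1 + x) powr (- 2)"
      using x by (simp add: g'_def powr_minus powr_numeral divide_inverse)
    ultimately have "\<bar>g' x\<bar> * f (g x) = x powr (a - 1) *
        ((1 + x) powr (- 2) * (1 + x) powr (- (a - 1)) * (1 + x) powr (- (b - 1)))"
      unfolding f_def g1 by (simp add: mult_ac)
    also have "(1 + x) powr (- 2) * (1 + x) powr (- (a - 1)) * (1 + x) powr (- (b - 1)) = (1 + x) powr (- a - b)"
      unfolding powr_add[symmetric] by (rule arg_cong[where f="\<lambda>t. (1 + x) powr t"]) simp
    finally show ?thesis .
  qed
  have "((\<lambda>x. x powr (a - 1) * (1 + x) powr (- a - b)) has_integral Beta a b) {0<..}"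
    by (rule has_integral_eq[OF eq int])
  then show ?thesis
    by (intro nn_integral_has_integral_lebesgue') auto
qed

text \<open>For u < v put d = v - u and y = u - d x; the two differences become d x and d (1 + x).
  Scaling produces d * d^(2a-2) = d^(2a-1), and what remains is the half-line form of the beta
  integral with b = 1 - 2a, since a - 1 = -a - b.\<close>

lemma nn_integral_powr_product:
  fixes a u v :: real
  assumes a: "0 < a" "a < 1 / 2" and uv: "u \<noteq> v"
  shows "(\<integral>\<^sup>+ y. ennreal (max (u - y) 0 powr (a - 1) * max (v - y) 0 powr (a - 1)) \<partial>lborel) =
    ennreal (Beta a (1 - 2 * a) * \<bar>u - v\<bar> powr (2 * a - 1))"
proof -
  have less: "(\<integral>\<^sup>+ y. ennreal (max (u - y) 0 powr (a - 1) * max (v - y) 0 powr (a - 1)) \<partial>lborel) =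
    ennreal (Beta a (1 - 2 * a) * (v - u) powr (2 * a - 1))" if "u < v" for u v :: real
  proof -
    define d where "d = v - u"
    have d: "0 < d" using that by (simp add: d_def)
    let ?J = "\<integral>\<^sup>+ x. ennreal (x powr (a - 1) * (1 + x) powr (- a - (1 - 2 * a))) * indicator {0<..} x \<partial>lborel"
    have "(\<integral>\<^sup>+ y. ennreal (max (u - y) 0 powr (a - 1) * max (v - y) 0 powr (a - 1)) \<partial>lborel) =
        ennreal \<bar>- d\<bar> * (\<integral>\<^sup>+ x. ennreal (max (u - (u + - d * x)) 0 powr (a - 1) *
          max (v - (u + - d * x)) 0 powr (a - 1)) \<partial>lborel)"
      using d by (intro nn_integral_real_affine) auto
    also have "(\<integral>\<^sup>+ x. ennreal (max (u - (u + - d * x)) 0 powr (a - 1) * max (v - (u + - d * x)) 0 powr (a - 1)) \<partial>lborel) =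
        (\<integral>\<^sup>+ x. ennreal (d powr (2 * a - 2)) *
          (ennreal (x powr (a - 1) * (1 + x) powr (- a - (1 - 2 * a))) * indicator {0<..} x) \<partial>lborel)"
    proof (intro nn_integral_cong)
      fix x :: real
      have e1: "u - (u + - d * x) = d * x" "v - (u + - d * x) = d * (1 + x)"
        by (simp_all add: d_def algebra_simps)
      show "ennreal (max (u - (u + - d * x)) 0 powr (a - 1) * max (v - (u + - d * x)) 0 powr (a - 1)) =
          ennreal (d powr (2 * a - 2)) *
          (ennreal (x powr (a - 1) * (1 + x) powr (- a - (1 - 2 * a))) * indicator {0<..} x)"
      proof (cases "0 < x")
        case True
        then have "max (d * x) 0 = d * x" "max (d * (1 + x)) 0 = d * (1 + x)" using d by auto
        moreover have "(d * x) powr (a - 1) * (d * (1 + x)) powr (a - 1) =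
            d powr (2 * a - 2) * (x powr (a - 1) * (1 + x) powr (a - 1))"
        proof -
          have "d powr (2 * a - 2) = d powr (a - 1) * d powr (a - 1)"
            unfolding powr_add[symmetric] by simp
          then show ?thesis using True d by (simp add: powr_mult mult_ac)
        qed
        ultimately show ?thesis
          unfolding e1 using True by (simp add: ennreal_mult)
      next
        case False
        then have "max (d * x) 0 = 0" using d by (simp add: max_def mult_le_0_iff)
        then show ?thesis unfolding e1 using False by simp
      qed
    qed
    also have "\<dots> = ennreal (d powr (2 * a - 2)) * ?J"
      by (rule nn_integral_cmult) measurable
    also have "?J = ennreal (Beta a (1 - 2 * a))"
      using a by (intro nn_integral_Beta_half_line) auto
    also have "ennreal \<bar>- d\<bar> * (ennreal (d powr (2 * a - 2)) * ennreal (Beta a (1 - 2 * a))) =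
        ennreal (d * d powr (2 * a - 2)) * ennreal (Beta a (1 - 2 * a))"
      using d by (simp add: ennreal_mult mult.assoc)
    also have "d * d powr (2 * a - 2) = d powr (2 * a - 1)"
    proof -
      have "d * d powr (2 * a - 2) = d powr 1 * d powr (2 * a - 2)" using d by simp
      also have "\<dots> = d powr (1 + (2 * a - 2))" by (simp only: powr_add)
      finally show ?thesis by simp
    qed
    also have "ennreal (d powr (2 * a - 1)) * ennreal (Beta a (1 - 2 * a)) =
        ennreal (Beta a (1 - 2 * a) * (v - u) powr (2 * a - 1))"
    proof -
      have "0 \<le> Beta a (1 - 2 * a)"
        using a by (simp add: Beta_def Gamma_real_pos less_imp_le)
      then show ?thesis by (simp only: ennreal_mult[symmetric] powr_ge_zero d_def mult.commute)
    qed
    finally show ?thesis .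
  qed
  show ?thesis
  proof (cases "u < v")
    case True
    then show ?thesis using less[OF True] by (simp add: abs_if)
  next
    case False
    then have "v < u" using uv by simp
    from less[OF this] show ?thesis using \<open>v < u\<close> by (simp add: abs_if mult.commute)
  qed
qed

lemma Beta_pos:
  assumes "0 < a" "0 < (b :: real)"
  shows "0 < Beta a b"
  using assms by (simp add: Beta_def Gamma_real_pos)

text \<open>The inner product of two mixtures is the mixture of the inner products, by Fubini's
  theorem for three variables. The factorization of the inner integral holds only for almost every
  y, namely where the product is integrable in the two mixing variables.\<close>

lemma integral_mixture_product:
  fixes p :: "'y \<times> 'u \<Rightarrow> real" and q :: "'y \<times> 'v \<Rightarrow> real"
  assumes "sigma_finite_measure Y" "sigma_finite_measure P" "sigma_finite_measure Q"
    and p: "p \<in> borel_measurable (Y \<Otimes>\<^sub>M P)" and q: "q \<in> borel_measurable (Y \<Otimes>\<^sub>M Q)"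
    and int: "integrable (Y \<Otimes>\<^sub>M (P \<Otimes>\<^sub>M Q)) (\<lambda>(y, w). p (y, fst w) * q (y, snd w))"
  shows "integrable Y (\<lambda>y. (\<integral>u. p (y, u) \<partial>P) * (\<integral>v. q (y, v) \<partial>Q))" (is ?A)
    and "(\<integral>y. (\<integral>u. p (y, u) \<partial>P) * (\<integral>v. q (y, v) \<partial>Q) \<partial>Y) =
      (\<integral>w. (\<integral>y. p (y, fst w) * q (y, snd w) \<partial>Y) \<partial>(P \<Otimes>\<^sub>M Q))" (is ?B)
proof -
  interpret Y: sigma_finite_measure Y by fact
  interpret P: sigma_finite_measure P by fact
  interpret Q: sigma_finite_measure Q by fact
  interpret PQ: pair_sigma_finite P Q ..
  interpret YPQ: pair_sigma_finite Y "P \<Otimes>\<^sub>M Q" ..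
  have meas: "(\<lambda>y. (\<integral>u. p (y, u) \<partial>P) * (\<integral>v. q (y, v) \<partial>Q)) \<in> borel_measurable Y"
    using p q by (intro borel_measurable_times P.borel_measurable_lebesgue_integral
        Q.borel_measurable_lebesgue_integral) auto
  have eq: "AE y in Y. (\<integral>w. p (y, fst w) * q (y, snd w) \<partial>(P \<Otimes>\<^sub>M Q)) = (\<integral>u. p (y, u) \<partial>P) * (\<integral>v. q (y, v) \<partial>Q)"
    using YPQ.AE_integrable_fst'[OF int]
  proof eventually_elim
    fix y assume "integrable (P \<Otimes>\<^sub>M Q) (\<lambda>w. case (y, w) of (y, w) \<Rightarrow> p (y, fst w) * q (y, snd w))"
    then have "integrable (P \<Otimes>\<^sub>M Q) (\<lambda>w. p (y, fst w) * q (y, snd w))" by simp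
    from PQ.integral_fst'[OF this]
    show "(\<integral>w. p (y, fst w) * q (y, snd w) \<partial>(P \<Otimes>\<^sub>M Q)) = (\<integral>u. p (y, u) \<partial>P) * (\<integral>v. q (y, v) \<partial>Q)"
      by simp
  qed
  have int1: "integrable Y (\<lambda>y. \<integral>w. p (y, fst w) * q (y, snd w) \<partial>(P \<Otimes>\<^sub>M Q))"
    using YPQ.integrable_fst'[OF int] by simp
  show ?A by (rule integrable_cong_AE_imp[OF int1 meas eq])
  have "(\<integral>y. (\<integral>u. p (y, u) \<partial>P) * (\<integral>v. q (y, v) \<partial>Q) \<partial>Y) =
      (\<integral>y. (\<integral>w. p (y, fst w) * q (y, snd w) \<partial>(P \<Otimes>\<^sub>M Q)) \<partial>Y)"
    using eq by (intro integral_cong_AE meas borel_measurable_integrable[OF int1]) (auto elim: eventually_mono)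
  also have "\<dots> = (\<integral>w. (\<integral>y. p (y, fst w) * q (y, snd w) \<partial>Y) \<partial>(P \<Otimes>\<^sub>M Q))"
    by (rule YPQ.Fubini_integral[OF int, symmetric])
  finally show ?B .
qed

section \<open>Riesz kernels and their average over the unit interval\<close>

abbreviation riesz_beta :: "real \<Rightarrow> real" where
  "riesz_beta H \<equiv> Beta (H / 2) (1 - H)"

definition riesz :: "real \<Rightarrow> real \<Rightarrow> real \<Rightarrow> real" where
  "riesz H u y = max (u - y) 0 powr (H / 2 - 1)"

lemma riesz_measurable [measurable (raw)]:
  "f \<in> borel_measurable M \<Longrightarrow> g \<in> borel_measurable M \<Longrightarrow> (\<lambda>x. riesz H (f x) (g x)) \<in> borel_measurable M"
  unfolding riesz_def by measurable

lemma riesz_nonneg: "0 \<le> riesz H u y"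
  by (simp add: riesz_def)

lemma nn_integral_riesz_product:
  assumes H: "1 / 2 < H" "H < 1" and "u \<noteq> v"
  shows "(\<integral>\<^sup>+ y. ennreal (riesz H u y * riesz H v y) \<partial>lborel) =
    ennreal (riesz_beta H * \<bar>u - v\<bar> powr (H - 1))"
  using nn_integral_powr_product[of "H / 2" u v] assms by (simp add: riesz_def)

text \<open>A domination that is uniform over exponents q between p and 0: exponent p is the worse
  one for d \<le> 1, and exponent 0 for d > 1. All limits H \<rightarrow> 1 below rest on
  it.\<close>

lemma powr_le_one_plus_powr:
  fixes d :: real
  assumes "0 \<le> d" "p \<le> q" "q \<le> 0"
  shows "d powr q \<le> 1 + d powr p"
proof (cases "d \<le> 1")
  case True
  then have "d powr q \<le> d powr p" using assms by (intro powr_mono') auto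
  then show ?thesis by simp
next
  case False
  then have "d powr q \<le> d powr 0" using assms by (intro powr_mono) auto
  then have "d powr q \<le> 1" using False by simp
  then show ?thesis by (simp add: add_increasing2)
qed

lemma nn_integral_powr_half_symmetric:
  "(\<integral>\<^sup>+ w. ennreal (indicator {-1..1} w * \<bar>w\<bar> powr (- 1 / 2)) \<partial>lborel) \<le> ennreal 4"
proof -
  define k where "k w = ennreal (w powr (- 1 / 2)) * indicator {0..1} w" for w :: real
  have k [measurable]: "k \<in> borel_measurable borel" unfolding k_def by measurable
  have "((\<lambda>x. x powr (- 1 / 2)) has_integral (1 powr (- 1 / 2 + 1) / (- 1 / 2 + 1))) {0..1 :: real}"
    by (rule has_integral_powr_from_0) auto
  then have "((\<lambda>x. x powr (- 1 / 2)) has_integral 2) {0..1 :: real}" by simp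
  from nn_integral_has_integral_lebesgue'[OF _ this] have k2: "(\<integral>\<^sup>+ w. k w \<partial>lborel) = ennreal 2"
    unfolding k_def by simp
  have "(\<integral>\<^sup>+ w. k w \<partial>lborel) = ennreal \<bar>- 1\<bar> * (\<integral>\<^sup>+ w. k (0 + (- 1) * w) \<partial>lborel)"
    by (rule nn_integral_real_affine[OF k]) simp
  then have k2': "(\<integral>\<^sup>+ w. k (- w) \<partial>lborel) = ennreal 2" using k2 by simp
  have "(\<integral>\<^sup>+ w. ennreal (indicator {-1..1} w * \<bar>w\<bar> powr (- 1 / 2)) \<partial>lborel) \<le>
      (\<integral>\<^sup>+ w. k w + k (- w) \<partial>lborel)"
    by (intro nn_integral_mono) (auto simp: k_def indicator_def abs_if)
  also have "\<dots> = ennreal 2 + ennreal 2"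
    using k2 k2' by (subst nn_integral_add) auto
  finally show ?thesis by (simp add: ennreal_plus[symmetric] del: ennreal_plus)
qed

text \<open>Dominates the integrand of \<open>unit_potential\<close> for all H in [1/2,1) at once,
  as H - 1 \<ge> -1/2.\<close>

definition potential_bound :: "real \<Rightarrow> real \<Rightarrow> real" where
  "potential_bound u v = indicator {0..1} v * (1 + \<bar>u - v\<bar> powr (- 1 / 2))"

text \<open>The 6 is 2 + 4: twice the length of the interval, plus the integral of |w|^(-1/2) over
  [-1,1]. Translation makes it uniform in \<open>u\<close>.\<close>

lemma potential_bound:
  "integrable lborel (potential_bound u)" "(\<integral>v. potential_bound u v \<partial>lborel) \<le> 6"
proof -
  define k where "k w = ennreal (indicator {-1..1} w * \<bar>w\<bar> powr (- 1 / 2))" for w :: real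
  have k [measurable]: "k \<in> borel_measurable borel" unfolding k_def by measurable
  have [measurable]: "potential_bound u \<in> borel_measurable borel"
    unfolding potential_bound_def by measurable
  have "(\<integral>\<^sup>+ w. k w \<partial>lborel) = ennreal \<bar>- 1\<bar> * (\<integral>\<^sup>+ v. k (u + (- 1) * v) \<partial>lborel)"
    by (rule nn_integral_real_affine[OF k]) simp
  then have ku: "(\<integral>\<^sup>+ v. k (u - v) \<partial>lborel) \<le> ennreal 4"
    using nn_integral_powr_half_symmetric by (simp add: k_def)
  have "(\<integral>\<^sup>+ v. ennreal (potential_bound u v) \<partial>lborel) \<le> (\<integral>\<^sup>+ v. 2 * indicator {0..1} v + k (u - v) \<partial>lborel)"
  proof (intro nn_integral_mono)
    fix v
    have "\<bar>u - v\<bar> powr (- 1 / 2) \<le> 1 + indicator {-1..1} (u - v) * \<bar>u - v\<bar> powr (- 1 / 2)"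
    proof (cases "\<bar>u - v\<bar> \<le> 1")
      case False
      then have "\<bar>u - v\<bar> powr (- 1 / 2) \<le> \<bar>u - v\<bar> powr 0" by (intro powr_mono) auto
      then show ?thesis using False by (auto simp: indicator_def)
    qed (auto simp: indicator_def)
    then have "potential_bound u v \<le> 2 * indicator {0..1} v + indicator {-1..1} (u - v) * \<bar>u - v\<bar> powr (- 1 / 2)"
      by (auto simp: potential_bound_def indicator_def)
    then have "ennreal (potential_bound u v) \<le>
        ennreal (2 * indicator {0..1} v + indicator {-1..1} (u - v) * \<bar>u - v\<bar> powr (- 1 / 2))"
      by (rule ennreal_leI)
    also have "\<dots> = 2 * indicator {0..1} v + k (u - v)"
      by (subst ennreal_plus) (auto simp: k_def indicator_def)
    finally show "ennreal (potential_bound u v) \<le> 2 * indicator {0..1} v + k (u - v)" .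
  qed
  also have "\<dots> = 2 + (\<integral>\<^sup>+ v. k (u - v) \<partial>lborel)"
    by (subst nn_integral_add) (auto simp: nn_integral_cmult)
  also have "\<dots> \<le> 2 + ennreal 4" using ku by (intro add_left_mono)
  also have "\<dots> = ennreal 6" by (simp flip: ennreal_plus ennreal_numeral)
  finally have le: "(\<integral>\<^sup>+ v. ennreal (potential_bound u v) \<partial>lborel) \<le> ennreal 6" .
  have nonneg: "0 \<le> potential_bound u v" for v by (simp add: potential_bound_def)
  show "integrable lborel (potential_bound u)"
    using le nonneg by (intro integrableI_nonneg) (auto intro: le_less_trans)
  from nn_integral_eq_integral[OF this] le nonneg
  have "ennreal (\<integral>v. potential_bound u v \<partial>lborel) \<le> ennreal 6"
    by simp
  then show "(\<integral>v. potential_bound u v \<partial>lborel) \<le> 6"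
    by (subst (asm) ennreal_le_iff) auto
qed

text \<open>The Riesz potential of the unit interval. Up to the factor \<open>riesz_beta H\<close>
  it is the inner product of \<open>riesz H u\<close> with \<open>riesz_unit H\<close>.\<close>

definition unit_potential :: "real \<Rightarrow> real \<Rightarrow> real" where
  "unit_potential H u = (\<integral>v. indicator {0..1} v * \<bar>u - v\<bar> powr (H - 1) \<partial>lborel)"

lemma unit_potential:
  assumes H: "1 / 2 \<le> H" "H < 1"
  shows "integrable lborel (\<lambda>v. indicator {0..1} v * \<bar>u - v\<bar> powr (H - 1))"
    "0 \<le> unit_potential H u" "unit_potential H u \<le> 6"
    "(\<integral>\<^sup>+ v. ennreal (indicator {0..1} v * \<bar>u - v\<bar> powr (H - 1)) \<partial>lborel) = ennreal (unit_potential H u)"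
proof -
  have le: "indicator {0..1} v * \<bar>u - v\<bar> powr (H - 1) \<le> potential_bound u v" for v
    unfolding potential_bound_def using H by (intro mult_left_mono powr_le_one_plus_powr) auto
  show int: "integrable lborel (\<lambda>v. indicator {0..1} v * \<bar>u - v\<bar> powr (H - 1))"
  proof (rule Bochner_Integration.integrable_bound[OF potential_bound(1)[of u]])
    show "AE v in lborel. norm (indicator {0..1} v * \<bar>u - v\<bar> powr (H - 1)) \<le> norm (potential_bound u v)"
    proof (rule AE_I2)
      fix v
      show "norm (indicator {0..1} v * \<bar>u - v\<bar> powr (H - 1)) \<le> norm (potential_bound u v)"
        using le[of v] order_trans[OF le[of v] abs_ge_self] by (simp add: abs_mult)
    qed
  qed measurable
  show "0 \<le> unit_potential H u" unfolding unit_potential_def by (rule integral_nonneg_AE) simp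
  have "unit_potential H u \<le> (\<integral>v. potential_bound u v \<partial>lborel)"
    unfolding unit_potential_def by (rule integral_mono[OF int potential_bound(1) le])
  also note potential_bound(2)
  finally show "unit_potential H u \<le> 6" .
  show "(\<integral>\<^sup>+ v. ennreal (indicator {0..1} v * \<bar>u - v\<bar> powr (H - 1)) \<partial>lborel) = ennreal (unit_potential H u)"
    unfolding unit_potential_def using int by (intro nn_integral_eq_integral) auto
qed

lemma unit_potential_measurable [measurable]: "unit_potential H \<in> borel_measurable borel"
proof -
  have "(\<lambda>u. \<integral>v. indicator {0..1} v * \<bar>u - v\<bar> powr (H - 1) \<partial>lborel) \<in> borel_measurable borel"
    by (rule lborel.borel_measurable_lebesgue_integral) measurable
  then show ?thesis by (simp add: unit_potential_def[abs_def])
qed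

text \<open>The vector e of the overview without its scalar factor, the root of
  \<open>rosenblatt_const H\<close>.\<close>

definition riesz_unit :: "real \<Rightarrow> real \<Rightarrow> real" where
  "riesz_unit H y = (\<integral>v. indicator {0..1} v * riesz H v y \<partial>lborel)"

lemma riesz_unit_measurable [measurable]: "riesz_unit H \<in> borel_measurable borel"
proof -
  have "(\<lambda>y. \<integral>v. indicator {0..1} v * riesz H v y \<partial>lborel) \<in> borel_measurable borel"
    by (rule lborel.borel_measurable_lebesgue_integral) measurable
  then show ?thesis by (simp add: riesz_unit_def[abs_def])
qed

lemma riesz_unit_nonneg: "0 \<le> riesz_unit H y"
  unfolding riesz_unit_def by (rule integral_nonneg_AE) (simp add: riesz_nonneg)

definition unit_energy :: "real \<Rightarrow> real" where
  "unit_energy H = (\<integral>u. indicator {0..1} u * unit_potential H u \<partial>lborel)"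

lemma unit_energy:
  assumes H: "1 / 2 \<le> H" "H < 1"
  shows "(\<integral>\<^sup>+ u. ennreal (indicator {0..1} u * unit_potential H u) \<partial>lborel) = ennreal (unit_energy H)"
    "0 \<le> unit_energy H"
proof -
  have "integrable lborel (\<lambda>u. indicator {0..1} u * unit_potential H u)"
  proof (rule Bochner_Integration.integrable_bound)
    show "integrable lborel (\<lambda>u :: real. indicator {0..1} u * 6 :: real)" by simp
    show "AE u in lborel. norm (indicator {0..1} u * unit_potential H u) \<le> norm (indicator {0..1} u * 6 :: real)"
      using unit_potential(2,3)[OF H] by (intro AE_I2) (auto simp: indicator_def)
  qed measurable
  then show "(\<integral>\<^sup>+ u. ennreal (indicator {0..1} u * unit_potential H u) \<partial>lborel) = ennreal (unit_energy H)"
    unfolding unit_energy_def using unit_potential(2)[OF H] by (intro nn_integral_eq_integral) auto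
  show "0 \<le> unit_energy H"
    unfolding unit_energy_def using unit_potential(2)[OF H] by (intro integral_nonneg_AE) auto
qed

lemma riesz_unit_inner:
  assumes H: "1 / 2 < H" "H < 1"
  shows "(\<integral>\<^sup>+ y. ennreal (riesz H u y * riesz_unit H y) \<partial>lborel) = ennreal (riesz_beta H * unit_potential H u)"
    "sq_norm lborel (riesz_unit H) = ennreal (riesz_beta H * unit_energy H)"
proof -
  define \<beta> where "\<beta> = riesz_beta H"
  have \<beta>: "0 < \<beta>" unfolding \<beta>_def using H by (intro Beta_pos) auto
  have H': "1 / 2 \<le> H" "H < 1" using H by auto
  \<comment> \<open>The average of the Riesz kernels is taken with values in [0,\<infinity>], so
    that Tonelli's theorem applies before finiteness is known.\<close>
  define E where "E y = (\<integral>\<^sup>+ v. ennreal (indicator {0..1} v * riesz H v y) \<partial>lborel)" for y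
  have E_m [measurable]: "E \<in> borel_measurable borel"
  proof -
    have "(\<lambda>y. \<integral>\<^sup>+ v. ennreal (indicator {0..1} v * riesz H v y) \<partial>lborel) \<in> borel_measurable borel"
      by (rule lborel.borel_measurable_nn_integral) measurable
    then show ?thesis by (simp add: E_def[abs_def])
  qed
  have pot: "(\<integral>\<^sup>+ y. ennreal (riesz H u y) * E y \<partial>lborel) = ennreal (\<beta> * unit_potential H u)" for u
  proof -
    have "(\<integral>\<^sup>+ y. ennreal (riesz H u y) * E y \<partial>lborel) =
        (\<integral>\<^sup>+ y. (\<integral>\<^sup>+ v. ennreal (indicator {0..1} v * (riesz H u y * riesz H v y)) \<partial>lborel) \<partial>lborel)"
      unfolding E_def
      by (intro nn_integral_cong, subst nn_integral_cmult[symmetric])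
        (auto intro!: nn_integral_cong simp: ennreal_mult[symmetric] riesz_nonneg mult_ac)
    also have "\<dots> = (\<integral>\<^sup>+ v. (\<integral>\<^sup>+ y. ennreal (indicator {0..1} v * (riesz H u y * riesz H v y)) \<partial>lborel) \<partial>lborel)"
      by (rule lborel_pair.Fubini') measurable
    also have "\<dots> = (\<integral>\<^sup>+ v. ennreal \<beta> * ennreal (indicator {0..1} v * \<bar>u - v\<bar> powr (H - 1)) \<partial>lborel)"
    proof (rule nn_integral_cong_AE)
      show "AE v in lborel. (\<integral>\<^sup>+ y. ennreal (indicator {0..1} v * (riesz H u y * riesz H v y)) \<partial>lborel) =
          ennreal \<beta> * ennreal (indicator {0..1} v * \<bar>u - v\<bar> powr (H - 1))"
        using AE_lborel_singleton[of u]
      proof eventually_elim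
        fix v :: real assume "v \<noteq> u"
        then have "(\<integral>\<^sup>+ y. ennreal (riesz H u y * riesz H v y) \<partial>lborel) = ennreal (\<beta> * \<bar>u - v\<bar> powr (H - 1))"
          unfolding \<beta>_def using H by (intro nn_integral_riesz_product) auto
        then show "(\<integral>\<^sup>+ y. ennreal (indicator {0..1} v * (riesz H u y * riesz H v y)) \<partial>lborel) =
          ennreal \<beta> * ennreal (indicator {0..1} v * \<bar>u - v\<bar> powr (H - 1))"
          using \<beta> by (cases "v \<in> {0..1}") (auto simp: ennreal_mult)
      qed
    qed
    also have "\<dots> = ennreal \<beta> * ennreal (unit_potential H u)"
      by (subst nn_integral_cmult) (auto simp: unit_potential(4)[OF H'])
    also have "\<dots> = ennreal (\<beta> * unit_potential H u)"
      using \<beta> unit_potential(2)[OF H'] by (simp add: ennreal_mult)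
    finally show ?thesis .
  qed
  have EE: "(\<integral>\<^sup>+ y. E y * E y \<partial>lborel) = ennreal (\<beta> * unit_energy H)"
  proof -
    have "(\<integral>\<^sup>+ y. E y * E y \<partial>lborel) =
        (\<integral>\<^sup>+ y. (\<integral>\<^sup>+ v. ennreal (indicator {0..1} v) * (ennreal (riesz H v y) * E y) \<partial>lborel) \<partial>lborel)"
    proof (intro nn_integral_cong)
      fix y
      have "E y * E y = (\<integral>\<^sup>+ v. ennreal (indicator {0..1} v * riesz H v y) * E y \<partial>lborel)"
        by (subst nn_integral_multc) (auto simp: E_def)
      then show "E y * E y = (\<integral>\<^sup>+ v. ennreal (indicator {0..1} v) * (ennreal (riesz H v y) * E y) \<partial>lborel)"
        by (simp add: ennreal_mult riesz_nonneg mult.assoc)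
    qed
    also have "\<dots> = (\<integral>\<^sup>+ v. (\<integral>\<^sup>+ y. ennreal (indicator {0..1} v) * (ennreal (riesz H v y) * E y) \<partial>lborel) \<partial>lborel)"
      by (rule lborel_pair.Fubini') measurable
    also have "\<dots> = (\<integral>\<^sup>+ v. ennreal \<beta> * ennreal (indicator {0..1} v * unit_potential H v) \<partial>lborel)"
    proof (intro nn_integral_cong)
      fix v
      have "(\<integral>\<^sup>+ y. ennreal (indicator {0..1} v) * (ennreal (riesz H v y) * E y) \<partial>lborel) =
          ennreal (indicator {0..1} v) * ennreal (\<beta> * unit_potential H v)"
        by (subst nn_integral_cmult) (auto simp: pot)
      also have "\<dots> = ennreal \<beta> * ennreal (indicator {0..1} v * unit_potential H v)"
        using \<beta> unit_potential(2)[OF H'] by (simp add: ennreal_mult mult_ac)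
      finally show "(\<integral>\<^sup>+ y. ennreal (indicator {0..1} v) * (ennreal (riesz H v y) * E y) \<partial>lborel) =
          ennreal \<beta> * ennreal (indicator {0..1} v * unit_potential H v)" .
    qed
    also have "\<dots> = ennreal \<beta> * ennreal (unit_energy H)"
      by (subst nn_integral_cmult) (auto simp: unit_energy(1)[OF H'])
    also have "\<dots> = ennreal (\<beta> * unit_energy H)"
      using \<beta> unit_energy(2)[OF H'] by (simp add: ennreal_mult)
    finally show ?thesis .
  qed
  \<comment> \<open>The finite energy just computed shows that \<open>E\<close> is finite almost
    everywhere, and there it agrees with \<open>riesz_unit\<close>.\<close>
  have "AE y in lborel. E y * E y \<noteq> \<infinity>"
    using EE by (intro nn_integral_PInf_AE) auto
  then have fin: "AE y in lborel. E y = ennreal (riesz_unit H y)"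
  proof eventually_elim
    fix y assume "E y * E y \<noteq> \<infinity>"
    then have "E y < \<infinity>" by (auto simp: less_top ennreal_mult_eq_top_iff)
    then have int: "integrable lborel (\<lambda>v. indicator {0..1} v * riesz H v y)"
      unfolding E_def by (intro integrableI_nonneg) (auto simp: riesz_nonneg)
    show "E y = ennreal (riesz_unit H y)"
      unfolding E_def riesz_unit_def by (rule nn_integral_eq_integral[OF int]) (simp add: riesz_nonneg)
  qed
  have "(\<integral>\<^sup>+ y. ennreal (riesz H u y * riesz_unit H y) \<partial>lborel) = (\<integral>\<^sup>+ y. ennreal (riesz H u y) * E y \<partial>lborel)"
    by (intro nn_integral_cong_AE eventually_mono[OF fin]) (simp add: ennreal_mult riesz_nonneg riesz_unit_nonneg)
  then show "(\<integral>\<^sup>+ y. ennreal (riesz H u y * riesz_unit H y) \<partial>lborel) = ennreal (riesz_beta H * unit_potential H u)"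
    unfolding pot \<beta>_def .
  have "sq_norm lborel (riesz_unit H) = (\<integral>\<^sup>+ y. E y * E y \<partial>lborel)"
    unfolding sq_norm_def
    by (intro nn_integral_cong_AE eventually_mono[OF fin]) (simp add: power2_eq_square ennreal_mult riesz_unit_nonneg)
  then show "sq_norm lborel (riesz_unit H) = ennreal (riesz_beta H * unit_energy H)"
    unfolding EE \<beta>_def .
qed

section \<open>Inner products of mixtures of rank-one kernels\<close>

abbreviation pair_energy :: "(real \<Rightarrow> real) \<Rightarrow> real \<Rightarrow> real \<times> real \<Rightarrow> real" where
  "pair_energy f p w \<equiv> f (fst w) * f (snd w) * \<bar>fst w - snd w\<bar> powr p"

definition riesz_mixture :: "real \<Rightarrow> (real \<Rightarrow> real) \<Rightarrow> real \<times> real \<Rightarrow> real" where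
  "riesz_mixture H f z = (\<integral>u. f u * riesz H u (fst z) * riesz H u (snd z) \<partial>lborel)"

lemma nn_integral_tensor:
  fixes f g :: "real \<Rightarrow> ennreal"
  assumes [measurable]: "f \<in> borel_measurable borel" "g \<in> borel_measurable borel"
  shows "(\<integral>\<^sup>+ z. f (fst z) * g (snd z) \<partial>lborel2) = (\<integral>\<^sup>+ x. f x \<partial>lborel) * (\<integral>\<^sup>+ y. g y \<partial>lborel)"
proof -
  have "(\<integral>\<^sup>+ z. f (fst z) * g (snd z) \<partial>lborel2) = (\<integral>\<^sup>+ x. (\<integral>\<^sup>+ y. f x * g y \<partial>lborel) \<partial>lborel)"
    by (subst lborel.nn_integral_fst[symmetric]) auto
  then show ?thesis
    by (simp add: nn_integral_cmult nn_integral_multc)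
qed

lemma integral_tensor_square:
  fixes r :: "real \<Rightarrow> real"
  assumes [measurable]: "r \<in> borel_measurable borel" and r: "\<And>y. 0 \<le> r y"
    and A: "(\<integral>\<^sup>+ y. ennreal (r y) \<partial>lborel) = ennreal A" "0 \<le> A"
  shows "(\<integral>\<^sup>+ z. ennreal (r (fst z) * r (snd z)) \<partial>lborel2) = ennreal (A\<^sup>2)"
    "(\<integral>z. r (fst z) * r (snd z) \<partial>lborel2) = A\<^sup>2"
proof -
  have "(\<integral>\<^sup>+ z. ennreal (r (fst z) * r (snd z)) \<partial>lborel2) = ennreal A * ennreal A"
    using nn_integral_tensor[of "\<lambda>y. ennreal (r y)" "\<lambda>y. ennreal (r y)"] r A(1) by (simp add: ennreal_mult)
  then show nn: "(\<integral>\<^sup>+ z. ennreal (r (fst z) * r (snd z)) \<partial>lborel2) = ennreal (A\<^sup>2)"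
    using A(2) by (simp add: ennreal_mult power2_eq_square)
  show "(\<integral>z. r (fst z) * r (snd z) \<partial>lborel2) = A\<^sup>2"
    by (subst integral_eq_nn_integral) (auto simp: nn r)
qed

lemma riesz_mixture_measurable:
  assumes [measurable]: "f \<in> borel_measurable borel"
  shows "riesz_mixture H f \<in> borel_measurable lborel2"
proof -
  have "(\<lambda>z. \<integral>u. f u * riesz H u (fst z) * riesz H u (snd z) \<partial>lborel) \<in> borel_measurable lborel2"
    by (rule lborel.borel_measurable_lebesgue_integral) measurable
  then show ?thesis by (simp add: riesz_mixture_def[abs_def])
qed

lemma AE_lborel_pair_neq: "AE w in lborel2. fst w \<noteq> (snd w :: real)"
proof (rule lborel_pair.AE_pair_measure)
  show "{w \<in> space lborel2. fst w \<noteq> (snd w :: real)} \<in> sets lborel2"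
    by measurable
  have "AE y in lborel. x \<noteq> y" for x :: real
    using AE_lborel_singleton[of x] by eventually_elim auto
  then show "AE x in lborel. AE y in lborel. fst (x, y) \<noteq> (snd (x, y) :: real)"
    by simp
qed

text \<open>The inner product of g_u \<otimes> g_u and g_v \<otimes> g_v is the square of that of
  g_u and g_v, hence \<open>riesz_beta H\<close> squared times |u - v|^(2H-2). So the squared norm
  of the mixture is the energy of \<open>f\<close> that defines the norm of the integrand
  space.\<close>

lemma riesz_mixture_self_inner:
  assumes H: "1 / 2 < H" "H < 1" and f [measurable]: "f \<in> borel_measurable borel"
    and int: "integrable lborel2 (pair_energy f (2 * H - 2))"
  shows "integrable lborel2 (\<lambda>z. (riesz_mixture H f z)\<^sup>2)"
    "(\<integral>z. (riesz_mixture H f z)\<^sup>2 \<partial>lborel2) = (riesz_beta H)\<^sup>2 *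
      (\<integral>w. pair_energy f (2 * H - 2) w \<partial>lborel2)"
proof -
  define \<beta> where "\<beta> = riesz_beta H"
  have \<beta>: "0 < \<beta>" unfolding \<beta>_def using H by (intro Beta_pos) auto
  let ?L = lborel2
  have L: "sigma_finite_measure ?L" ..
  interpret LL: pair_sigma_finite ?L ?L ..
  define p where "p x = f (snd x) * riesz H (snd x) (fst (fst x)) * riesz H (snd x) (snd (fst x))"
    for x :: "(real \<times> real) \<times> real"
  have p [measurable]: "p \<in> borel_measurable (?L \<Otimes>\<^sub>M lborel)"
    unfolding p_def by measurable
  define r where "r w y = riesz H (fst w) y * riesz H (snd w) y" for w :: "real \<times> real" and y
  have pp: "p (z, fst w) * p (z, snd w) = f (fst w) * f (snd w) * (r w (fst z) * r w (snd z))" for z w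
    by (simp add: p_def r_def mult_ac)
  have r_nonneg: "0 \<le> r w y" for w y by (simp add: r_def riesz_nonneg)
  have r_meas [measurable]: "r w \<in> borel_measurable borel" for w unfolding r_def by measurable
  have r_int: "(\<integral>\<^sup>+ z. ennreal (r w (fst z) * r w (snd z)) \<partial>?L) = ennreal (\<beta>\<^sup>2 * \<bar>fst w - snd w\<bar> powr (2 * H - 2))"
    "(\<integral>z. r w (fst z) * r w (snd z) \<partial>?L) = \<beta>\<^sup>2 * \<bar>fst w - snd w\<bar> powr (2 * H - 2)"
    if "fst w \<noteq> snd w" for w
  proof -
    have "(\<integral>\<^sup>+ y. ennreal (r w y) \<partial>lborel) = ennreal (\<beta> * \<bar>fst w - snd w\<bar> powr (H - 1))"
      unfolding r_def \<beta>_def by (rule nn_integral_riesz_product[OF H that])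
    note sq = integral_tensor_square[OF r_meas r_nonneg this]
    have "(\<beta> * \<bar>fst w - snd w\<bar> powr (H - 1))\<^sup>2 = \<beta>\<^sup>2 * \<bar>fst w - snd w\<bar> powr (2 * H - 2)"
      by (simp add: power2_eq_square mult_ac powr_add[symmetric])
    then show "(\<integral>\<^sup>+ z. ennreal (r w (fst z) * r w (snd z)) \<partial>?L) = ennreal (\<beta>\<^sup>2 * \<bar>fst w - snd w\<bar> powr (2 * H - 2))"
      "(\<integral>z. r w (fst z) * r w (snd z) \<partial>?L) = \<beta>\<^sup>2 * \<bar>fst w - snd w\<bar> powr (2 * H - 2)"
      using sq \<beta> by simp_all
  qed
  define T where "T = (\<lambda>x. p (fst x, fst (snd x)) * p (fst x, snd (snd x)))"
  have T [measurable]: "T \<in> borel_measurable (?L \<Otimes>\<^sub>M ?L)"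
    unfolding T_def p_def by measurable
  \<comment> \<open>The products of Riesz kernels are nonnegative, so the absolute value falls on
    \<open>f\<close> alone. Integrating over \<open>z\<close> first reduces the claim to the energy
    of |f|.\<close>
  have intT: "integrable (?L \<Otimes>\<^sub>M ?L) T"
  proof (rule integrableI_bounded[OF T])
    have "(\<integral>\<^sup>+ x. ennreal (norm (T x)) \<partial>(?L \<Otimes>\<^sub>M ?L)) = (\<integral>\<^sup>+ w. (\<integral>\<^sup>+ z. ennreal (norm (T (z, w))) \<partial>?L) \<partial>?L)"
      by (rule LL.nn_integral_snd[symmetric]) measurable
    also have "\<dots> = (\<integral>\<^sup>+ w. ennreal (\<beta>\<^sup>2) * ennreal (norm (pair_energy f (2 * H - 2) w)) \<partial>?L)"
    proof (intro nn_integral_cong_AE eventually_mono[OF AE_lborel_pair_neq])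
      fix w :: "real \<times> real" assume w: "fst w \<noteq> snd w"
      have "(\<integral>\<^sup>+ z. ennreal (norm (T (z, w))) \<partial>?L) =
          (\<integral>\<^sup>+ z. ennreal \<bar>f (fst w) * f (snd w)\<bar> * ennreal (r w (fst z) * r w (snd z)) \<partial>?L)"
        unfolding T_def fst_conv snd_conv pp
        by (intro nn_integral_cong) (simp add: abs_mult r_nonneg ennreal_mult)
      also have "\<dots> = ennreal \<bar>f (fst w) * f (snd w)\<bar> * ennreal (\<beta>\<^sup>2 * \<bar>fst w - snd w\<bar> powr (2 * H - 2))"
        unfolding r_int(1)[OF w, symmetric] by (rule nn_integral_cmult) measurable
      also have "\<dots> = ennreal (\<beta>\<^sup>2) * ennreal (norm (pair_energy f (2 * H - 2) w))"
        by (simp add: ennreal_mult[symmetric] abs_mult mult_ac)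
      finally show "(\<integral>\<^sup>+ z. ennreal (norm (T (z, w))) \<partial>?L) =
          ennreal (\<beta>\<^sup>2) * ennreal (norm (pair_energy f (2 * H - 2) w))" .
    qed
    also have "\<dots> = ennreal (\<beta>\<^sup>2) * (\<integral>\<^sup>+ w. ennreal (norm (pair_energy f (2 * H - 2) w)) \<partial>?L)"
      by (rule nn_integral_cmult) measurable
    also have "\<dots> < \<infinity>"
      using int unfolding integrable_iff_bounded by (auto simp: ennreal_mult_less_top)
    finally show "(\<integral>\<^sup>+ x. ennreal (norm (T x)) \<partial>(?L \<Otimes>\<^sub>M ?L)) < \<infinity>" .
  qed
  then have intT': "integrable (?L \<Otimes>\<^sub>M ?L) (\<lambda>(z, w). p (z, fst w) * p (z, snd w))"
    by (simp add: T_def split_beta')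
  note mix = integral_mixture_product[OF L sigma_finite_lborel sigma_finite_lborel p p intT']
  have eq: "(\<integral>u. p (z, u) \<partial>lborel) * (\<integral>u. p (z, u) \<partial>lborel) = (riesz_mixture H f z)\<^sup>2" for z
    by (simp add: p_def riesz_mixture_def power2_eq_square)
  show "integrable ?L (\<lambda>z. (riesz_mixture H f z)\<^sup>2)"
    using mix(1) unfolding eq .
  have "(\<integral>z. (riesz_mixture H f z)\<^sup>2 \<partial>?L) = (\<integral>w. (\<integral>z. p (z, fst w) * p (z, snd w) \<partial>?L) \<partial>?L)"
    using mix(2) unfolding eq .
  also have "\<dots> = (\<integral>w. \<beta>\<^sup>2 * (pair_energy f (2 * H - 2) w) \<partial>?L)"
  proof (rule integral_cong_AE)
    have "(\<lambda>w. \<integral>z. T (z, w) \<partial>?L) \<in> borel_measurable ?L"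
      by (rule sigma_finite_measure.borel_measurable_lebesgue_integral[OF L]) measurable
    then show "(\<lambda>w. \<integral>z. p (z, fst w) * p (z, snd w) \<partial>?L) \<in> borel_measurable ?L"
      by (simp add: T_def)
    show "AE w in ?L. (\<integral>z. p (z, fst w) * p (z, snd w) \<partial>?L) =
        \<beta>\<^sup>2 * (pair_energy f (2 * H - 2) w)"
    proof (intro eventually_mono[OF AE_lborel_pair_neq])
      fix w :: "real \<times> real" assume w: "fst w \<noteq> snd w"
      show "(\<integral>z. p (z, fst w) * p (z, snd w) \<partial>?L) =
          \<beta>\<^sup>2 * (pair_energy f (2 * H - 2) w)"
        unfolding pp by (simp add: r_int(2)[OF w])
    qed
  qed measurable
  finally show "(\<integral>z. (riesz_mixture H f z)\<^sup>2 \<partial>?L) = (riesz_beta H)\<^sup>2 *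
      (\<integral>w. pair_energy f (2 * H - 2) w \<partial>?L)"
    by (simp add: \<beta>_def)
qed

text \<open>Pairing g_u \<otimes> g_u with the tensor square of \<open>riesz_unit\<close> gives the
  squared potential at \<open>u\<close>. The potential is at most 6, so the integrability of
  \<open>f\<close> settles Fubini's theorem.\<close>

lemma riesz_mixture_unit_inner:
  assumes H: "1 / 2 < H" "H < 1" and f: "integrable lborel f"
  shows "integrable lborel2 (\<lambda>z. riesz_mixture H f z * (riesz_unit H (fst z) * riesz_unit H (snd z)))"
    "(\<integral>z. riesz_mixture H f z * (riesz_unit H (fst z) * riesz_unit H (snd z)) \<partial>lborel2) =
      (riesz_beta H)\<^sup>2 * (\<integral>u. f u * (unit_potential H u)\<^sup>2 \<partial>lborel)"
proof -
  define \<beta> where "\<beta> = riesz_beta H"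
  have \<beta>: "0 < \<beta>" unfolding \<beta>_def using H by (intro Beta_pos) auto
  have H': "1 / 2 \<le> H" "H < 1" using H by auto
  have [measurable]: "f \<in> borel_measurable borel" using f by auto
  let ?L = lborel2
  have L: "sigma_finite_measure ?L" ..
  interpret LL: pair_sigma_finite ?L lborel ..
  define r where "r u y = riesz H u y * riesz_unit H y" for u y
  have r_nonneg: "0 \<le> r u y" for u y by (simp add: r_def riesz_nonneg riesz_unit_nonneg)
  have r_meas [measurable]: "r u \<in> borel_measurable borel" for u unfolding r_def by measurable
  have r_nn: "(\<integral>\<^sup>+ y. ennreal (r u y) \<partial>lborel) = ennreal (\<beta> * unit_potential H u)" for u
    unfolding r_def \<beta>_def by (rule riesz_unit_inner(1)[OF H])
  have "0 \<le> \<beta> * unit_potential H u" for u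
    using \<beta> unit_potential(2)[OF H'] by simp
  note r_int = integral_tensor_square[OF r_meas r_nonneg r_nn this, unfolded power_mult_distrib]
  define T where "T x = f (snd x) * (r (snd x) (fst (fst x)) * r (snd x) (snd (fst x)))" for x :: "(real \<times> real) \<times> real"
  have T [measurable]: "T \<in> borel_measurable (?L \<Otimes>\<^sub>M lborel)"
    unfolding T_def r_def by measurable
  have pot2: "(unit_potential H u)\<^sup>2 \<le> 36" for u
    using power_mono[OF unit_potential(3)[OF H'] unit_potential(2)[OF H'], of u 2] by simp
  have intT: "integrable (?L \<Otimes>\<^sub>M lborel) T"
  proof (rule integrableI_bounded[OF T])
    have "(\<integral>\<^sup>+ x. ennreal (norm (T x)) \<partial>(?L \<Otimes>\<^sub>M lborel)) = (\<integral>\<^sup>+ u. (\<integral>\<^sup>+ z. ennreal (norm (T (z, u))) \<partial>?L) \<partial>lborel)"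
      by (rule LL.nn_integral_snd[symmetric]) measurable
    also have "\<dots> \<le> (\<integral>\<^sup>+ u. ennreal (\<beta>\<^sup>2 * 36) * ennreal (norm (f u)) \<partial>lborel)"
    proof (rule nn_integral_mono)
      fix u
      have "(\<integral>\<^sup>+ z. ennreal (norm (T (z, u))) \<partial>?L) = (\<integral>\<^sup>+ z. ennreal \<bar>f u\<bar> * ennreal (r u (fst z) * r u (snd z)) \<partial>?L)"
        unfolding T_def fst_conv snd_conv
        by (intro nn_integral_cong) (simp add: abs_mult r_nonneg ennreal_mult)
      also have "\<dots> = ennreal \<bar>f u\<bar> * ennreal (\<beta>\<^sup>2 * (unit_potential H u)\<^sup>2)"
        unfolding r_int(1)[symmetric] by (rule nn_integral_cmult) measurable
      also have "\<dots> \<le> ennreal \<bar>f u\<bar> * ennreal (\<beta>\<^sup>2 * 36)"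
        using pot2[of u] by (intro mult_left_mono ennreal_leI) auto
      finally show "(\<integral>\<^sup>+ z. ennreal (norm (T (z, u))) \<partial>?L) \<le> ennreal (\<beta>\<^sup>2 * 36) * ennreal (norm (f u))"
        by (simp add: mult.commute)
    qed
    also have "\<dots> = ennreal (\<beta>\<^sup>2 * 36) * (\<integral>\<^sup>+ u. ennreal (norm (f u)) \<partial>lborel)"
      by (rule nn_integral_cmult) measurable
    also have "\<dots> < \<infinity>"
      using f unfolding integrable_iff_bounded by (auto simp: ennreal_mult_less_top)
    finally show "(\<integral>\<^sup>+ x. ennreal (norm (T x)) \<partial>(?L \<Otimes>\<^sub>M lborel)) < \<infinity>" .
  qed
  have eq: "(\<integral>u. T (z, u) \<partial>lborel) = riesz_mixture H f z * (riesz_unit H (fst z) * riesz_unit H (snd z))" for z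
  proof -
    have "(\<integral>u. T (z, u) \<partial>lborel) =
        (\<integral>u. (f u * riesz H u (fst z) * riesz H u (snd z)) * (riesz_unit H (fst z) * riesz_unit H (snd z)) \<partial>lborel)"
      by (intro Bochner_Integration.integral_cong refl) (simp add: T_def r_def mult_ac)
    then show ?thesis by (simp add: riesz_mixture_def)
  qed
  show "integrable ?L (\<lambda>z. riesz_mixture H f z * (riesz_unit H (fst z) * riesz_unit H (snd z)))"
    using LL.integrable_fst'[OF intT] unfolding eq .
  have "(\<integral>z. riesz_mixture H f z * (riesz_unit H (fst z) * riesz_unit H (snd z)) \<partial>?L) =
      (\<integral>u. (\<integral>z. T (z, u) \<partial>?L) \<partial>lborel)"
    unfolding eq[symmetric] using LL.Fubini_integral[of "\<lambda>z u. T (z, u)"] intT by simp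
  also have "\<dots> = (\<integral>u. \<beta>\<^sup>2 * (f u * (unit_potential H u)\<^sup>2) \<partial>lborel)"
  proof (intro Bochner_Integration.integral_cong refl)
    fix u
    show "(\<integral>z. T (z, u) \<partial>?L) = \<beta>\<^sup>2 * (f u * (unit_potential H u)\<^sup>2)"
      by (simp add: T_def r_int(2))
  qed
  finally show "(\<integral>z. riesz_mixture H f z * (riesz_unit H (fst z) * riesz_unit H (snd z)) \<partial>?L) =
      (riesz_beta H)\<^sup>2 * (\<integral>u. f u * (unit_potential H u)\<^sup>2 \<partial>lborel)"
    by (simp add: \<beta>_def)
qed

section \<open>The limit of the Rosenblatt kernels\<close>

lemma tendsto_powr_one:
  assumes "p \<longlonglongrightarrow> 0" and "d \<noteq> (0 :: real)"
  shows "(\<lambda>n. \<bar>d\<bar> powr p n) \<longlonglongrightarrow> 1"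
proof -
  have "(\<lambda>n. \<bar>d\<bar> powr p n) \<longlonglongrightarrow> \<bar>d\<bar> powr 0"
    using assms by (intro tendsto_powr tendsto_const) auto
  then show ?thesis using assms(2) by simp
qed

lemma unit_potential_tendsto:
  assumes H: "\<And>n. 1 / 2 \<le> H n" "\<And>n. H n < 1" and lim: "H \<longlonglongrightarrow> 1"
  shows "(\<lambda>n. unit_potential (H n) u) \<longlonglongrightarrow> 1"
proof -
  have "(\<lambda>n. H n - 1) \<longlonglongrightarrow> 1 - 1" by (intro tendsto_intros lim)
  then have lim0: "(\<lambda>n. H n - 1) \<longlonglongrightarrow> 0" by simp
  have "(\<lambda>n. unit_potential (H n) u) \<longlonglongrightarrow> (\<integral>v. indicator {0..1 :: real} v \<partial>lborel)"
    unfolding unit_potential_def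
  proof (rule integral_dominated_convergence[where w="potential_bound u"])
    show "integrable lborel (potential_bound u)" by (rule potential_bound)
    show "AE v in lborel. (\<lambda>n. indicator {0..1} v * \<bar>u - v\<bar> powr (H n - 1)) \<longlonglongrightarrow> indicator {0..1} v"
      using AE_lborel_singleton[of u]
    proof eventually_elim
      fix v :: real assume "v \<noteq> u"
      then have "u - v \<noteq> 0" by simp
      from tendsto_mult[OF tendsto_const tendsto_powr_one[OF lim0 this], of "indicator {0..1} v"]
      show "(\<lambda>n. indicator {0..1} v * \<bar>u - v\<bar> powr (H n - 1)) \<longlonglongrightarrow> indicator {0..1} v" by simp
    qed
    show "AE v in lborel. norm (indicator {0..1} v * \<bar>u - v\<bar> powr (H n - 1)) \<le> potential_bound u v" for n
    proof (rule AE_I2)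
      fix v
      have "indicator {0..1} v * \<bar>u - v\<bar> powr (H n - 1) \<le> potential_bound u v"
        unfolding potential_bound_def using H[of n] less_imp_le[OF H(2)[of n]]
        by (intro mult_left_mono powr_le_one_plus_powr) auto
      then show "norm (indicator {0..1} v * \<bar>u - v\<bar> powr (H n - 1)) \<le> potential_bound u v"
        by (simp add: abs_mult)
    qed
  qed measurable
  then show ?thesis by simp
qed

lemma unit_energy_tendsto:
  assumes H: "\<And>n. 1 / 2 \<le> H n" "\<And>n. H n < 1" and lim: "H \<longlonglongrightarrow> 1"
  shows "(\<lambda>n. unit_energy (H n)) \<longlonglongrightarrow> 1"
proof -
  have "(\<lambda>n. unit_energy (H n)) \<longlonglongrightarrow> (\<integral>u. indicator {0..1 :: real} u * 1 \<partial>lborel)"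
    unfolding unit_energy_def
  proof (rule integral_dominated_convergence[where w="\<lambda>u. indicator {0..1} u * 6"])
    show "AE u in lborel. (\<lambda>n. indicator {0..1} u * unit_potential (H n) u) \<longlonglongrightarrow> indicator {0..1} u * 1"
      by (intro AE_I2 tendsto_mult tendsto_const unit_potential_tendsto H lim)
    show "AE u in lborel. norm (indicator {0..1} u * unit_potential (H n) u) \<le> indicator {0..1} u * 6" for n
      using unit_potential(2,3)[OF H(1)[of n] H(2)[of n]] by (intro AE_I2) (auto simp: indicator_def)
    show "integrable lborel (\<lambda>u :: real. indicator {0..1} u * 6 :: real)" by simp
  qed measurable
  then show ?thesis by simp
qed

lemma integral_unit_potential_square_tendsto:
  assumes H: "\<And>n. 1 / 2 \<le> H n" "\<And>n. H n < 1" and lim: "H \<longlonglongrightarrow> 1" and f: "integrable lborel f"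
  shows "(\<lambda>n. \<integral>u. f u * (unit_potential (H n) u)\<^sup>2 \<partial>lborel) \<longlonglongrightarrow> (\<integral>u. f u \<partial>lborel)"
proof -
  have [measurable]: "f \<in> borel_measurable borel" using f by auto
  have "(\<lambda>n. \<integral>u. f u * (unit_potential (H n) u)\<^sup>2 \<partial>lborel) \<longlonglongrightarrow> (\<integral>u. f u * 1\<^sup>2 \<partial>lborel)"
  proof (rule integral_dominated_convergence[where w="\<lambda>u. \<bar>f u\<bar> * 36"])
    show "AE u in lborel. (\<lambda>n. f u * (unit_potential (H n) u)\<^sup>2) \<longlonglongrightarrow> f u * 1\<^sup>2"
      by (intro AE_I2 tendsto_mult tendsto_power tendsto_const unit_potential_tendsto H lim)
    show "AE u in lborel. norm (f u * (unit_potential (H n) u)\<^sup>2) \<le> \<bar>f u\<bar> * 36" for n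
    proof (rule AE_I2)
      fix u
      have "(unit_potential (H n) u)\<^sup>2 \<le> 6\<^sup>2"
        using unit_potential(2,3)[OF H(1)[of n] H(2)[of n], of u] by (intro power_mono)
      then have "\<bar>f u\<bar> * (unit_potential (H n) u)\<^sup>2 \<le> \<bar>f u\<bar> * 36" by (intro mult_left_mono) auto
      then show "norm (f u * (unit_potential (H n) u)\<^sup>2) \<le> \<bar>f u\<bar> * 36" by (simp add: abs_mult)
    qed
    show "integrable lborel (\<lambda>u. \<bar>f u\<bar> * 36)" using f by simp
  qed measurable
  then show ?thesis by simp
qed

lemma integrable_tensor:
  fixes f :: "real \<Rightarrow> real"
  assumes f: "integrable lborel f"
  shows "integrable lborel2 (\<lambda>w. f (fst w) * f (snd w))"
    "(\<integral>w. f (fst w) * f (snd w) \<partial>lborel2) = (\<integral>u. f u \<partial>lborel)\<^sup>2"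
proof -
  have [measurable]: "f \<in> borel_measurable borel" using f by auto
  show int: "integrable lborel2 (\<lambda>w. f (fst w) * f (snd w))"
  proof (rule lborel_pair.Fubini_integrable)
    show "integrable lborel (\<lambda>x. \<integral>y. norm (f (fst (x, y)) * f (snd (x, y))) \<partial>lborel)"
      using f by (simp add: abs_mult)
    show "AE x in lborel. integrable lborel (\<lambda>y. f (fst (x, y)) * f (snd (x, y)))"
      using f by (intro AE_I2) simp
  qed measurable
  show "(\<integral>w. f (fst w) * f (snd w) \<partial>lborel2) = (\<integral>u. f u \<partial>lborel)\<^sup>2"
    using lborel_pair.integral_fst'[OF int] by (simp add: power2_eq_square)
qed

text \<open>The finite energy with exponent 2\<epsilon> - 1 supplies the dominating function: H
  \<ge> 1/2 + \<epsilon> means 2H - 2 \<ge> 2\<epsilon> - 1, and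
  \<open>powr_le_one_plus_powr\<close> covers all these exponents at once.\<close>

lemma energy_integral_tendsto:
  fixes f :: "real \<Rightarrow> real"
  assumes f: "integrable lborel f"
    and en: "integrable lborel2 (\<lambda>w. \<bar>f (fst w) * f (snd w)\<bar> * \<bar>fst w - snd w\<bar> powr (2 * \<epsilon> - 1))"
    and H: "\<And>n. 1 / 2 + \<epsilon> \<le> H n" "\<And>n. H n < 1" and lim: "H \<longlonglongrightarrow> 1"
  shows "\<And>n. integrable lborel2 (\<lambda>w. pair_energy f (2 * H n - 2) w)"
    "(\<lambda>n. \<integral>w. pair_energy f (2 * H n - 2) w \<partial>lborel2)
      \<longlonglongrightarrow> (\<integral>u. f u \<partial>lborel)\<^sup>2"
proof -
  let ?L = lborel2
  have [measurable]: "f \<in> borel_measurable borel" using f by auto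
  define W where "W w = \<bar>f (fst w) * f (snd w)\<bar> + \<bar>f (fst w) * f (snd w)\<bar> * \<bar>fst w - snd w\<bar> powr (2 * \<epsilon> - 1)" for w
  have W: "integrable ?L W"
    unfolding W_def using integrable_abs[OF integrable_tensor(1)[OF f]] en by (rule Bochner_Integration.integrable_add)
  have le: "norm (pair_energy f (2 * H n - 2) w) \<le> W w" for n w
  proof -
    have "\<bar>fst w - snd w\<bar> powr (2 * H n - 2) \<le> 1 + \<bar>fst w - snd w\<bar> powr (2 * \<epsilon> - 1)"
      using H[of n] by (intro powr_le_one_plus_powr) auto
    then have "\<bar>f (fst w) * f (snd w)\<bar> * \<bar>fst w - snd w\<bar> powr (2 * H n - 2) \<le>
        \<bar>f (fst w) * f (snd w)\<bar> * (1 + \<bar>fst w - snd w\<bar> powr (2 * \<epsilon> - 1))"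
      by (intro mult_left_mono) auto
    then show ?thesis by (simp add: W_def abs_mult distrib_left)
  qed
  show "integrable ?L (\<lambda>w. pair_energy f (2 * H n - 2) w)" for n
  proof (rule Bochner_Integration.integrable_bound[OF W])
    show "AE w in ?L. norm (pair_energy f (2 * H n - 2) w) \<le> norm (W w)"
      using order_trans[OF le abs_ge_self] by (intro AE_I2) auto
  qed measurable
  have "(\<lambda>n. 2 * H n - 2) \<longlonglongrightarrow> 2 * 1 - 2" by (intro tendsto_intros lim)
  then have lim0: "(\<lambda>n. 2 * H n - 2) \<longlonglongrightarrow> 0" by simp
  have "(\<lambda>n. \<integral>w. pair_energy f (2 * H n - 2) w \<partial>?L)
      \<longlonglongrightarrow> (\<integral>w. f (fst w) * f (snd w) \<partial>?L)"
  proof (rule integral_dominated_convergence[OF _ _ W])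
    show "AE w in ?L. (\<lambda>n. pair_energy f (2 * H n - 2) w) \<longlonglongrightarrow> f (fst w) * f (snd w)"
      using AE_lborel_pair_neq
    proof eventually_elim
      fix w :: "real \<times> real" assume "fst w \<noteq> snd w"
      then have "fst w - snd w \<noteq> 0" by simp
      from tendsto_mult[OF tendsto_const tendsto_powr_one[OF lim0 this], of "f (fst w) * f (snd w)"]
      show "(\<lambda>n. pair_energy f (2 * H n - 2) w) \<longlonglongrightarrow> f (fst w) * f (snd w)"
        by simp
    qed
    show "AE w in ?L. norm (pair_energy f (2 * H n - 2) w) \<le> W w" for n
      by (intro AE_I2 le)
  qed measurable
  then show "(\<lambda>n. \<integral>w. pair_energy f (2 * H n - 2) w \<partial>?L)
      \<longlonglongrightarrow> (\<integral>u. f u \<partial>lborel)\<^sup>2"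
    by (simp add: integrable_tensor(2)[OF f])
qed

text \<open>The normalization cancels the beta function, which is unbounded as H tends to 1. The
  product tends to 1/sqrt 2, the constant of the limit law.\<close>

lemma rosenblatt_const_Beta:
  assumes "1 / 2 < H" "H < 1"
  shows "0 < rosenblatt_const H" "rosenblatt_const H * riesz_beta H = sqrt (H * (2 * H - 1) / 2)"
proof -
  have \<beta>: "0 < riesz_beta H" using assms by (intro Beta_pos) auto
  then show "0 < rosenblatt_const H"
    using assms by (simp add: rosenblatt_const_def)
  show "rosenblatt_const H * riesz_beta H = sqrt (H * (2 * H - 1) / 2)"
    using \<beta> by (simp add: rosenblatt_const_def real_sqrt_divide real_sqrt_mult)
qed

text \<open>Each of the three inner products in the expansion carries the factor
  \<open>riesz_beta H\<close> squared, so the constant of the kernel cancels it and only H (2H - 1)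
  / 2 remains. With \<open>F = 0\<close> the formula is the squared norm of the kernel
  itself.\<close>

lemma sq_norm_mixture_minus_tensor:
  fixes F :: real
  assumes H: "1 / 2 < H" "H < 1" and f: "integrable lborel f"
    and int: "integrable lborel2 (pair_energy f (2 * H - 2))"
  shows "sq_norm lborel (\<lambda>z. rosenblatt_const H * riesz_mixture H f z -
      F * (sqrt (rosenblatt_const H) * riesz_unit H (fst z) * (sqrt (rosenblatt_const H) * riesz_unit H (snd z)))) =
    ennreal (H * (2 * H - 1) / 2 *
      ((\<integral>w. pair_energy f (2 * H - 2) w \<partial>lborel2)
       - 2 * F * (\<integral>u. f u * (unit_potential H u)\<^sup>2 \<partial>lborel) + F\<^sup>2 * (unit_energy H)\<^sup>2))"
proof -
  let ?L = lborel2
  define c where "c = rosenblatt_const H"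
  define \<beta> where "\<beta> = riesz_beta H"
  have c: "0 < c" "c * \<beta> = sqrt (H * (2 * H - 1) / 2)"
    using rosenblatt_const_Beta[OF H] by (simp_all add: c_def \<beta>_def)
  have cb: "c\<^sup>2 * \<beta>\<^sup>2 = H * (2 * H - 1) / 2"
    using H unfolding power_mult_distrib[symmetric] c(2) by simp
  have \<beta>: "0 < \<beta>" unfolding \<beta>_def using H by (intro Beta_pos) auto
  have H': "1 / 2 \<le> H" "H < 1" using H by auto
  have fm: "f \<in> borel_measurable borel" using f by auto
  define X where "X = riesz_mixture H f"
  define U where "U z = riesz_unit H (fst z) * riesz_unit H (snd z)" for z
  define I where "I = (\<integral>w. pair_energy f (2 * H - 2) w \<partial>?L)"
  define J where "J = (\<integral>u. f u * (unit_potential H u)\<^sup>2 \<partial>lborel)"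
  have XX: "integrable ?L (\<lambda>z. (X z)\<^sup>2)" "(\<integral>z. (X z)\<^sup>2 \<partial>?L) = \<beta>\<^sup>2 * I"
    unfolding X_def I_def \<beta>_def using riesz_mixture_self_inner[OF H fm int] by auto
  have XU: "integrable ?L (\<lambda>z. X z * U z)" "(\<integral>z. X z * U z \<partial>?L) = \<beta>\<^sup>2 * J"
    unfolding X_def U_def J_def \<beta>_def using riesz_mixture_unit_inner[OF H f] by auto
  have "(\<integral>\<^sup>+ z. ennreal ((U z)\<^sup>2) \<partial>?L) = ennreal (\<beta> * unit_energy H) * ennreal (\<beta> * unit_energy H)"
  proof -
    have "sq_norm lborel U = ennreal (\<beta> * unit_energy H) * ennreal (\<beta> * unit_energy H)"
      unfolding U_def[abs_def] \<beta>_def riesz_unit_inner(2)[OF H, symmetric] by (rule sq_norm_prod) measurable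
    then show ?thesis by (simp add: sq_norm_def lborel_prod)
  qed
  also have "\<dots> = ennreal (\<beta>\<^sup>2 * (unit_energy H)\<^sup>2)"
    using \<beta> unit_energy(2)[OF H'] by (simp add: ennreal_mult[symmetric] power2_eq_square mult_ac)
  finally have nnU: "(\<integral>\<^sup>+ z. ennreal ((U z)\<^sup>2) \<partial>?L) = ennreal (\<beta>\<^sup>2 * (unit_energy H)\<^sup>2)" .
  have Um: "(\<lambda>z. (U z)\<^sup>2) \<in> borel_measurable ?L" unfolding U_def by measurable
  have UU: "integrable ?L (\<lambda>z. (U z)\<^sup>2)" "(\<integral>z. (U z)\<^sup>2 \<partial>?L) = \<beta>\<^sup>2 * (unit_energy H)\<^sup>2"
  proof -
    show "integrable ?L (\<lambda>z. (U z)\<^sup>2)"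
      using nnU Um by (intro integrableI_nonneg) auto
    show "(\<integral>z. (U z)\<^sup>2 \<partial>?L) = \<beta>\<^sup>2 * (unit_energy H)\<^sup>2"
      using Um by (subst integral_eq_nn_integral) (auto simp: nnU)
  qed
  have eq: "(c * X z - F * (sqrt c * riesz_unit H (fst z) * (sqrt c * riesz_unit H (snd z))))\<^sup>2 =
      c\<^sup>2 * ((X z)\<^sup>2 - 2 * F * (X z * U z) + F\<^sup>2 * (U z)\<^sup>2)" for z
  proof -
    have "sqrt c * riesz_unit H (fst z) * (sqrt c * riesz_unit H (snd z)) = (sqrt c * sqrt c) * U z"
      by (simp add: U_def mult_ac)
    also have "sqrt c * sqrt c = c" using c(1) by simp
    finally show ?thesis by (simp add: power2_eq_square algebra_simps)
  qed
  have int_all: "integrable ?L (\<lambda>z. c\<^sup>2 * ((X z)\<^sup>2 - 2 * F * (X z * U z) + F\<^sup>2 * (U z)\<^sup>2))"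
    using XX(1) XU(1) UU(1) by (intro integrable_mult_right Bochner_Integration.integrable_add Bochner_Integration.integrable_diff)
  have "sq_norm lborel (\<lambda>z. c * X z - F * (sqrt c * riesz_unit H (fst z) * (sqrt c * riesz_unit H (snd z)))) =
      (\<integral>\<^sup>+ z. ennreal (c\<^sup>2 * ((X z)\<^sup>2 - 2 * F * (X z * U z) + F\<^sup>2 * (U z)\<^sup>2)) \<partial>?L)"
    unfolding sq_norm_def eq lborel_prod ..
  also have "\<dots> = ennreal (\<integral>z. c\<^sup>2 * ((X z)\<^sup>2 - 2 * F * (X z * U z) + F\<^sup>2 * (U z)\<^sup>2) \<partial>?L)"
    by (rule nn_integral_eq_integral[OF int_all]) (auto simp: eq[symmetric])
  also have "(\<integral>z. c\<^sup>2 * ((X z)\<^sup>2 - 2 * F * (X z * U z) + F\<^sup>2 * (U z)\<^sup>2) \<partial>?L) =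
      c\<^sup>2 * (\<beta>\<^sup>2 * I - 2 * F * (\<beta>\<^sup>2 * J) + F\<^sup>2 * (\<beta>\<^sup>2 * (unit_energy H)\<^sup>2))"
    using XX XU UU by simp
  also have "\<dots> = (c\<^sup>2 * \<beta>\<^sup>2) * (I - 2 * F * J + F\<^sup>2 * (unit_energy H)\<^sup>2)"
    by (simp add: algebra_simps)
  finally show ?thesis unfolding cb by (simp add: c_def X_def I_def J_def)
qed

text \<open>Passing from a Lebesgue measurable \<open>f\<close> to a Borel version changes the
  integrand only on a null set of \<open>u\<close>. The kernels therefore agree at every
  \<open>z\<close>, which makes the Rosenblatt kernel Borel measurable.\<close>

lemma rosenblatt_kernel_eq_mixture:
  assumes f: "f \<in> borel_measurable lebesgue" and g: "g \<in> borel_measurable borel"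
    and ae: "AE u in lborel. f u = g u"
  shows "rosenblatt_kernel H f z = rosenblatt_const H * riesz_mixture H g z"
proof -
  have r: "(\<lambda>u. riesz H u y) \<in> borel_measurable lborel" for y by measurable
  note r' = measurable_completion[OF r]
  have gl: "g \<in> borel_measurable lborel" using g by simp
  note g' = measurable_completion[OF gl]
  have "(LINT u|lebesgue. f u * riesz H u (fst z) * riesz H u (snd z)) =
      (LINT u|lebesgue. g u * riesz H u (fst z) * riesz H u (snd z))"
  proof (rule integral_cong_AE)
    show "AE u in lebesgue. f u * riesz H u (fst z) * riesz H u (snd z) = g u * riesz H u (fst z) * riesz H u (snd z)"
      using ae by (intro AE_completion) (auto elim: eventually_mono)
  qed (intro borel_measurable_times f g' r')+
  also have "\<dots> = (LINT u|lborel. g u * riesz H u (fst z) * riesz H u (snd z))"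
    by (rule integral_completion) (intro borel_measurable_times gl r)
  finally show ?thesis
    by (simp add: rosenblatt_kernel_def riesz_mixture_def riesz_def case_prod_beta)
qed

lemma weak_conv_m_offset:
  assumes "weak_conv_m (\<lambda>n. \<mu> (n + N)) \<nu>"
  shows "weak_conv_m \<mu> \<nu>"
  using assms unfolding weak_conv_m_def weak_conv_def by (auto intro: LIMSEQ_offset[where k=N])

text \<open>The assumption \<open>pos\<close> makes the squared norm of e positive, so that the
  approximating normal variables are nondegenerate. It holds for H near 1, where the energy of the
  unit interval is close to 1.\<close>

theorem (in wiener_process) rosenblatt_limit:
  fixes g :: "real \<Rightarrow> real"
  assumes f: "f \<in> borel_measurable lebesgue" and g: "integrable lborel g"
    and ae: "AE u in lborel. f u = g u" and \<epsilon>: "0 < \<epsilon>"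
    and en: "integrable lborel2 (\<lambda>w. \<bar>g (fst w) * g (snd w)\<bar> * \<bar>fst w - snd w\<bar> powr (2 * \<epsilon> - 1))"
    and H: "\<And>n. 1 / 2 + \<epsilon> \<le> H n" "\<And>n. H n < 1" and lim: "H \<longlonglongrightarrow> 1"
    and pos: "\<And>n. 0 < unit_energy (H n)"
  shows "weak_conv_m (\<lambda>n. distr M borel (wiener_rosenblatt_integral M B (H n) f))
    (distr std_normal_distribution borel (\<lambda>z. (\<integral>u. g u \<partial>lborel) * sqrt (1 / 2) * (z\<^sup>2 - 1)))"
proof -
  have H1: "1 / 2 < H n" and H2: "1 / 2 \<le> H n" for n using H(1)[of n] \<epsilon> by auto
  have gm: "g \<in> borel_measurable borel" using g by auto
  define F where "F = (\<integral>u. g u \<partial>lborel)"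
  define c where "c n = rosenblatt_const (H n)" for n
  define h where "h n = rosenblatt_kernel (H n) f" for n
  define e where "e n y = sqrt (c n) * riesz_unit (H n) y" for n y
  define E where "E n = c n * (riesz_beta (H n) * unit_energy (H n))" for n
  define I where "I n = (\<integral>w. pair_energy g (2 * H n - 2) w \<partial>lborel2)" for n
  define J where "J n = (\<integral>u. g u * (unit_potential (H n) u)\<^sup>2 \<partial>lborel)" for n
  have c: "0 < c n" for n unfolding c_def by (rule rosenblatt_const_Beta(1)[OF H1 H(2)])
  note int = energy_integral_tendsto(1)[OF g en H lim]
  have h_eq: "h n = (\<lambda>z. c n * riesz_mixture (H n) g z)" for n
    unfolding h_def c_def by (intro ext rosenblatt_kernel_eq_mixture[OF f gm ae])
  have \<kappa>: "(\<lambda>n. H n * (2 * H n - 1) / 2) \<longlonglongrightarrow> 1 * (2 * 1 - 1) / 2"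
    by (intro tendsto_intros lim) simp
  have "weak_conv_m (\<lambda>n. distr M borel (double_wiener_integral M B (h n)))
      (distr std_normal_distribution borel (\<lambda>z. F * sqrt (1 / 2) * (z\<^sup>2 - 1)))"
  proof (rule second_chaos_limit)
    have mix: "riesz_mixture (H n) g \<in> borel_measurable borel" for n
      using riesz_mixture_measurable[OF gm, of "H n"] by (simp add: lborel_prod)
    then show "h n \<in> borel_measurable borel" for n
      unfolding h_eq by (intro borel_measurable_times borel_measurable_const)
    \<comment> \<open>The distance formula with \<open>F = 0\<close> yields the norm of the
      kernel.\<close>
    show "sq_norm lborel (h n) < \<infinity>" for n
      using sq_norm_mixture_minus_tensor[OF H1 H(2) g int, of n 0] unfolding h_eq c_def by simp
    show "e n \<in> borel_measurable borel" for n
      unfolding e_def by (intro borel_measurable_times borel_measurable_const riesz_unit_measurable)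
    show "sq_norm lborel (e n) = ennreal (E n)" for n
    proof -
      have "sq_norm lborel (e n) = ennreal ((sqrt (c n))\<^sup>2) * ennreal (riesz_beta (H n) * unit_energy (H n))"
        unfolding e_def riesz_unit_inner(2)[OF H1 H(2), symmetric] by (rule sq_norm_cmult) simp
      also have "\<dots> = ennreal (E n)"
        using c[of n] by (simp add: E_def ennreal_mult')
      finally show ?thesis .
    qed
    have E_eq: "E n = sqrt (H n * (2 * H n - 1) / 2) * unit_energy (H n)" for n
      unfolding E_def c_def mult.assoc[symmetric] rosenblatt_const_Beta(2)[OF H1 H(2)] ..
    show "0 < E n" for n
      unfolding E_eq using pos[of n] H1[of n] by (intro mult_pos_pos) auto
    show "E \<longlonglongrightarrow> sqrt (1 / 2)"
      using tendsto_mult[OF tendsto_real_sqrt[OF \<kappa>] unit_energy_tendsto[OF H2 H(2) lim]]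
      by (simp add: E_eq[abs_def])
    have sq: "sq_norm lborel (\<lambda>z. h n z - F * (e n (fst z) * e n (snd z))) =
        ennreal (H n * (2 * H n - 1) / 2 * (I n - 2 * F * J n + F\<^sup>2 * (unit_energy (H n))\<^sup>2))" for n
      using sq_norm_mixture_minus_tensor[OF H1 H(2) g int, of n F]
      unfolding h_eq e_def c_def I_def J_def .
    \<comment> \<open>Energy and cross term tend to F^2 and F, and the energy of the unit interval
      to 1. The bracket tends to F^2 - 2 F^2 + F^2 = 0, which is the asymptotic rank one.\<close>
    have "(\<lambda>n. H n * (2 * H n - 1) / 2 * (I n - 2 * F * J n + F\<^sup>2 * (unit_energy (H n))\<^sup>2)) \<longlonglongrightarrow>
        1 * (2 * 1 - 1) / 2 * (F\<^sup>2 - 2 * F * F + F\<^sup>2 * 1\<^sup>2)"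
      unfolding I_def J_def F_def
      by (intro tendsto_mult[OF \<kappa>] tendsto_add tendsto_diff tendsto_mult[OF tendsto_const] tendsto_power
          energy_integral_tendsto(2)[OF g en H lim] integral_unit_potential_square_tendsto[OF H2 H(2) lim g]
          unit_energy_tendsto[OF H2 H(2) lim])
    from tendsto_ennrealI[OF this]
    show "(\<lambda>n. sq_norm lborel (\<lambda>z. h n z - F * (e n (fst z) * e n (snd z)))) \<longlonglongrightarrow> 0"
      unfolding sq by (simp add: power2_eq_square)
  qed
  then show ?thesis
    by (simp add: h_def F_def wiener_rosenblatt_integral_def)
qed

text \<open>The passage H \<rightarrow> 1 from the left is expressed along arbitrary sequences. The
  filter yields the bounds on \<open>H n\<close> only eventually, so the limit theorem is applied to
  a tail of the sequence.\<close>

theorem proposition2: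
  fixes M :: "'a measure" and B :: "real \<Rightarrow> 'a \<Rightarrow> real"
    and f :: "real \<Rightarrow> real" and \<epsilon> :: real
  assumes "wiener_process M B"
    and "f \<in> borel_measurable lebesgue"
    and "integrable lebesgue f"
    and "0 < \<epsilon>" and "\<epsilon> < 1/2"
    and "(\<integral>\<^sup>+ u. \<integral>\<^sup>+ v. ennreal (\<bar>f u\<bar> * \<bar>f v\<bar> * \<bar>u - v\<bar> powr (2 * \<epsilon> - 1))
            \<partial>lebesgue \<partial>lebesgue) < \<infinity>"
  shows "\<forall>H :: nat \<Rightarrow> real. filterlim H (at_left 1) sequentially \<longrightarrow>
    weak_conv_m
      (\<lambda>n. distr M borel (wiener_rosenblatt_integral M B (H n) f))
      (distr std_normal_distribution borel
        (\<lambda>z. 1 / sqrt 2 * (LINT u|lebesgue. f u) * (z\<^sup>2 - 1)))"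
proof (intro allI impI)
  fix H :: "nat \<Rightarrow> real" assume H: "filterlim H (at_left 1) sequentially"
  interpret wiener_process M B by fact
  \<comment> \<open>A Borel version of \<open>f\<close>, for which the product measure and Fubini's
    theorem are available.\<close>
  obtain g where gm [measurable]: "g \<in> borel_measurable lborel" and ae: "AE u in lborel. f u = g u"
    using completion_ex_borel_measurable_real[OF assms(2)] by blast
  have gl: "g \<in> borel_measurable lebesgue" using gm by (rule measurable_completion)
  have ae': "AE u in lebesgue. f u = g u" using ae by (rule AE_completion)
  have g: "integrable lborel g"
    using assms(3) integrable_cong_AE[OF assms(2) gl ae'] integrable_completion[OF gm] by simp
  have int_f: "(LINT u|lebesgue. f u) = (\<integral>u. g u \<partial>lborel)"
    using integral_cong_AE[OF assms(2) gl ae'] integral_completion[OF gm] by simp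
  have en: "integrable (lborel \<Otimes>\<^sub>M lborel) (\<lambda>w. \<bar>g (fst w) * g (snd w)\<bar> * \<bar>fst w - snd w\<bar> powr (2 * \<epsilon> - 1))"
  proof (rule integrableI_nonneg)
    have "(\<integral>\<^sup>+ w. ennreal (\<bar>g (fst w) * g (snd w)\<bar> * \<bar>fst w - snd w\<bar> powr (2 * \<epsilon> - 1)) \<partial>(lborel \<Otimes>\<^sub>M lborel)) =
        (\<integral>\<^sup>+ u. \<integral>\<^sup>+ v. ennreal (\<bar>g u\<bar> * \<bar>g v\<bar> * \<bar>u - v\<bar> powr (2 * \<epsilon> - 1)) \<partial>lborel \<partial>lborel)"
      by (subst lborel.nn_integral_fst[symmetric]) (auto simp: abs_mult)
    also have "\<dots> = (\<integral>\<^sup>+ u. \<integral>\<^sup>+ v. ennreal (\<bar>f u\<bar> * \<bar>f v\<bar> * \<bar>u - v\<bar> powr (2 * \<epsilon> - 1)) \<partial>lborel \<partial>lborel)"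
    proof (rule nn_integral_cong_AE, rule eventually_mono[OF ae])
      fix u assume u: "f u = g u"
      show "(\<integral>\<^sup>+ v. ennreal (\<bar>g u\<bar> * \<bar>g v\<bar> * \<bar>u - v\<bar> powr (2 * \<epsilon> - 1)) \<partial>lborel) =
          (\<integral>\<^sup>+ v. ennreal (\<bar>f u\<bar> * \<bar>f v\<bar> * \<bar>u - v\<bar> powr (2 * \<epsilon> - 1)) \<partial>lborel)"
        by (intro nn_integral_cong_AE eventually_mono[OF ae]) (simp add: u)
    qed
    also have "\<dots> < \<infinity>" using assms(6) by (simp add: nn_integral_completion)
    finally show "(\<integral>\<^sup>+ w. ennreal (\<bar>g (fst w) * g (snd w)\<bar> * \<bar>fst w - snd w\<bar> powr (2 * \<epsilon> - 1)) \<partial>(lborel \<Otimes>\<^sub>M lborel)) < \<infinity>" .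
  qed auto
  have lim: "H \<longlonglongrightarrow> 1" and less: "eventually (\<lambda>n. H n < 1) sequentially"
    using H by (auto simp: filterlim_at elim: eventually_mono)
  \<comment> \<open>Here \<epsilon> < 1/2 enters: it places 1/2 + \<epsilon> below the limit
    1.\<close>
  have "eventually (\<lambda>n. 1 / 2 + \<epsilon> < H n) sequentially"
    by (rule order_tendstoD(1)[OF lim]) (use assms(5) in simp)
  with less have "eventually (\<lambda>n. 1 / 2 + \<epsilon> \<le> H n \<and> H n < 1) sequentially"
    by eventually_elim auto
  then obtain N where N: "\<And>n. 1 / 2 + \<epsilon> \<le> H (n + N) \<and> H (n + N) < 1"
    unfolding eventually_sequentially by (meson le_add2)
  have limN: "(\<lambda>n. H (n + N)) \<longlonglongrightarrow> 1" by (rule LIMSEQ_ignore_initial_segment[OF lim])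
  have half: "1 / 2 \<le> H (n + N)" "H (n + N) < 1" for n
    using N[of n] assms(4) by auto
  \<comment> \<open>A second shift, by \<open>K\<close>, comes on top of \<open>N\<close>: the
    convergence of the energy to 1 is stated for sequences that lie in [1/2,1) throughout, and its
    positivity is read off from that limit.\<close>
  have "eventually (\<lambda>n. 0 < unit_energy (H (n + N))) sequentially"
    by (rule order_tendstoD(1)[OF unit_energy_tendsto[OF half limN]]) simp
  then obtain K where K: "\<And>n. 0 < unit_energy (H (n + K + N))"
    unfolding eventually_sequentially by (meson le_add2)
  have limK: "(\<lambda>n. H (n + K + N)) \<longlonglongrightarrow> 1"
    using LIMSEQ_ignore_initial_segment[OF limN, of K] by simp
  have NK: "1 / 2 + \<epsilon> \<le> H (n + K + N)" "H (n + K + N) < 1" for n using N by auto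
  have "weak_conv_m (\<lambda>n. distr M borel (wiener_rosenblatt_integral M B (H (n + K + N)) f))
      (distr std_normal_distribution borel (\<lambda>z. (\<integral>u. g u \<partial>lborel) * sqrt (1 / 2) * (z\<^sup>2 - 1)))"
    by (rule rosenblatt_limit[OF assms(2) g ae assms(4) en NK limK K])
  then have "weak_conv_m (\<lambda>n. distr M borel (wiener_rosenblatt_integral M B (H (n + (K + N))) f))
      (distr std_normal_distribution borel (\<lambda>z. 1 / sqrt 2 * (LINT u|lebesgue. f u) * (z\<^sup>2 - 1)))"
    by (simp add: int_f real_sqrt_divide mult.commute add.assoc)
  then show "weak_conv_m (\<lambda>n. distr M borel (wiener_rosenblatt_integral M B (H n) f))
      (distr std_normal_distribution borel (\<lambda>z. 1 / sqrt 2 * (LINT u|lebesgue. f u) * (z\<^sup>2 - 1)))"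
    by (rule weak_conv_m_offset[where N="K + N"])
qed

end
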